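(* Let $(M,g)$ be a connected three-dimensional Riemannian manifold with Ricci tensor $R$ and scalar curvature $r=\mathrm{tr}\,R$. (i) $g$ admits a group $G_6$ of isometries with $r=0$ (locally isomorphic to $E(3)$) if and only if it admits a transitive $G_3$ of isometries of Bianchi-Behr type I. Moreover, in that case it admits a transitive $G_3$ of Bianchi-Behr type VII$_0$. (ii) $g$ admits a group $G_6$ of isometries with $r<0$ (locally isomorphic to $SO(3,1)$) if and only if it admits a transitive $G_3$ of isometries of Bianchi-Behr type V. Moreover, in that case it admits a transitive $G_3$ of Bianchi-Behr type VII$_h$. (iii) If $g$ admits a group $G_6$ of isometries with $r>0$ (locally isomorphic to $SO(4)$), then it admits a transitive $G_3$ of Bianchi-Behr type IX.
   Context: All considerations are local: "group of isometries $G_k$" refers to a $k$-dimensional Lie algebra of Killing vector fields defined near each point; it acts transitively if these fields span the tangent space at each point. Bianchi-Behr types: a three-dimensional Lie algebra (here, of Killing fields) is of the indicated type if it has a basis $\xi_1,\xi_2,\xi_3$ with the following brackets. I: all zero. V: $[\xi_1,\xi_2]=0$, $[\xi_2,\xi_3]=\xi_2$, $[\xi_3,\xi_1]=-\xi_1$. VII: $[\xi_1,\xi_2]=0$, $[\xi_2,\xi_3]=-\xi_1+q\xi_2$, $[\xi_3,\xi_1]=-\xi_2$, with $q^2<4$; it is type VII$_0$ if $q=0$ and type VII$_h$ if $q\neq0$, with $h=q^2/(4-q^2)$. IX: $[\xi_1,\xi_2]=\xi_3$, $[\xi_2,\xi_3]=\xi_1$, $[\xi_3,\xi_1]=\xi_2$.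 *)

theory Defs
  imports "HOL-Analysis.Analysis"
begin

section \<open>Smooth maps on open subsets of normed spaces\<close>

text \<open>Intended for open \<open>S\<close> only: the derivatives are taken in the full space.\<close>

primrec Ck_on :: "nat \<Rightarrow> 'a::real_normed_vector set \<Rightarrow> ('a \<Rightarrow> 'b::real_normed_vector) \<Rightarrow> bool" where
  "Ck_on 0 S f \<longleftrightarrow> continuous_on S f"
| "Ck_on (Suc k) S f \<longleftrightarrow>
     (\<forall>x\<in>S. f differentiable (at x)) \<and> (\<forall>v. Ck_on k S (\<lambda>x. frechet_derivative f (at x) v))"

definition smooth_on :: "'a::real_normed_vector set \<Rightarrow> ('a \<Rightarrow> 'b::real_normed_vector) \<Rightarrow> bool" where
  "smooth_on S f \<longleftrightarrow> (\<forall>k. Ck_on k S f)"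

definition partial :: "'n::finite \<Rightarrow> (real^'n \<Rightarrow> real) \<Rightarrow> real^'n \<Rightarrow> real" where
  "partial i f x = frechet_derivative f (at x) (axis i 1)"


section \<open>Smooth manifolds\<close>

text \<open>
  The underlying topological space of the manifold is the whole type \<open>'m\<close>. A chart is a pair of
  its domain and its coordinate map; the values of the latter off the domain are irrelevant.
\<close>

type_synonym ('m, 'n) chart = "'m set \<times> ('m \<Rightarrow> real^'n)"

definition chart_inv :: "('m, 'n::finite) chart \<Rightarrow> real^'n \<Rightarrow> 'm" where
  "chart_inv c = inv_into (fst c) (snd c)"

definition coords :: "('m, 'n::finite) chart \<Rightarrow> 'm set \<Rightarrow> (real^'n) set" where
  "coords c W = snd c ` (fst c \<inter> W)"

definition transition :: "('m, 'n::finite) chart \<Rightarrow> ('m, 'n) chart \<Rightarrow> real^'n \<Rightarrow> real^'n" where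
  "transition c d = snd d \<circ> chart_inv c"

definition jacobian :: "('m, 'n::finite) chart \<Rightarrow> ('m, 'n) chart \<Rightarrow> real^'n \<Rightarrow> real^'n^'n" where
  "jacobian c d x = matrix (frechet_derivative (transition c d) (at x))"

definition is_chart :: "('m::topological_space, 'n::finite) chart \<Rightarrow> bool" where
  "is_chart c \<longleftrightarrow> open (fst c) \<and> open (coords c UNIV) \<and>
     homeomorphism (fst c) (coords c UNIV) (snd c) (chart_inv c)"

definition smooth_atlas ::
    "('m::{t2_space, second_countable_topology}, 'n::finite) chart set \<Rightarrow> bool" where
  "smooth_atlas A \<longleftrightarrow>
     (\<forall>c\<in>A. is_chart c) \<and> (\<Union>c\<in>A. fst c) = UNIV \<and>
     (\<forall>c\<in>A. \<forall>d\<in>A. smooth_on (coords c (fst d)) (transition c d))"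


section \<open>Riemannian metrics and their curvature\<close>

text \<open>
  Tensor fields are given by their components in each chart, as functions of the coordinates of
  that chart, subject to the usual transformation laws.
\<close>

type_synonym ('m, 'n) metric = "('m, 'n) chart \<Rightarrow> real^'n \<Rightarrow> real^'n^'n"

definition riemannian_metric ::
    "('m::topological_space, 'n::finite) chart set \<Rightarrow> ('m, 'n) metric \<Rightarrow> bool" where
  "riemannian_metric A g \<longleftrightarrow>
     (\<forall>c\<in>A. smooth_on (coords c UNIV) (g c)) \<and>
     (\<forall>c\<in>A. \<forall>x\<in>coords c UNIV. transpose (g c x) = g c x \<and> (\<forall>v. v \<noteq> 0 \<longrightarrow> v \<bullet> (g c x *v v) > 0)) \<and>
     (\<forall>c\<in>A. \<forall>d\<in>A. \<forall>x\<in>coords c (fst d).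
        g c x = transpose (jacobian c d x) ** g d (transition c d x) ** jacobian c d x)"

text \<open>In the following, \<open>G\<close> is the component matrix of a metric in one coordinate system.\<close>

definition christoffel ::
    "(real^'n \<Rightarrow> real^'n^'n) \<Rightarrow> 'n::finite \<Rightarrow> 'n \<Rightarrow> 'n \<Rightarrow> real^'n \<Rightarrow> real" where
  "christoffel G i j k x = (1/2) * (\<Sum>l\<in>UNIV. matrix_inv (G x) $ i $ l *
     (partial j (\<lambda>y. G y $ l $ k) x + partial k (\<lambda>y. G y $ l $ j) x - partial l (\<lambda>y. G y $ j $ k) x))"

text \<open>
  \<open>riemann G i j k l\<close> is the component with upper index \<open>i\<close> and lower indices \<open>j k l\<close>, i.e.
  the \<open>i\<close>-th component of \<open>R(\<partial>\<^sub>k, \<partial>\<^sub>l)\<partial>\<^sub>j\<close>, where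
  \<open>R(X,Y) = \<nabla>\<^sub>X\<nabla>\<^sub>Y - \<nabla>\<^sub>Y\<nabla>\<^sub>X - \<nabla>\<^bsub>[X,Y]\<^esub>\<close>. With the contraction used for \<open>ricci\<close>, round spheres
  have positive scalar curvature.
\<close>

definition riemann ::
    "(real^'n \<Rightarrow> real^'n^'n) \<Rightarrow> 'n::finite \<Rightarrow> 'n \<Rightarrow> 'n \<Rightarrow> 'n \<Rightarrow> real^'n \<Rightarrow> real" where
  "riemann G i j k l x =
     partial k (christoffel G i l j) x - partial l (christoffel G i k j) x +
     (\<Sum>m\<in>UNIV. christoffel G i k m x * christoffel G m l j x -
                 christoffel G i l m x * christoffel G m k j x)"

definition ricci :: "(real^'n \<Rightarrow> real^'n^'n) \<Rightarrow> 'n::finite \<Rightarrow> 'n \<Rightarrow> real^'n \<Rightarrow> real" where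
  "ricci G j l x = (\<Sum>i\<in>UNIV. riemann G i j i l x)"

definition scalar_curvature :: "(real^'n \<Rightarrow> real^'n^'n::finite) \<Rightarrow> real^'n \<Rightarrow> real" where
  "scalar_curvature G x = (\<Sum>j\<in>UNIV. \<Sum>l\<in>UNIV. matrix_inv (G x) $ j $ l * ricci G j l x)"


section \<open>Local vector fields, Killing fields and Lie algebras of Killing fields\<close>

type_synonym ('m, 'n) vfield = "('m, 'n) chart \<Rightarrow> real^'n \<Rightarrow> real^'n"

definition vector_field_on ::
    "('m::topological_space, 'n::finite) chart set \<Rightarrow> 'm set \<Rightarrow> ('m, 'n) vfield \<Rightarrow> bool" where
  "vector_field_on A W X \<longleftrightarrow>
     (\<forall>c\<in>A. smooth_on (coords c W) (X c)) \<and>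
     (\<forall>c\<in>A. \<forall>d\<in>A. \<forall>x\<in>coords c (fst d \<inter> W). X d (transition c d x) = jacobian c d x *v X c x)"

definition vf_eq_on ::
    "('m, 'n::finite) chart set \<Rightarrow> 'm set \<Rightarrow> ('m, 'n) vfield \<Rightarrow> ('m, 'n) vfield \<Rightarrow> bool" where
  "vf_eq_on A W X Y \<longleftrightarrow> (\<forall>c\<in>A. \<forall>x\<in>coords c W. X c x = Y c x)"

definition vf_comb ::
    "('k::finite \<Rightarrow> real) \<Rightarrow> ('k \<Rightarrow> ('m, 'n::finite) vfield) \<Rightarrow> ('m, 'n) vfield" where
  "vf_comb a \<xi> = (\<lambda>c x. \<Sum>k\<in>UNIV. a k *\<^sub>R \<xi> k c x)"

abbreviation vf_zero :: "('m, 'n::finite) vfield" where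
  "vf_zero \<equiv> (\<lambda>c x. 0)"

abbreviation vf_minus :: "('m, 'n::finite) vfield \<Rightarrow> ('m, 'n) vfield" where
  "vf_minus X \<equiv> (\<lambda>c x. - X c x)"

definition lie_bracket ::
    "('m, 'n::finite) vfield \<Rightarrow> ('m, 'n) vfield \<Rightarrow> ('m, 'n) vfield" where
  "lie_bracket X Y = (\<lambda>c x. \<chi> i. \<Sum>j\<in>UNIV.
     X c x $ j * partial j (\<lambda>y. Y c y $ i) x - Y c x $ j * partial j (\<lambda>y. X c y $ i) x)"

definition lie_derivative_metric ::
    "('m, 'n::finite) vfield \<Rightarrow> ('m, 'n) metric \<Rightarrow> ('m, 'n) metric" where
  "lie_derivative_metric X g = (\<lambda>c x. \<chi> i j. \<Sum>k\<in>UNIV.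
     X c x $ k * partial k (\<lambda>y. g c y $ i $ j) x +
     g c x $ k $ j * partial i (\<lambda>y. X c y $ k) x +
     g c x $ i $ k * partial j (\<lambda>y. X c y $ k) x)"

definition killing_field_on ::
    "('m::topological_space, 'n::finite) chart set \<Rightarrow> ('m, 'n) metric \<Rightarrow> 'm set \<Rightarrow> ('m, 'n) vfield \<Rightarrow> bool" where
  "killing_field_on A g W X \<longleftrightarrow> vector_field_on A W X \<and>
     (\<forall>c\<in>A. \<forall>x\<in>coords c W. lie_derivative_metric X g c x = 0)"

text \<open>
  The family \<open>\<xi>\<close> is a basis of a Lie algebra of Killing fields on the open set \<open>W\<close>; the dimension
  is \<open>CARD('k)\<close>. Taking \<open>W\<close> connected excludes unrelated Killing fields on different
  components of \<open>W\<close>, so that the dimension agrees with that of the algebra of germs at a point.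
\<close>

definition killing_algebra_basis ::
    "('m::topological_space, 'n::finite) chart set \<Rightarrow> ('m, 'n) metric \<Rightarrow> 'm set \<Rightarrow>
     ('k::finite \<Rightarrow> ('m, 'n) vfield) \<Rightarrow> bool" where
  "killing_algebra_basis A g W \<xi> \<longleftrightarrow> open W \<and> connected W \<and>
     (\<forall>i. killing_field_on A g W (\<xi> i)) \<and>
     (\<forall>a. vf_eq_on A W (vf_comb a \<xi>) vf_zero \<longrightarrow> (\<forall>i. a i = 0)) \<and>
     (\<forall>i j. \<exists>a. vf_eq_on A W (lie_bracket (\<xi> i) (\<xi> j)) (vf_comb a \<xi>))"

definition transitive_on ::
    "('m, 'n::finite) chart set \<Rightarrow> 'm set \<Rightarrow> ('k::finite \<Rightarrow> ('m, 'n) vfield) \<Rightarrow> bool" where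
  "transitive_on A W \<xi> \<longleftrightarrow> (\<forall>c\<in>A. \<forall>x\<in>coords c W. span (range (\<lambda>i. \<xi> i c x)) = UNIV)"

definition admits_G6 ::
    "('m::topological_space, 'n::finite) chart set \<Rightarrow> ('m, 'n) metric \<Rightarrow> bool" where
  "admits_G6 A g \<longleftrightarrow>
     (\<forall>p. \<exists>W (\<xi> :: 6 \<Rightarrow> ('m, 'n) vfield). p \<in> W \<and> killing_algebra_basis A g W \<xi>)"

text \<open>The index type \<open>3\<close> has the elements \<open>1\<close>, \<open>2\<close> and \<open>3\<close> (where \<open>3 = 0\<close>).\<close>

type_synonym ('m, 'n) bianchi_type = "('m, 'n) chart set \<Rightarrow> 'm set \<Rightarrow> (3 \<Rightarrow> ('m, 'n) vfield) \<Rightarrow> bool"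

definition admits_transitive_G3 ::
    "('m::topological_space, 'n::finite) chart set \<Rightarrow> ('m, 'n) metric \<Rightarrow> ('m, 'n) bianchi_type \<Rightarrow> bool" where
  "admits_transitive_G3 A g T \<longleftrightarrow>
     (\<forall>p. \<exists>W \<xi>. p \<in> W \<and> killing_algebra_basis A g W \<xi> \<and> transitive_on A W \<xi> \<and> T A W \<xi>)"


section \<open>Bianchi-Behr types\<close>

definition bianchi_I :: "('m, 'n::finite) bianchi_type" where
  "bianchi_I A W \<xi> \<longleftrightarrow> (\<forall>i j. vf_eq_on A W (lie_bracket (\<xi> i) (\<xi> j)) vf_zero)"

definition bianchi_V :: "('m, 'n::finite) bianchi_type" where
  "bianchi_V A W \<xi> \<longleftrightarrow>
     vf_eq_on A W (lie_bracket (\<xi> 1) (\<xi> 2)) vf_zero \<and>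
     vf_eq_on A W (lie_bracket (\<xi> 2) (\<xi> 3)) (\<xi> 2) \<and>
     vf_eq_on A W (lie_bracket (\<xi> 3) (\<xi> 1)) (vf_minus (\<xi> 1))"

definition bianchi_VII :: "real \<Rightarrow> ('m, 'n::finite) bianchi_type" where
  "bianchi_VII q A W \<xi> \<longleftrightarrow> q\<^sup>2 < 4 \<and>
     vf_eq_on A W (lie_bracket (\<xi> 1) (\<xi> 2)) vf_zero \<and>
     vf_eq_on A W (lie_bracket (\<xi> 2) (\<xi> 3)) (\<lambda>c x. - \<xi> 1 c x + q *\<^sub>R \<xi> 2 c x) \<and>
     vf_eq_on A W (lie_bracket (\<xi> 3) (\<xi> 1)) (vf_minus (\<xi> 2))"

definition bianchi_VII0 :: "('m, 'n::finite) bianchi_type" where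
  "bianchi_VII0 = bianchi_VII 0"

definition bianchi_VIIh :: "real \<Rightarrow> ('m, 'n::finite) bianchi_type" where
  "bianchi_VIIh h A W \<xi> \<longleftrightarrow> (\<exists>q. q \<noteq> 0 \<and> h = q\<^sup>2 / (4 - q\<^sup>2) \<and> bianchi_VII q A W \<xi>)"

definition bianchi_IX :: "('m, 'n::finite) bianchi_type" where
  "bianchi_IX A W \<xi> \<longleftrightarrow>
     vf_eq_on A W (lie_bracket (\<xi> 1) (\<xi> 2)) (\<xi> 3) \<and>
     vf_eq_on A W (lie_bracket (\<xi> 2) (\<xi> 3)) (\<xi> 1) \<and>
     vf_eq_on A W (lie_bracket (\<xi> 3) (\<xi> 1)) (\<xi> 2)"


section \<open>Local isomorphism with \<open>E(3)\<close>, \<open>SO(3,1)\<close> and \<open>SO(4)\<close>\<close>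

text \<open>Lie algebra of the isometry group of the bilinear form with matrix \<open>\<eta>\<close>.\<close>

definition lie_so :: "real^'n^'n::finite \<Rightarrow> (real^'n^'n) set" where
  "lie_so \<eta> = {X. transpose X ** \<eta> + \<eta> ** X = 0}"

definition so_4 :: "(real^4^4) set" where
  "so_4 = lie_so (mat 1)"

definition so_31 :: "(real^4^4) set" where
  "so_31 = lie_so (\<chi> i j. if i = j then (if i = 4 then - 1 else 1) else 0)"

text \<open>
  A Euclidean motion \<open>x \<mapsto> Rx + b\<close> of 3-space acts on \<open>(x, 1)\<close> by the \<open>4 \<times> 4\<close> matrix with
  blocks \<open>R\<close>, \<open>b\<close> and last row \<open>(0, 1)\<close>; accordingly the Lie algebra of \<open>E(3)\<close> consists of the
  matrices with skew-symmetric upper left block and vanishing last row.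
\<close>

definition e_3 :: "(real^4^4) set" where
  "e_3 = {X. X $ 4 = 0 \<and> (\<forall>i j. i \<noteq> 4 \<longrightarrow> j \<noteq> 4 \<longrightarrow> X $ i $ j = - X $ j $ i)}"

text \<open>
  The Lie algebra with basis \<open>\<xi>\<close> is isomorphic to the matrix Lie algebra \<open>H\<close>: the isomorphism
  is the linear extension of \<open>\<xi> i \<mapsto> B i\<close>.
\<close>

definition isomorphic_to_matrix_algebra ::
    "('m, 'n::finite) chart set \<Rightarrow> 'm set \<Rightarrow> ('k::finite \<Rightarrow> ('m, 'n) vfield) \<Rightarrow>
     (real^'d^'d::finite) set \<Rightarrow> bool" where
  "isomorphic_to_matrix_algebra A W \<xi> H \<longleftrightarrow>
     (\<exists>B :: 'k \<Rightarrow> real^'d^'d. inj B \<and> independent (range B) \<and> span (range B) = H \<and>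
        (\<forall>i j. \<exists>a. vf_eq_on A W (lie_bracket (\<xi> i) (\<xi> j)) (vf_comb a \<xi>) \<and>
                    B i ** B j - B j ** B i = (\<Sum>k\<in>UNIV. a k *\<^sub>R B k)))"

text \<open>Every six-dimensional local group of isometries has a Lie algebra isomorphic to \<open>H\<close>.\<close>

definition G6_locally_isomorphic ::
    "('m::topological_space, 'n::finite) chart set \<Rightarrow> ('m, 'n) metric \<Rightarrow> (real^'d^'d::finite) set \<Rightarrow> bool" where
  "G6_locally_isomorphic A g H \<longleftrightarrow>
     (\<forall>W (\<xi> :: 6 \<Rightarrow> ('m, 'n) vfield).
        killing_algebra_basis A g W \<xi> \<longrightarrow> isomorphic_to_matrix_algebra A W \<xi> H)"

end

theory Submission
  imports Defs
begin

text \<open>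
  A Killing field is determined by its value and its covariant derivative at one point, since its
  second derivatives are linear in these. Hence a six-dimensional algebra realises every pair
  \<open>(s, a)\<close> of a tangent vector and an infinitesimal rotation, with brackets given by the curvature
  tensor. The Jacobi identity with a rotation as one argument makes the curvature tensor isotropic,
  so that the algebra is \<open>[(s, a), (t, b)] = (a \<times> t - b \<times> s, a \<times> b + K s \<times> t)\<close>
  with \<open>r = 6 K\<close>, and the required subalgebras and matrix representations can be written down.

  Conversely, the dual coframe of a transitive algebra of type I or V has closed multiples, whose
  potentials serve as coordinates in which the metric is that of Euclidean or hyperbolic space; the
  three missing Killing fields are explicit in them. The same brackets determine the sign of \<open>K\<close>:
  a transitive abelian algebra forces \<open>K = 0\<close>, and a transitive algebra of type V forces \<open>K < 0\<close>.
\<close>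

section \<open>Calculus of smooth functions\<close>

text \<open>The constant K is found at one point at a time, from an algebra of fields given near
  that point. An orthonormal frame at the point turns the covariant derivatives of Killing fields
  into skew matrices, hence into vectors of R^3. A subalgebra is then chosen by its brackets; once
  its translation parts are independent it is transitive at the point, and so on a smaller
  coordinate ball.

  The obstacle in the converse is that the atlas is fixed, and the potentials of the closed forms
  need not be charts of it. They are therefore kept as functions on the manifold and differentiated
  along the frame only, where their derivatives have simple formulas; the new Killing fields are
  combinations of the frame with such functions as coefficients. The curvature is not computed from
  this metric: the six fields contain the frame, so the frame sits inside the model algebra of the
  first half, and the sign of K becomes a question about vectors in R^3.\<close>

lemma frechet_derivative_cong_open:
  assumes "open S" "x \<in> S" "\<And>y. y \<in> S \<Longrightarrow> f y = g y"
  shows "frechet_derivative f (at x) = frechet_derivative g (at x)"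
proof -
  have "(f has_derivative D) (at x) \<longleftrightarrow> (g has_derivative D) (at x)" for D
    using has_derivative_transform_within_open[OF _ assms(1,2), of f D UNIV g]
      has_derivative_transform_within_open[OF _ assms(1,2), of g D UNIV f] assms(3) by auto
  then show ?thesis
    by (simp add: frechet_derivative_def)
qed

lemma frechet_derivative_works_at:
  "f differentiable (at x) \<Longrightarrow> (f has_derivative frechet_derivative f (at x)) (at x)"
  by (simp add: frechet_derivative_works)

lemma frechet_derivative_eqI:
  "(f has_derivative D) (at x) \<Longrightarrow> frechet_derivative f (at x) = D"
  using frechet_derivative_at by metis

lemma Ck_on_subset: "Ck_on k S f \<Longrightarrow> T \<subseteq> S \<Longrightarrow> Ck_on k T f"
  by (induction k arbitrary: f) (auto intro: continuous_on_subset)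

lemma Ck_on_SucD:
  assumes "Ck_on (Suc k) S f"
  shows "x \<in> S \<Longrightarrow> (f has_derivative frechet_derivative f (at x)) (at x)"
    and "Ck_on k S (\<lambda>x. frechet_derivative f (at x) v)"
  using assms by (auto intro: frechet_derivative_works_at)

lemma Ck_on_cong:
  assumes "open S" "\<And>x. x \<in> S \<Longrightarrow> f x = g x" "Ck_on k S f"
  shows "Ck_on k S g"
  using assms(2,3)
proof (induction k arbitrary: f g)
  case 0
  then show ?case by (metis Ck_on.simps(1) continuous_on_cong)
next
  case (Suc k)
  have eq: "frechet_derivative f (at x) = frechet_derivative g (at x)" if "x \<in> S" for x
    using frechet_derivative_cong_open[OF assms(1) that] Suc.prems(1) by blast
  have "g differentiable at x" if "x \<in> S" for x
    using has_derivative_transform_within_open[OF Ck_on_SucD(1)[OF Suc.prems(2) that] assms(1) that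
        Suc.prems(1)]
    by (auto simp: differentiable_def)
  moreover have "Ck_on k S (\<lambda>x. frechet_derivative g (at x) v)" for v
    by (rule Suc.IH[where f = "\<lambda>x. frechet_derivative f (at x) v"]) (use eq Suc.prems in auto)
  ultimately show ?case by simp
qed

lemma Ck_on_Suc_imp: "Ck_on (Suc k) S f \<Longrightarrow> Ck_on k S f"
proof (induction k arbitrary: f)
  case 0
  then show ?case
    by (auto intro!: continuous_at_imp_continuous_on differentiable_imp_continuous_within)
next
  case (Suc k)
  then show ?case by (metis Ck_on.simps(2))
qed

text \<open>\<open>Ck_on\<close> speaks of \<open>frechet_derivative\<close>; an explicit derivative
  \<open>D\<close> serves as well, because derivatives are unique and \<open>S\<close> is
  open.\<close>

lemma Ck_on_SucI:
  assumes "open S" "\<And>x. x \<in> S \<Longrightarrow> (f has_derivative D x) (at x)" "\<And>v. Ck_on k S (\<lambda>x. D x v)"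
  shows "Ck_on (Suc k) S f"
proof -
  have "Ck_on k S (\<lambda>x. frechet_derivative f (at x) v)" for v
    by (rule Ck_on_cong[OF assms(1) _ assms(3)[of v]]) (simp add: frechet_derivative_eqI[OF assms(2)])
  then show ?thesis using assms(2) by (auto simp: differentiable_def)
qed

lemma Ck_on_const: "open S \<Longrightarrow> Ck_on k S (\<lambda>x. c)"
proof (induction k arbitrary: c)
  case (Suc k)
  show ?case by (rule Ck_on_SucI[where D = "\<lambda>x v. 0"]) (use Suc in auto)
qed auto

lemma Ck_on_add:
  "open S \<Longrightarrow> Ck_on k S f \<Longrightarrow> Ck_on k S g \<Longrightarrow> Ck_on k S (\<lambda>x. f x + g x)"
proof (induction k arbitrary: f g)
  case (Suc k)
  show ?case
    using Ck_on_SucD[OF Suc.prems(2)] Ck_on_SucD[OF Suc.prems(3)] Suc.IH Suc.prems(1)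
    by (intro Ck_on_SucI[OF Suc.prems(1) has_derivative_add] Suc.IH) simp_all
qed (auto intro: continuous_on_add)

lemma Ck_on_bounded_linear:
  "open S \<Longrightarrow> bounded_linear L \<Longrightarrow> Ck_on k S f \<Longrightarrow> Ck_on k S (\<lambda>x. L (f x))"
proof (induction k arbitrary: f)
  case 0
  then show ?case by (auto intro: bounded_linear.continuous_on)
next
  case (Suc k)
  show ?case
    using Ck_on_SucD[OF Suc.prems(3)] Suc.IH Suc.prems(1,2)
    by (intro Ck_on_SucI[OF Suc.prems(1) bounded_linear.has_derivative[OF Suc.prems(2)]] Suc.IH)
        simp_all
qed

text \<open>The product rule pairs each function with the derivative of the other, so the induction
  step uses both factors also at one order lower (\<open>Ck_on_Suc_imp\<close>).\<close>

lemma Ck_on_scaleR: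
  fixes f :: "'a::real_normed_vector \<Rightarrow> real" and g :: "'a \<Rightarrow> 'b::real_normed_vector"
  shows "open S \<Longrightarrow> Ck_on k S f \<Longrightarrow> Ck_on k S g \<Longrightarrow> Ck_on k S (\<lambda>x. f x *\<^sub>R g x)"
proof (induction k arbitrary: f g)
  case (Suc k)
  show ?case
    using Ck_on_SucD[OF Suc.prems(2)] Ck_on_SucD[OF Suc.prems(3)] Suc.IH
      Ck_on_Suc_imp[OF Suc.prems(2)] Ck_on_Suc_imp[OF Suc.prems(3)] Suc.prems(1)
    by (intro Ck_on_SucI[OF Suc.prems(1) has_derivative_scaleR] Ck_on_add) (auto intro!: Suc.IH)
qed (auto intro: continuous_on_scaleR)

text \<open>The derivative of 1/f is -(1/f)^2 times that of f, so order k of 1/f itself, which is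
  the induction hypothesis, yields order k + 1.\<close>

lemma Ck_on_inverse:
  fixes f :: "'a::real_normed_vector \<Rightarrow> real"
  shows "open S \<Longrightarrow> (\<And>x. x \<in> S \<Longrightarrow> f x \<noteq> 0) \<Longrightarrow> Ck_on k S f \<Longrightarrow> Ck_on k S (\<lambda>x. inverse (f x))"
proof (induction k)
  case 0
  then show ?case by (auto intro!: continuous_on_inverse)
next
  case (Suc k)
  have "Ck_on k S (\<lambda>x. (inverse (f x) *\<^sub>R inverse (f x)) *\<^sub>R (- frechet_derivative f (at x) v))" for v
    using Suc Ck_on_SucD(2)[OF Suc.prems(3)] Ck_on_Suc_imp[OF Suc.prems(3)]
    by (intro Ck_on_scaleR Ck_on_bounded_linear[OF _ bounded_linear_minus[OF bounded_linear_ident]])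
        auto
  then show ?case
    by (intro Ck_on_SucI[OF Suc.prems(1) has_derivative_eq_rhs[OF Deriv.has_derivative_inverse]])
      (use Ck_on_SucD(1)[OF Suc.prems(3)] Suc.prems(2) in \<open>auto simp: fun_eq_iff algebra_simps\<close>)
qed

lemma smooth_on_subset: "smooth_on S f \<Longrightarrow> T \<subseteq> S \<Longrightarrow> smooth_on T f"
  using Ck_on_subset unfolding smooth_on_def by blast

lemma smooth_on_cong:
  "open S \<Longrightarrow> (\<And>x. x \<in> S \<Longrightarrow> f x = g x) \<Longrightarrow> smooth_on S f \<Longrightarrow> smooth_on S g"
  using Ck_on_cong unfolding smooth_on_def by blast

lemma smooth_on_const [simp]: "open S \<Longrightarrow> smooth_on S (\<lambda>x. c)"
  by (simp add: smooth_on_def Ck_on_const)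

lemma smooth_on_add: "open S \<Longrightarrow> smooth_on S f \<Longrightarrow> smooth_on S g \<Longrightarrow> smooth_on S (\<lambda>x. f x + g x)"
  by (simp add: smooth_on_def Ck_on_add)

lemma smooth_on_bounded_linear:
  "open S \<Longrightarrow> bounded_linear L \<Longrightarrow> smooth_on S f \<Longrightarrow> smooth_on S (\<lambda>x. L (f x))"
  by (simp add: smooth_on_def Ck_on_bounded_linear)

lemma smooth_on_scaleR:
  fixes f :: "'a::real_normed_vector \<Rightarrow> real"
  shows "open S \<Longrightarrow> smooth_on S f \<Longrightarrow> smooth_on S g \<Longrightarrow> smooth_on S (\<lambda>x. f x *\<^sub>R g x)"
  by (simp add: smooth_on_def Ck_on_scaleR)

lemma smooth_on_mult:
  fixes f g :: "'a::real_normed_vector \<Rightarrow> real"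
  shows "open S \<Longrightarrow> smooth_on S f \<Longrightarrow> smooth_on S g \<Longrightarrow> smooth_on S (\<lambda>x. f x * g x)"
  using smooth_on_scaleR[of S f g] by simp

lemma smooth_on_minus: "open S \<Longrightarrow> smooth_on S f \<Longrightarrow> smooth_on S (\<lambda>x. - f x)"
  using smooth_on_bounded_linear[OF _ bounded_linear_minus[OF bounded_linear_ident]] by blast

lemma smooth_on_diff: "open S \<Longrightarrow> smooth_on S f \<Longrightarrow> smooth_on S g \<Longrightarrow> smooth_on S (\<lambda>x. f x - g x)"
  using smooth_on_add[OF _ _ smooth_on_minus, of S f g] by simp

lemma smooth_on_sum:
  assumes "open S" "\<And>i. i \<in> I \<Longrightarrow> smooth_on S (f i)"
  shows "smooth_on S (\<lambda>x. \<Sum>i\<in>I. f i x)"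
  using assms by (induction I rule: infinite_finite_induct) (auto intro: smooth_on_add)

lemma smooth_on_divide:
  fixes f g :: "'a::real_normed_vector \<Rightarrow> real"
  assumes "open S" "smooth_on S f" "smooth_on S g" "\<And>x. x \<in> S \<Longrightarrow> g x \<noteq> 0"
  shows "smooth_on S (\<lambda>x. f x / g x)"
proof -
  have "smooth_on S (\<lambda>x. inverse (g x))"
    using assms by (simp add: smooth_on_def Ck_on_inverse)
  from smooth_on_mult[OF assms(1,2) this] show ?thesis by (simp add: field_class.field_divide_inverse)
qed

lemma smooth_on_nth: "open S \<Longrightarrow> smooth_on S f \<Longrightarrow> smooth_on S (\<lambda>x. f x $ i)"
  using smooth_on_bounded_linear[OF _ bounded_linear_vec_nth] by blast

lemma smooth_on_vec:
  fixes f :: "'a::real_normed_vector \<Rightarrow> real^'n::finite"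
  assumes "open S" "\<And>i. smooth_on S (\<lambda>x. f x $ i)"
  shows "smooth_on S f"
proof -
  have "smooth_on S (\<lambda>x. \<Sum>i\<in>UNIV. f x $ i *\<^sub>R axis i 1)"
    using assms by (intro smooth_on_sum smooth_on_scaleR) auto
  moreover have "(\<Sum>i\<in>UNIV. f x $ i *\<^sub>R axis i 1) = f x" for x
    using basis_expansion[of "f x"] by (simp add: scalar_mult_eq_scaleR)
  ultimately show ?thesis
    by (rule smooth_on_cong[OF assms(1), rotated])
qed

lemma smooth_on_differentiable: "smooth_on S f \<Longrightarrow> x \<in> S \<Longrightarrow> f differentiable (at x)"
  unfolding smooth_on_def by (metis Ck_on.simps(2))

lemma smooth_on_continuous_on: "smooth_on S f \<Longrightarrow> continuous_on S f"
  unfolding smooth_on_def by (metis Ck_on.simps(1))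

lemma smooth_on_frechet_derivative:
  "smooth_on S f \<Longrightarrow> smooth_on S (\<lambda>x. frechet_derivative f (at x) v)"
  unfolding smooth_on_def by (metis Ck_on.simps(2))

lemma smooth_on_partial: "smooth_on S f \<Longrightarrow> smooth_on S (partial i f)"
  using smooth_on_frechet_derivative[of S f "axis i 1"] by (simp add: partial_def[abs_def])

lemmas smooth_intros = smooth_on_const smooth_on_add smooth_on_diff smooth_on_minus smooth_on_mult
  smooth_on_sum smooth_on_nth smooth_on_partial

lemma frechet_derivative_partial:
  assumes "f differentiable (at x)"
  shows "frechet_derivative f (at x) v = (\<Sum>i\<in>UNIV. v $ i * partial i f x)"
proof -
  have lin: "linear (frechet_derivative f (at x))"
    using assms by (simp add: linear_frechet_derivative)
  have "frechet_derivative f (at x) v = frechet_derivative f (at x) (\<Sum>i\<in>UNIV. v $ i *\<^sub>R axis i 1)"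
    using basis_expansion[of v] by (simp add: scalar_mult_eq_scaleR)
  also have "\<dots> = (\<Sum>i\<in>UNIV. v $ i * partial i f x)"
    by (simp add: linear_sum[OF lin] linear_scale[OF lin] partial_def)
  finally show ?thesis .
qed

lemma has_derivative_partial:
  "f differentiable (at x) \<Longrightarrow> (f has_derivative (\<lambda>v. \<Sum>i\<in>UNIV. v $ i * partial i f x)) (at x)"
  by (rule has_derivative_eq_rhs[OF frechet_derivative_works_at]) (auto simp:
      frechet_derivative_partial)

lemma partial_eqI: "(f has_derivative D) (at x) \<Longrightarrow> partial i f x = D (axis i 1)"
  by (simp add: partial_def frechet_derivative_eqI)

lemma partial_cong:
  "open S \<Longrightarrow> x \<in> S \<Longrightarrow> (\<And>y. y \<in> S \<Longrightarrow> f y = g y) \<Longrightarrow> partial i f x = partial i g x"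
  unfolding partial_def by (simp add: frechet_derivative_cong_open[of S x f g])

lemma partial_const [simp]: "partial i (\<lambda>x. c) x = 0"
  by (simp add: partial_def)

lemma partial_add:
  "f differentiable (at x) \<Longrightarrow> g differentiable (at x) \<Longrightarrow>
    partial i (\<lambda>y. f y + g y) x = partial i f x + partial i g x"
  by (rule trans[OF partial_eqI[OF has_derivative_add]]) (auto intro: frechet_derivative_works_at
      simp: partial_def)

lemma partial_diff:
  "f differentiable (at x) \<Longrightarrow> g differentiable (at x) \<Longrightarrow>
    partial i (\<lambda>y. f y - g y) x = partial i f x - partial i g x"
  by (rule trans[OF partial_eqI[OF has_derivative_diff]]) (auto intro: frechet_derivative_works_at
      simp: partial_def)

lemma partial_mult:
  "f differentiable (at x) \<Longrightarrow> g differentiable (at x) \<Longrightarrow>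
    partial i (\<lambda>y. f y * g y) x = partial i f x * g x + f x * partial i g x"
  by (rule trans[OF partial_eqI[OF has_derivative_mult]]) (auto intro: frechet_derivative_works_at
      simp: partial_def)

lemma partial_sum:
  assumes "\<And>k. k \<in> I \<Longrightarrow> f k differentiable (at x)"
  shows "partial i (\<lambda>y. \<Sum>k\<in>I. f k y) x = (\<Sum>k\<in>I. partial i (f k) x)"
  using assms by (intro trans[OF partial_eqI[OF has_derivative_sum]])
    (auto intro: frechet_derivative_works_at simp: partial_def)

section \<open>Mean values and the symmetry of second partial derivatives\<close>

lemma partial_mvt:
  fixes f :: "real^'n::finite \<Rightarrow> real"
  assumes "0 < t" "\<And>s. 0 \<le> s \<Longrightarrow> s \<le> t \<Longrightarrow> f differentiable (at (x + s *\<^sub>R axis i 1))"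
  shows "\<exists>s. 0 < s \<and> s < t \<and> f (x + t *\<^sub>R axis i 1) - f x = t * partial i f (x + s *\<^sub>R axis i 1)"
proof -
  have d: "((\<lambda>s. f (x + s *\<^sub>R axis i 1)) has_real_derivative partial i f (x + s *\<^sub>R axis i 1)) (at s)"
    if "0 \<le> s" "s \<le> t" for s
  proof -
    let ?D = "frechet_derivative f (at (x + s *\<^sub>R axis i 1))"
    have "((\<lambda>s. x + s *\<^sub>R axis i 1) has_derivative (\<lambda>h. h *\<^sub>R axis i 1)) (at s)"
      by (auto intro!: derivative_eq_intros)
    from has_derivative_compose[OF this frechet_derivative_works_at[OF assms(2)[OF that]]]
    have "((\<lambda>s. f (x + s *\<^sub>R axis i 1)) has_derivative (\<lambda>h. ?D (h *\<^sub>R axis i 1))) (at s)" .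
    moreover have "?D (h *\<^sub>R axis i 1) = partial i f (x + s *\<^sub>R axis i 1) * h" for h
      using linear_scale[OF linear_frechet_derivative[OF assms(2)[OF that]]] by (simp add: partial_def)
    ultimately show ?thesis by (simp add: has_field_derivative_def mult_commute_abs)
  qed
  show ?thesis
    using MVT2[OF assms(1) d] by auto
qed

lemma smooth_on_eventually_small:
  fixes h :: "real^'n::finite \<Rightarrow> real"
  assumes "open S" "continuous_on S h" "x \<in> S" "e > 0"
  obtains d where "d > 0" "\<And>y. dist y x < d \<Longrightarrow> y \<in> S \<and> \<bar>h y - h x\<bar> < e"
proof -
  have "isCont h x" using assms continuous_on_eq_continuous_at by blast
  then obtain d1 where "d1 > 0" "\<And>y. dist y x < d1 \<Longrightarrow> dist (h y) (h x) < e"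
    using assms(4) unfolding continuous_at_eps_delta by metis
  moreover obtain d2 where "d2 > 0" "\<And>y. dist y x < d2 \<Longrightarrow> y \<in> S"
    using assms(1,3) unfolding open_dist by metis
  ultimately show ?thesis by (intro that[of "min d1 d2"]) (auto simp: dist_real_def)
qed

text \<open>The left side is the mixed second difference of \<open>f\<close> over a square of side
  \<open>t\<close>, that is, the increment in direction \<open>i\<close> of a difference taken in
  direction \<open>j\<close>. One mean value in each direction produces the mixed derivative. The
  left side is symmetric in \<open>i\<close> and \<open>j\<close>, whereas the right side singles
  out an order of differentiation.\<close>

lemma partial_second_difference:
  fixes f :: "real^'n::finite \<Rightarrow> real"
  assumes "smooth_on S f" "t > 0" "\<And>r s. 0 \<le> r \<Longrightarrow> r \<le> t \<Longrightarrow> 0 \<le> s \<Longrightarrow> s \<le> t \<Longrightarrow> x + r *\<^sub>R axis i 1 + s *\<^sub>R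
      axis j 1 \<in> S"
  shows "\<exists>r s. 0 < r \<and> r < t \<and> 0 < s \<and> s < t \<and>
    f (x + t *\<^sub>R axis i 1 + t *\<^sub>R axis j 1) - f (x + t *\<^sub>R axis j 1) - f (x + t *\<^sub>R axis i 1) + f x =
     t * (t * partial j (partial i f) (x + r *\<^sub>R axis i 1 + s *\<^sub>R axis j 1))"
proof -
  let ?v = "t *\<^sub>R axis j 1 :: real^'n"
  have df: "f differentiable (at (x + s *\<^sub>R axis i 1 + ?v))" "f differentiable (at (x + s *\<^sub>R axis i
      1))"
    if "0 \<le> s" "s \<le> t" for s
    using assms(3)[of s t] assms(3)[of s 0] that assms(1,2) by (auto intro: smooth_on_differentiable)
  let ?h = "\<lambda>y. f (y + ?v) - f y"
  have shift: "((\<lambda>y. f (y + ?v)) has_derivative frechet_derivative f (at (y + ?v))) (at y)"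
    if "f differentiable (at (y + ?v))" for y
  proof -
    have "((\<lambda>y. y + ?v) has_derivative (\<lambda>h. h)) (at y)"
      by (auto intro!: derivative_eq_intros)
    from has_derivative_compose[OF this frechet_derivative_works_at[OF that]] show ?thesis .
  qed
  have d2: "(\<lambda>y. f (y + ?v)) differentiable (at y)" "partial i (\<lambda>y. f (y + ?v)) y = partial i f (y +
      ?v)"
    if "f differentiable (at (y + ?v))" for y
    using shift[OF that] partial_eqI[OF shift[OF that]] by (auto simp: differentiable_def partial_def)
  have dh: "?h differentiable (at (x + s *\<^sub>R axis i 1))" if "0 \<le> s" "s \<le> t" for s
    using df[OF that] by (intro differentiable_diff d2)
  obtain r where r: "0 < r" "r < t" "?h (x + t *\<^sub>R axis i 1) - ?h x = t * partial i ?h (x + r *\<^sub>R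
      axis i 1)"
    using partial_mvt[OF assms(2) dh] by auto
  have pd: "partial i ?h (x + r *\<^sub>R axis i 1) =
      partial i f (x + r *\<^sub>R axis i 1 + ?v) - partial i f (x + r *\<^sub>R axis i 1)"
    using df[of r] r(1,2) by (simp add: partial_diff d2)
  obtain s where s: "0 < s" "s < t" "partial i f (x + r *\<^sub>R axis i 1 + ?v) - partial i f (x + r *\<^sub>R
      axis i 1)
      = t * partial j (partial i f) (x + r *\<^sub>R axis i 1 + s *\<^sub>R axis j 1)"
    using partial_mvt[OF assms(2), of "partial i f" "x + r *\<^sub>R axis i 1" j] assms(3)[of r] r(1,2)
      smooth_on_differentiable[OF smooth_on_partial[OF assms(1)]] by auto
  show ?thesis using r s pd by (intro exI[of _ r] exI[of _ s]) (simp add: algebra_simps)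
qed

text \<open>Schwarz's theorem: the same second difference over a small square equals either mixed
  derivative at some nearby point, so by continuity the two cannot differ at
  \<open>x\<close>.\<close>

lemma partial_commute:
  fixes f :: "real^'n::finite \<Rightarrow> real"
  assumes "open S" "smooth_on S f" "x \<in> S"
  shows "partial i (partial j f) x = partial j (partial i f) x"
proof (rule ccontr)
  assume neq: "\<not> ?thesis"
  define e where "e = \<bar>partial i (partial j f) x - partial j (partial i f) x\<bar> / 2"
  have "e > 0" using neq by (simp add: e_def)
  have c: "continuous_on S (partial i (partial j f))" "continuous_on S (partial j (partial i f))"
    using assms(2) by (auto intro: smooth_on_continuous_on smooth_on_partial)
  obtain d1 where d1: "d1 > 0" "\<And>y. dist y x < d1 \<Longrightarrow> y \<in> S \<and> \<bar>partial i (partial j f) y - partial i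
      (partial j f) x\<bar> < e"
    using smooth_on_eventually_small[OF assms(1) c(1) assms(3) \<open>e > 0\<close>] by metis
  obtain d2 where d2: "d2 > 0" "\<And>y. dist y x < d2 \<Longrightarrow> y \<in> S \<and> \<bar>partial j (partial i f) y - partial j
      (partial i f) x\<bar> < e"
    using smooth_on_eventually_small[OF assms(1) c(2) assms(3) \<open>e > 0\<close>] by metis
  \<comment> \<open>A third of the radius: the mean value points are displaced by at most
    \<open>t\<close> in each of two directions, hence by at most 2t in norm.\<close>
  define t where "t = min d1 d2 / 3"
  have t: "t > 0" using d1 d2 by (simp add: t_def)
  have near: "dist (x + r *\<^sub>R axis k 1 + s *\<^sub>R axis l 1) x < min d1 d2"
    if "0 \<le> r" "r \<le> t" "0 \<le> s" "s \<le> t" for r s and k l :: 'n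
  proof -
    have "norm (r *\<^sub>R axis k 1 + s *\<^sub>R axis l 1 :: real^'n) \<le> \<bar>r\<bar> + \<bar>s\<bar>"
      using norm_triangle_ineq[of "r *\<^sub>R axis k 1 :: real^'n" "s *\<^sub>R axis l 1"] by simp
    then show ?thesis using that t by (simp add: dist_norm add.assoc t_def)
  qed
  obtain r s where 1: "0 < r" "r < t" "0 < s" "s < t"
    "f (x + t *\<^sub>R axis i 1 + t *\<^sub>R axis j 1) - f (x + t *\<^sub>R axis j 1) - f (x + t *\<^sub>R axis i 1) + f x =
      t * (t * partial j (partial i f) (x + r *\<^sub>R axis i 1 + s *\<^sub>R axis j 1))"
    using partial_second_difference[OF assms(2) t, of x i j] near d1(2) by fastforce
  obtain r' s' where 2: "0 < r'" "r' < t" "0 < s'" "s' < t"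
    "f (x + t *\<^sub>R axis j 1 + t *\<^sub>R axis i 1) - f (x + t *\<^sub>R axis i 1) - f (x + t *\<^sub>R axis j 1) + f x =
      t * (t * partial i (partial j f) (x + r' *\<^sub>R axis j 1 + s' *\<^sub>R axis i 1))"
    using partial_second_difference[OF assms(2) t, of x j i] near d1(2) by fastforce
  have "t * (t * partial j (partial i f) (x + r *\<^sub>R axis i 1 + s *\<^sub>R axis j 1)) =
      t * (t * partial i (partial j f) (x + r' *\<^sub>R axis j 1 + s' *\<^sub>R axis i 1))"
    using 1(5) 2(5) add.commute[of "x + t *\<^sub>R axis i 1" "t *\<^sub>R axis j 1"]
      by (simp only: add.assoc add.commute[of "t *\<^sub>R axis j 1"])
  then have eq: "partial j (partial i f) (x + r *\<^sub>R axis i 1 + s *\<^sub>R axis j 1) =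
      partial i (partial j f) (x + r' *\<^sub>R axis j 1 + s' *\<^sub>R axis i 1)"
    using t by simp
  have "\<bar>partial j (partial i f) (x + r *\<^sub>R axis i 1 + s *\<^sub>R axis j 1) - partial j (partial i f) x\<bar> < e"
    using d2(2) near[of r s i j] 1 by auto
  moreover have "\<bar>partial i (partial j f) (x + r' *\<^sub>R axis j 1 + s' *\<^sub>R axis i 1) - partial i
      (partial j f) x\<bar> < e"
    using d1(2) near[of r' s' j i] 2 by auto
  ultimately have "\<bar>partial i (partial j f) x - partial j (partial i f) x\<bar> < 2 * e"
    using eq by linarith
  then show False by (simp add: e_def)
qed

section \<open>Killing fields in one coordinate system\<close>

text \<open>The bracket on plain functions of the coordinates of one chart, so that it can be
  iterated without reference to the atlas.\<close>

definition local_bracket :: "(real^'n::finite \<Rightarrow> real^'n) \<Rightarrow> (real^'n \<Rightarrow> real^'n) \<Rightarrow> real^'n \<Rightarrow> real^'n"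
    where
  "local_bracket X Y x = (\<chi> i. \<Sum>j\<in>UNIV.
     X x $ j * partial j (\<lambda>y. Y y $ i) x - Y x $ j * partial j (\<lambda>y. X y $ i) x)"

lemma lie_bracket_local: "lie_bracket X Y c x = local_bracket (X c) (Y c) x"
  by (simp add: lie_bracket_def local_bracket_def)

lemma partial_local_bracket:
  assumes "open U" "smooth_on U X" "smooth_on U Y" "x \<in> U"
  shows "partial k (\<lambda>y. local_bracket X Y y $ i) x = (\<Sum>j\<in>UNIV.
     partial k (\<lambda>y. X y $ j) x * partial j (\<lambda>y. Y y $ i) x + X x $ j * partial k (partial j (\<lambda>y. Y y
         $ i)) x
     - (partial k (\<lambda>y. Y y $ j) x * partial j (\<lambda>y. X y $ i) x + Y x $ j * partial k (partial j (\<lambda>y.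
         X y $ i)) x))"
proof -
  have d: "f differentiable (at x)" if "smooth_on U f" for f :: "real^'a \<Rightarrow> real"
    using that assms(4) by (rule smooth_on_differentiable)
  have X: "smooth_on U (\<lambda>y. X y $ j)" "smooth_on U (partial m (\<lambda>y. X y $ j))" for j m
    using assms by (auto intro!: smooth_intros)
  have Y: "smooth_on U (\<lambda>y. Y y $ j)" "smooth_on U (partial m (\<lambda>y. Y y $ j))" for j m
    using assms by (auto intro!: smooth_intros)
  show ?thesis
    using assms(1) X Y by (simp add: local_bracket_def partial_sum partial_diff partial_mult d
        smooth_intros)
qed

text \<open>Products of first derivatives cancel algebraically; the terms with second derivatives
  cancel because partial derivatives commute.\<close>

lemma local_bracket_jacobi:
  fixes X Y Z :: "real^3 \<Rightarrow> real^3"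
  assumes "open U" "smooth_on U X" "smooth_on U Y" "smooth_on U Z" "x \<in> U"
  shows "local_bracket (local_bracket X Y) Z x + local_bracket (local_bracket Y Z) X x
    + local_bracket (local_bracket Z X) Y x = 0"
proof -
  \<comment> \<open>With names for the values and derivatives at \<open>x\<close> the claim becomes
    a polynomial identity.\<close>
  define a b c where "a i = X x $ i" and "b i = Y x $ i" and "c i = Z x $ i" for i
  define a1 b1 c1 where "a1 j i = partial j (\<lambda>y. X y $ i) x" and "b1 j i = partial j (\<lambda>y. Y y $ i) x"
    and "c1 j i = partial j (\<lambda>y. Z y $ i) x" for i j
  define a2 b2 c2 where "a2 k j i = partial k (partial j (\<lambda>y. X y $ i)) x"
    and "b2 k j i = partial k (partial j (\<lambda>y. Y y $ i)) x"
    and "c2 k j i = partial k (partial j (\<lambda>y. Z y $ i)) x" for i j k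
  note defs = a_def b_def c_def a1_def b1_def c1_def a2_def b2_def c2_def
  have comm: "a2 2 1 i = a2 1 2 i" "a2 3 1 i = a2 1 3 i" "a2 3 2 i = a2 2 3 i"
    "b2 2 1 i = b2 1 2 i" "b2 3 1 i = b2 1 3 i" "b2 3 2 i = b2 2 3 i"
    "c2 2 1 i = c2 1 2 i" "c2 3 1 i = c2 1 3 i" "c2 3 2 i = c2 2 3 i" for i
    unfolding defs by (rule partial_commute[OF assms(1) _ assms(5)]; use assms in \<open>auto intro:
        smooth_on_nth\<close>)+
  have br: "local_bracket V W x $ i = (\<Sum>j\<in>UNIV.
     V x $ j * partial j (\<lambda>y. W y $ i) x - W x $ j * partial j (\<lambda>y. V y $ i) x)" for V W and i
    by (simp add: local_bracket_def)
  note p = partial_local_bracket[OF assms(1) _ _ assms(5)]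
  have "(local_bracket (local_bracket X Y) Z x + local_bracket (local_bracket Y Z) X x
    + local_bracket (local_bracket Z X) Y x) $ i = 0" for i
    unfolding vector_add_component br p[OF assms(2,3)] p[OF assms(3,4)] p[OF assms(4,2)]
    unfolding defs[symmetric] sum_3 comm by (simp add: algebra_simps)
  then show ?thesis by (simp add: vec_eq_iff)
qed

section \<open>Inverse matrices and their smooth dependence on the entries\<close>

lemma
  assumes "invertible A"
  shows matrix_inv_right: "A ** matrix_inv A = mat 1" and matrix_inv_left: "matrix_inv A ** A = mat 1"
proof -
  have "A ** matrix_inv A = mat 1 \<and> matrix_inv A ** A = mat 1"
    unfolding matrix_inv_def by (rule someI_ex) (use assms in \<open>simp add: invertible_def\<close>)
  then show "A ** matrix_inv A = mat 1" "matrix_inv A ** A = mat 1" by auto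
qed

text \<open>Cramer's rule, applied to the columns of the inverse, writes its entries as quotients of
  polynomials in the entries of \<open>A\<close>; smoothness of the inverse is read off from this
  form.\<close>

lemma matrix_inv_nth:
  fixes A :: "real^'n^'n::finite"
  assumes "det A \<noteq> 0"
  shows "matrix_inv A $ i $ j = det (\<chi> r c. if c = i then axis j 1 $ r else A $ r $ c) / det A"
proof -
  have "A *v (matrix_inv A *v axis j 1) = axis j 1"
    using assms by (simp add: matrix_vector_mul_assoc invertible_det_nz matrix_inv_right)
  then have "matrix_inv A *v axis j 1 = (\<chi> k. det (\<chi> r c. if c = k then axis j 1 $ r else A $ r $ c)
      / det A)"
    using cramer[OF assms] by blast
  from arg_cong[OF this, of "\<lambda>v. v $ i"] show ?thesis
    by (simp add: matrix_vector_mult_basis column_def)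
qed

lemma smooth_on_det3:
  fixes M :: "'a::real_normed_vector \<Rightarrow> real^3^3"
  assumes "open U" "\<And>i j. smooth_on U (\<lambda>x. M x $ i $ j)"
  shows "smooth_on U (\<lambda>x. det (M x))"
  unfolding det_3 using assms by (auto intro!: smooth_on_add smooth_on_diff smooth_on_mult)

lemma smooth_on_matrix_inv:
  fixes M :: "'a::real_normed_vector \<Rightarrow> real^3^3"
  assumes "open U" "\<And>i j. smooth_on U (\<lambda>x. M x $ i $ j)" "\<And>x. x \<in> U \<Longrightarrow> det (M x) \<noteq> 0"
  shows "smooth_on U (\<lambda>x. matrix_inv (M x) $ i $ j)"
proof -
  have "smooth_on U (\<lambda>x. det (\<chi> r c. if c = i then axis j 1 $ r else M x $ r $ c) / det (M x))"
  proof (intro smooth_on_divide smooth_on_det3 assms)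
    show "smooth_on U (\<lambda>x. (\<chi> r c. if c = i then axis j 1 $ r else M x $ r $ c) $ r $ c)" for r c
      using assms by (cases "c = i") simp_all
  qed
  then show ?thesis
    by (rule smooth_on_cong[OF assms(1), rotated]) (simp add: matrix_inv_nth assms(3))
qed

text \<open>The Killing equation differentiated once, solved for the second derivatives \<open>ddX\<close> in the same
  way as Christoffel symbols are obtained from metricity, at a single point and with all index
  sums expanded.\<close>

lemma killing_second_derivative_algebra:
  fixes g dX :: "3 \<Rightarrow> 3 \<Rightarrow> real" and d \<Gamma> ddX \<gamma> :: "3 \<Rightarrow> 3 \<Rightarrow> 3 \<Rightarrow> real"
    and dd d\<Gamma> d\<gamma> :: "3 \<Rightarrow> 3 \<Rightarrow> 3 \<Rightarrow> 3 \<Rightarrow> real" and X :: "3 \<Rightarrow> real"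
  assumes E: "\<And>i j. (\<Sum>k\<in>UNIV. X k * d k i j + g k j * dX k i + g i k * dX k j) = 0"
    and dE: "\<And>l i j. (\<Sum>k\<in>UNIV. dX k l * d k i j + X k * dd l k i j + d l k j * dX k i + g k j * ddX
        k l i
        + d l i k * dX k j + g i k * ddX k l j) = 0"
    and low: "\<And>l j k. 2 * \<gamma> l j k = d j l k + d k l j - d l j k"
    and dlow: "\<And>m l j k. 2 * d\<gamma> m l j k = dd m j l k + dd m k l j - dd m l j k"
    and up: "\<And>l j k. \<gamma> l j k = (\<Sum>i\<in>UNIV. g l i * \<Gamma> i j k)"
    and dup: "\<And>m l j k. d\<gamma> m l j k = (\<Sum>i\<in>UNIV. d m l i * \<Gamma> i j k + g l i * d\<Gamma> m i j k)"
    and sg: "\<And>i j. g i j = g j i" and sd: "\<And>k i j. d k i j = d k j i"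
    and sdd: "\<And>l k i j. dd l k i j = dd l k j i" "\<And>l k i j. dd l k i j = dd k l i j"
    and sX: "\<And>k i j. ddX k i j = ddX k j i"
  shows "(\<Sum>i\<in>UNIV. g l i * (ddX i j k + (\<Sum>m\<in>UNIV. X m * d\<Gamma> m i j k - dX i m * \<Gamma> m j k
      + \<Gamma> i m k * dX m j + \<Gamma> i j m * dX m k))) = 0"
proof -
  have "2 * (\<Sum>m\<in>UNIV. X m * d\<gamma> m l j k + \<gamma> m j k * dX m l + \<gamma> l m k * dX m j + \<gamma> l j m * dX m k
      + g l m * ddX m j k) =
    (\<Sum>m\<in>UNIV. X m * (2 * d\<gamma> m l j k) + (2 * \<gamma> m j k) * dX m l + (2 * \<gamma> l m k) * dX m j + (2 * \<gamma> l j
        m) * dX m k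
      + 2 * (g l m * ddX m j k))"
    by (simp add: sum_3)
  \<comment> \<open>The Christoffel combination of \<open>dE\<close>: the equation with indices l, k
    differentiated in direction j, plus the one with l, j in direction k, minus the one with j, k in
    direction l.\<close>
  also have "\<dots> = 
    (\<Sum>m\<in>UNIV. dX m j * d m l k + X m * dd j m l k + d j m k * dX m l + g m k * ddX m j l
        + d j l m * dX m k + g l m * ddX m j k)
    + (\<Sum>m\<in>UNIV. dX m k * d m l j + X m * dd k m l j + d k m j * dX m l + g m j * ddX m k l
        + d k l m * dX m j + g l m * ddX m k j)
    - (\<Sum>m\<in>UNIV. dX m l * d m j k + X m * dd l m j k + d l m k * dX m j + g m k * ddX m l j
        + d l j m * dX m k + g j m * ddX m l k)"
    unfolding low dlow sum.distrib[symmetric] sum_subtractf[symmetric]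
  proof (rule sum.cong[OF refl])
    fix m
    have "d l j m = d l m j" "g m j = g j m" "g m k = g k m" "ddX m l j = ddX m j l" "ddX m l k =
        ddX m k l"
      "ddX m k j = ddX m j k" "dd m j l k = dd j m l k" "dd m k l j = dd k m l j" "dd m l j k = dd l
          m j k"
      "d k m j = d k j m" "d j m k = d j k m" "d l m k = d l k m" "d m k j = d m j k" "d m k l = d m
          l k"
      "d m j l = d m l j"
      using sg sd sdd sX by blast+
    then show "X m * (dd m j l k + dd m k l j - dd m l j k) + (d j m k + d k m j - d m j k) * dX m l +
         (d m l k + d k l m - d l m k) * dX m j + (d j l m + d m l j - d l j m) * dX m k + 2 * (g l
             m * ddX m j k) =
         dX m j * d m l k + X m * dd j m l k + d j m k * dX m l + g m k * ddX m j l + d j l m * dX m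
             k + g l m * ddX m j k +
         (dX m k * d m l j + X m * dd k m l j + d k m j * dX m l + g m j * ddX m k l + d k l m * dX
             m j + g l m * ddX m k j) -
         (dX m l * d m j k + X m * dd l m j k + d l m k * dX m j + g m k * ddX m l j + d l j m * dX
             m k + g j m * ddX m l k)"
      by (simp add: algebra_simps)
  qed
  also have "\<dots> = 0" by (simp only: dE)
  finally have T: "(\<Sum>m\<in>UNIV. X m * d\<gamma> m l j k + \<gamma> m j k * dX m l + \<gamma> l m k * dX m j + \<gamma> l j m * dX m k
      + g l m * ddX m j k) = 0" by simp
  have sg': "g 2 1 = g 1 2" "g 3 1 = g 1 3" "g 3 2 = g 2 3" using sg by blast+
  \<comment> \<open>Passing from lowered to raised symbols costs \<open>\<Gamma>\<close> times the
    undifferentiated Killing equation, which vanishes by \<open>E\<close>.\<close>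
  have "(\<Sum>i\<in>UNIV. g l i * (ddX i j k + (\<Sum>m\<in>UNIV. X m * d\<Gamma> m i j k - dX i m * \<Gamma> m j k
      + \<Gamma> i m k * dX m j + \<Gamma> i j m * dX m k))) =
    (\<Sum>m\<in>UNIV. X m * d\<gamma> m l j k + \<gamma> m j k * dX m l + \<gamma> l m k * dX m j + \<gamma> l j m * dX m k
      + g l m * ddX m j k) - (\<Sum>i\<in>UNIV. \<Gamma> i j k * (\<Sum>m\<in>UNIV. X m * d m l i + g m i * dX m l + g l m *
          dX m i))"
    unfolding up dup sum_3 using sg' by (simp add: algebra_simps)
  with T E show ?thesis by simp
qed

section \<open>Connection, curvature and Killing equation in one coordinate system\<close>

locale local_metric =
  fixes U :: "(real^3) set" and G :: "real^3 \<Rightarrow> real^3^3"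
  assumes open_U: "open U" and smooth_G: "smooth_on U G"
    and transpose_G: "\<And>x. x \<in> U \<Longrightarrow> transpose (G x) = G x"
    and pos_G: "\<And>x v. x \<in> U \<Longrightarrow> v \<noteq> 0 \<Longrightarrow> v \<bullet> (G x *v v) > 0"
begin

lemma G_sym: "x \<in> U \<Longrightarrow> G x $ i $ j = G x $ j $ i"
  using transpose_G[of x] by (metis (no_types) transpose_def vec_lambda_beta)

lemma smooth_G_nth: "smooth_on U (\<lambda>x. G x $ i $ j)"
  by (intro smooth_on_nth open_U smooth_G)

lemma det_G: assumes "x \<in> U" shows "det (G x) \<noteq> 0"
proof
  assume "det (G x) = 0"
  then obtain v where "v \<noteq> 0" "G x *v v = 0"
    by (metis invertible_det_nz invertible_left_inverse matrix_left_invertible_ker)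
  then show False using pos_G[OF assms, of v] by simp
qed

lemma invertible_G: "x \<in> U \<Longrightarrow> invertible (G x)"
  using det_G invertible_det_nz by blast

lemma G_cancel:
  assumes "x \<in> U" "\<And>l. (\<Sum>i\<in>UNIV. G x $ l $ i * v i) = 0" shows "v i = 0"
proof -
  have "G x *v (\<chi> i. v i) = 0" using assms(2) by (simp add: matrix_vector_mult_def vec_eq_iff)
  then have "(\<chi> i. v i) = 0"
    using invertible_G[OF assms(1)] by (metis invertible_left_inverse matrix_left_invertible_ker)
  then show ?thesis by (metis vec_lambda_beta zero_index)
qed

lemma smooth_G_inv: "smooth_on U (\<lambda>x. matrix_inv (G x) $ i $ j)"
  by (rule smooth_on_matrix_inv) (use open_U smooth_G_nth det_G in auto)

lemma G_inv: "x \<in> U \<Longrightarrow> (\<Sum>i\<in>UNIV. G x $ l $ i * matrix_inv (G x) $ i $ m) = (if l = m then 1 else 0)"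
  using matrix_inv_right[OF invertible_G, of x]
  by (simp add: matrix_matrix_mult_def mat_def vec_eq_iff)

lemma partial_G_sym: "x \<in> U \<Longrightarrow> partial k (\<lambda>y. G y $ i $ j) x = partial k (\<lambda>y. G y $ j $ i) x"
  by (rule partial_cong[OF open_U]) (use G_sym in auto)

lemma christoffel_sym: "x \<in> U \<Longrightarrow> christoffel G i j k x = christoffel G i k j x"
  by (simp add: christoffel_def partial_G_sym[of x _ j k] algebra_simps)

lemma smooth_christoffel: "smooth_on U (christoffel G i j k)"
  unfolding christoffel_def[abs_def]
  by (intro smooth_intros open_U smooth_G_inv smooth_G)

lemma partial_christoffel_sym:
  "x \<in> U \<Longrightarrow> partial m (christoffel G i j k) x = partial m (christoffel G i k j) x"
  by (rule partial_cong[OF open_U]) (use christoffel_sym in auto)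

lemma christoffel_lower:
  assumes "x \<in> U"
  shows "(\<Sum>i\<in>UNIV. G x $ l $ i * christoffel G i j k x) =
    (1/2) * (partial j (\<lambda>y. G y $ l $ k) x + partial k (\<lambda>y. G y $ l $ j) x - partial l (\<lambda>y. G y $ j
        $ k) x)"
proof -
  let ?c = "\<lambda>l. partial j (\<lambda>y. G y $ l $ k) x + partial k (\<lambda>y. G y $ l $ j) x - partial l (\<lambda>y. G y $
      j $ k) x"
  have "(\<Sum>i\<in>UNIV. G x $ l $ i * christoffel G i j k x) =
      (1/2) * (\<Sum>i\<in>UNIV. \<Sum>m\<in>UNIV. (G x $ l $ i * matrix_inv (G x) $ i $ m) * ?c m)"
    by (simp add: christoffel_def sum_distrib_left mult.assoc mult.left_commute)
  also have "\<dots> = (1/2) * (\<Sum>m\<in>UNIV. (\<Sum>i\<in>UNIV. G x $ l $ i * matrix_inv (G x) $ i $ m) * ?c m)"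
    by (subst sum.swap) (simp add: sum_distrib_right)
  also have "\<dots> = (1/2) * ?c l"
    by (simp add: G_inv[OF assms] if_distrib[of "\<lambda>a. a * _"] cong: if_cong)
  finally show ?thesis .
qed

text \<open>Of the six derivatives in the two lowered Christoffel symbols, four cancel by symmetry
  of the metric and two agree.\<close>

lemma metric_compatible:
  assumes "x \<in> U"
  shows "partial k (\<lambda>y. G y $ i $ j) x =
    (\<Sum>l\<in>UNIV. G x $ j $ l * christoffel G l k i x + G x $ i $ l * christoffel G l k j x)"
  unfolding sum.distrib christoffel_lower[OF assms]
  using partial_G_sym[OF assms, of k i j] partial_G_sym[OF assms, of i j k] partial_G_sym[OF assms,
      of j i k]
  by (simp add: field_simps)

definition killing :: "(real^3 \<Rightarrow> real^3) \<Rightarrow> bool" where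
  "killing X \<longleftrightarrow> smooth_on U X \<and> (\<forall>x\<in>U. \<forall>i j. (\<Sum>k\<in>UNIV.
     X x $ k * partial k (\<lambda>y. G y $ i $ j) x +
     G x $ k $ j * partial i (\<lambda>y. X y $ k) x +
     G x $ i $ k * partial j (\<lambda>y. X y $ k) x) = 0)"

lemma killing_smooth: "killing X \<Longrightarrow> smooth_on U X"
  by (simp add: killing_def)

lemma killing_smooth_nth: "killing X \<Longrightarrow> smooth_on U (\<lambda>x. X x $ i)"
  by (simp add: killing_def smooth_on_nth open_U)

text \<open>This is the vanishing of the Lie derivative of the Levi-Civita connection along
  \<open>X\<close>: isometries preserve the connection. It expresses the second derivatives of
  \<open>X\<close> by values and first derivatives.\<close>

lemma killing_second_derivative:
  assumes "killing X" "x \<in> U"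
  shows "partial j (partial k (\<lambda>y. X y $ i)) x =
    - (\<Sum>m\<in>UNIV. X x $ m * partial m (christoffel G i j k) x - partial m (\<lambda>y. X y $ i) x *
        christoffel G m j k x
      + christoffel G i m k x * partial j (\<lambda>y. X y $ m) x + christoffel G i j m x * partial k (\<lambda>y. X
          y $ m) x)"
proof -
  have sm: "smooth_on U (\<lambda>y. X y $ i)" "smooth_on U (partial m (\<lambda>y. X y $ i))"
    "smooth_on U (\<lambda>y. G y $ i $ j)" "smooth_on U (partial m (\<lambda>y. G y $ i $ j))"
    "smooth_on U (christoffel G i j k)" for i j k m
    using killing_smooth_nth[OF assms(1)] smooth_G_nth smooth_christoffel by (auto intro:
        smooth_on_partial)
  note d = sm[THEN smooth_on_differentiable, OF assms(2)]
  have "(\<Sum>i\<in>UNIV. G x $ l $ i * (partial j (partial k (\<lambda>y. X y $ i)) x + (\<Sum>m\<in>UNIV. 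
      X x $ m * partial m (christoffel G i j k) x - partial m (\<lambda>y. X y $ i) x * christoffel G m j k x
      + christoffel G i m k x * partial j (\<lambda>y. X y $ m) x + christoffel G i j m x * partial k (\<lambda>y. X
          y $ m) x))) = 0" for l
  \<comment> \<open>\<open>\<gamma>\<close> and \<open>d\<gamma>\<close> are the lowered Christoffel
    symbols and their derivatives, so \<open>up\<close> and \<open>dup\<close> hold by definition,
    while \<open>low\<close> and \<open>dlow\<close> are the lowering formula and its
    derivative.\<close>
  proof (rule killing_second_derivative_algebra[where
        X = "\<lambda>k. X x $ k" and d = "\<lambda>k i j. partial k (\<lambda>y. G y $ i $ j) x"
        and g = "\<lambda>i j. G x $ i $ j" and dX = "\<lambda>k i. partial i (\<lambda>y. X y $ k) x"
        and dd = "\<lambda>l k i j. partial l (partial k (\<lambda>y. G y $ i $ j)) x"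
        and ddX = "\<lambda>k l i. partial l (partial i (\<lambda>y. X y $ k)) x"
        and \<Gamma> = "\<lambda>i j k. christoffel G i j k x" and d\<Gamma> = "\<lambda>m i j k. partial m (christoffel G i j k) x"
        and \<gamma> = "\<lambda>l j k. \<Sum>i\<in>UNIV. G x $ l $ i * christoffel G i j k x"
        and d\<gamma> = "\<lambda>m l j k. \<Sum>i\<in>UNIV. partial m (\<lambda>y. G y $ l $ i) x * christoffel G i j k x
            + G x $ l $ i * partial m (christoffel G i j k) x"], goal_cases)
    case (1 i j)
    then show ?case using assms by (simp add: killing_def)
  next
    case (2 l i j)
    have "0 = partial l (\<lambda>y. \<Sum>k\<in>UNIV.
     X y $ k * partial k (\<lambda>y. G y $ i $ j) y +
     G y $ k $ j * partial i (\<lambda>y. X y $ k) y +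
     G y $ i $ k * partial j (\<lambda>y. X y $ k) y) x"
      using assms(1) partial_cong[OF open_U assms(2), of "\<lambda>y. 0"] by (simp add: killing_def)
    also have "\<dots> = (\<Sum>k\<in>UNIV. partial l (\<lambda>y. X y $ k) x * partial k (\<lambda>y. G y $ i $ j) x
        + X x $ k * partial l (partial k (\<lambda>y. G y $ i $ j)) x
        + (partial l (\<lambda>y. G y $ k $ j) x * partial i (\<lambda>y. X y $ k) x + G x $ k $ j * partial l
            (partial i (\<lambda>y. X y $ k)) x)
        + (partial l (\<lambda>y. G y $ i $ k) x * partial j (\<lambda>y. X y $ k) x + G x $ i $ k * partial l
            (partial j (\<lambda>y. X y $ k)) x))"
      using d by (simp add: partial_sum partial_add partial_mult)
    finally show ?case by (simp add: add.assoc)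
  next
    case (3 l j k)
    then show ?case by (simp add: christoffel_lower[OF assms(2)])
  next
    case (4 m l j k)
    have "partial m (\<lambda>y. 2 * (\<Sum>i\<in>UNIV. G y $ l $ i * christoffel G i j k y)) x = partial m (\<lambda>y.
      partial j (\<lambda>y. G y $ l $ k) y + partial k (\<lambda>y. G y $ l $ j) y - partial l (\<lambda>y. G y $ j $ k) y) x"
      by (rule partial_cong[OF open_U assms(2)]) (simp add: christoffel_lower)
    then show ?case using d by (simp add: partial_sum partial_add partial_mult partial_diff)
  next
    case (9 l k i j)
    show ?case by (rule partial_cong[OF open_U assms(2)]) (simp add: partial_G_sym)
  next
    case (10 l k i j)
    show ?case by (rule partial_commute[OF open_U _ assms(2)]) (rule sm)
  next
    case (11 k i j)
    show ?case by (rule partial_commute[OF open_U _ assms(2)]) (rule sm)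
  qed (use G_sym[OF assms(2)] partial_G_sym[OF assms(2)] in auto)
  from G_cancel[OF assms(2) this, of i] show ?thesis by simp
qed

text \<open>The component with upper index \<open>i\<close> of the covariant derivative of
  \<open>X\<close> in direction \<open>j\<close>.\<close>

definition cov :: "(real^3 \<Rightarrow> real^3) \<Rightarrow> 3 \<Rightarrow> 3 \<Rightarrow> real^3 \<Rightarrow> real" where
  "cov X i j x = partial j (\<lambda>y. X y $ i) x + (\<Sum>k\<in>UNIV. christoffel G i j k x * X x $ k)"

lemma smooth_cov: "smooth_on U X \<Longrightarrow> smooth_on U (cov X i j)"
  unfolding cov_def[abs_def] by (intro smooth_intros open_U smooth_christoffel)

text \<open>The Killing equation with the derivatives of the metric replaced by Christoffel symbols;
  pointwise, the covariant derivative is an infinitesimal rotation.\<close>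

lemma cov_skew:
  assumes "killing X" "x \<in> U"
  shows "(\<Sum>l\<in>UNIV. G x $ i $ l * cov X l j x + G x $ j $ l * cov X l i x) = 0"
proof -
  have "(\<Sum>k\<in>UNIV. X x $ k * partial k (\<lambda>y. G y $ i $ j) x +
     G x $ k $ j * partial i (\<lambda>y. X y $ k) x + G x $ i $ k * partial j (\<lambda>y. X y $ k) x) = 0"
    using assms by (simp add: killing_def)
  then show ?thesis
    unfolding metric_compatible[OF assms(2)] cov_def sum_3
    by (simp add: algebra_simps christoffel_sym[OF assms(2)] G_sym[OF assms(2)])
qed

text \<open>Kostant's identity: the second covariant derivative of a Killing field is the curvature
  applied to the field. Together with the definition of \<open>cov\<close> it gives a closed
  first-order linear system for \<open>X\<close> and \<open>cov X\<close>.\<close>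

lemma partial_cov:
  assumes "killing X" "x \<in> U"
  shows "partial k (cov X i j) x = (\<Sum>l\<in>UNIV. riemann G i j k l x * X x $ l
     - christoffel G i k l x * cov X l j x + christoffel G l k j x * cov X i l x)"
proof -
  have sm: "smooth_on U (\<lambda>y. X y $ i)" "smooth_on U (partial m (\<lambda>y. X y $ i))" "smooth_on U
      (christoffel G i j k)" for i j k m
    using killing_smooth_nth[OF assms(1)] smooth_christoffel by (auto intro: smooth_on_partial)
  note d = sm[THEN smooth_on_differentiable, OF assms(2)]
  have "partial k (cov X i j) x = partial k (partial j (\<lambda>y. X y $ i)) x
     + (\<Sum>l\<in>UNIV. partial k (christoffel G i j l) x * X x $ l + christoffel G i j l x * partial k
         (\<lambda>y. X y $ l) x)"
    unfolding cov_def[abs_def] using d by (simp add: partial_sum partial_add partial_mult)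
  then show ?thesis
    unfolding killing_second_derivative[OF assms] riemann_def cov_def sum_3
    by (simp add: algebra_simps christoffel_sym[OF assms(2)] partial_christoffel_sym[OF assms(2)])
qed

lemma riemann_skew: "riemann G i j k l x = - riemann G i j l k x"
  by (simp add: riemann_def sum_subtractf)

lemma riemann_bianchi:
  assumes "x \<in> U"
  shows "riemann G i j k l x + riemann G i k l j x + riemann G i l j k x = 0"
  unfolding riemann_def using christoffel_sym[OF assms] partial_christoffel_sym[OF assms]
  by (simp add: sum_subtractf)

lemma local_bracket_cov:
  assumes "x \<in> U"
  shows "local_bracket X Y x $ i = (\<Sum>j\<in>UNIV. X x $ j * cov Y i j x - Y x $ j * cov X i j x)"
  unfolding local_bracket_def cov_def sum_3 
  by (simp add: algebra_simps christoffel_sym[OF assms])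

lemma smooth_riemann: "smooth_on U (riemann G i j k l)"
  unfolding riemann_def[abs_def]
  by (intro smooth_on_add smooth_on_diff smooth_on_sum smooth_on_mult smooth_on_partial open_U
      smooth_christoffel)

text \<open>Differentiating the torsion-free formula for the bracket and inserting
  \<open>partial_cov\<close> leaves a commutator of the covariant derivatives and two curvature
  terms, which the first Bianchi identity merges into R(X, Y).\<close>

lemma cov_local_bracket:
  assumes "killing X" "killing Y" "x \<in> U"
  shows "cov (local_bracket X Y) i k x = (\<Sum>j\<in>UNIV. cov Y i j x * cov X j k x - cov X i j x * cov Y j
      k x)
     + (\<Sum>j\<in>UNIV. \<Sum>l\<in>UNIV. riemann G i k j l x * X x $ j * Y x $ l)"
proof -
  have d: "(\<lambda>y. X y $ i) differentiable (at x)" "(\<lambda>y. Y y $ i) differentiable (at x)"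
    "cov X i j differentiable (at x)" "cov Y i j differentiable (at x)" for i j
    using assms by (auto intro!: smooth_on_differentiable[OF _ assms(3)] killing_smooth_nth
        smooth_cov killing_smooth)
  have pX: "partial k (\<lambda>y. X y $ j) x = cov X j k x - (\<Sum>m\<in>UNIV. christoffel G j k m x * X x $ m)"
    and pY: "partial k (\<lambda>y. Y y $ j) x = cov Y j k x - (\<Sum>m\<in>UNIV. christoffel G j k m x * Y x $ m)" for j
    by (simp_all add: cov_def)
  have "partial k (\<lambda>y. local_bracket X Y y $ i) x = partial k (\<lambda>y. \<Sum>j\<in>UNIV. X y $ j * cov Y i j y -
      Y y $ j * cov X i j y) x"
    by (rule partial_cong[OF open_U assms(3)]) (rule local_bracket_cov)
  also have "\<dots> = (\<Sum>j\<in>UNIV. partial k (\<lambda>y. X y $ j) x * cov Y i j x + X x $ j * partial k (cov Y i j) x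
     - (partial k (\<lambda>y. Y y $ j) x * cov X i j x + Y x $ j * partial k (cov X i j) x))"
    using d by (simp add: partial_sum partial_diff partial_mult)
  finally have 1: "cov (local_bracket X Y) i k x = \<dots> + (\<Sum>m\<in>UNIV. christoffel G i k m x
      * (\<Sum>j\<in>UNIV. X x $ j * cov Y m j x - Y x $ j * cov X m j x))"
    by (simp add: cov_def local_bracket_cov[OF assms(3)])
  define c where "c i k = (\<Sum>j\<in>UNIV. cov Y i j x * cov X j k x - cov X i j x * cov Y j k x)" for i k
  have "cov (local_bracket X Y) i k x = c i k
     + (\<Sum>j\<in>UNIV. \<Sum>l\<in>UNIV. (riemann G i j k l x - riemann G i l k j x) * X x $ j * Y x $ l)"
    unfolding 1 c_def pX pY partial_cov[OF assms(1,3)] partial_cov[OF assms(2,3)] sum_3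
    by (simp add: algebra_simps christoffel_sym[OF assms(3)])
  moreover have "riemann G i j k l x - riemann G i l k j x = riemann G i k j l x" for j l
    using riemann_bianchi[OF assms(3), of i j k l] riemann_skew[of i k l j x] riemann_skew[of i l j
        k x] by simp
  ultimately show ?thesis by (simp add: c_def)
qed

end

text \<open>Gronwall's argument along the segment from \<open>y\<close> to \<open>x\<close>, applied to \<open>\<Sum>s. (\<psi> s)\<^sup>2\<close>.\<close>

lemma linear_pde_unique:
  fixes \<psi> :: "'s::finite \<Rightarrow> real^'n::finite \<Rightarrow> real"
  assumes "convex B" "\<And>s x. x \<in> B \<Longrightarrow> \<psi> s differentiable (at x)"
    and bound: "\<And>s k x. x \<in> B \<Longrightarrow> \<bar>partial k (\<psi> s) x\<bar> \<le> C * (\<Sum>t\<in>UNIV. \<bar>\<psi> t x\<bar>)"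
    and "y \<in> B" "\<And>s. \<psi> s y = 0" "x \<in> B"
  shows "\<psi> s x = 0"
proof -
  define v where "v = x - y"
  define p where "p t = y + t *\<^sub>R v" for t
  have pB: "p t \<in> B" if "0 \<le> t" "t \<le> 1" for t
    using convexD_alt[OF assms(1,4,6) that] by (simp add: p_def v_def algebra_simps)
  define \<phi> where "\<phi> t = (\<Sum>s\<in>UNIV. (\<psi> s (p t))\<^sup>2)" for t
  define d\<phi> where "d\<phi> t = (\<Sum>s\<in>UNIV. 2 * \<psi> s (p t) * (\<Sum>k\<in>UNIV. v $ k * partial k (\<psi> s) (p t)))" for t
  \<comment> \<open>The factor 2 comes from differentiating squares, the sum over \<open>k\<close>
    from the directional derivative, and \<open>CARD('s)\<close> from Cauchy-Schwarz for the square
    of the sum of all |\<psi> s|.\<close>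
  define D where "D = 2 * \<bar>C\<bar> * (\<Sum>k\<in>UNIV. \<bar>v $ k\<bar>) * real (CARD('s))"
  have der: "(\<phi> has_real_derivative d\<phi> t) (at t)" if "0 \<le> t" "t \<le> 1" for t
  proof -
    have "((\<lambda>t. \<psi> s (p t)) has_real_derivative (\<Sum>k\<in>UNIV. v $ k * partial k (\<psi> s) (p t))) (at t)" for s
    proof -
      have "(p has_derivative (\<lambda>h. h *\<^sub>R v)) (at t)"
        unfolding p_def by (auto intro!: derivative_eq_intros)
      from has_derivative_compose[OF this has_derivative_partial[OF assms(2)[OF pB[OF that]]], of s]
      have "((\<lambda>t. \<psi> s (p t)) has_derivative (\<lambda>h. \<Sum>k\<in>UNIV. (h *\<^sub>R v) $ k * partial k (\<psi> s) (p t)))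
          (at t)" .
      moreover have "(\<Sum>k\<in>UNIV. (h *\<^sub>R v) $ k * partial k (\<psi> s) (p t)) = (\<Sum>k\<in>UNIV. v $ k * partial k
          (\<psi> s) (p t)) * h" for h
        by (simp add: sum_distrib_left mult_ac)
      ultimately show ?thesis by (simp add: has_field_derivative_def)
    qed
    then show ?thesis unfolding \<phi>_def d\<phi>_def
      by (auto intro!: derivative_eq_intros sum.cong)
  qed
  have est: "d\<phi> t \<le> D * \<phi> t" if "0 \<le> t" "t \<le> 1" for t
  proof -
    let ?S = "\<Sum>s\<in>UNIV. \<bar>\<psi> s (p t)\<bar>" and ?V = "\<Sum>k\<in>UNIV. \<bar>v $ k\<bar>"
    have S0: "0 \<le> ?S" and V0: "0 \<le> ?V" by (auto intro: sum_nonneg)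
    have "\<bar>partial k (\<psi> s) (p t)\<bar> \<le> \<bar>C\<bar> * ?S" for k s
      using bound[OF pB[OF that], of k s] S0 mult_right_mono[of C "\<bar>C\<bar>" ?S] by linarith
    then have "\<bar>\<Sum>k\<in>UNIV. v $ k * partial k (\<psi> s) (p t)\<bar> \<le> (\<Sum>k\<in>UNIV. \<bar>v $ k\<bar> * (\<bar>C\<bar> * ?S))" for s
      by (intro order_trans[OF sum_abs] sum_mono) (simp add: abs_mult mult_left_mono)
    then have inner: "\<bar>\<Sum>k\<in>UNIV. v $ k * partial k (\<psi> s) (p t)\<bar> \<le> ?V * (\<bar>C\<bar> * ?S)" for s
      by (simp add: sum_distrib_right)
    have "d\<phi> t \<le> (\<Sum>s\<in>UNIV. 2 * \<bar>\<psi> s (p t)\<bar> * (?V * (\<bar>C\<bar> * ?S)))"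
      unfolding d\<phi>_def
    proof (rule sum_mono)
      fix s
      have "2 * \<psi> s (p t) * (\<Sum>k\<in>UNIV. v $ k * partial k (\<psi> s) (p t)) \<le>
        \<bar>2 * \<psi> s (p t)\<bar> * \<bar>\<Sum>k\<in>UNIV. v $ k * partial k (\<psi> s) (p t)\<bar>"
        unfolding abs_mult[symmetric] by (rule abs_ge_self)
      also have "\<dots> \<le> \<bar>2 * \<psi> s (p t)\<bar> * (?V * (\<bar>C\<bar> * ?S))"
        by (intro mult_left_mono inner) simp
      finally show "2 * \<psi> s (p t) * (\<Sum>k\<in>UNIV. v $ k * partial k (\<psi> s) (p t)) \<le> 2 * \<bar>\<psi> s (p t)\<bar> * (?V
          * (\<bar>C\<bar> * ?S))"
        by (simp add: abs_mult)
    qed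
    also have "\<dots> = (2 * ?V * \<bar>C\<bar>) * ?S\<^sup>2"
      by (simp add: sum_distrib_right[symmetric] sum_distrib_left[symmetric] power2_eq_square)
    also have "\<dots> \<le> (2 * ?V * \<bar>C\<bar>) * (real CARD('s) * \<phi> t)"
    proof (rule mult_left_mono)
      show "?S\<^sup>2 \<le> real CARD('s) * \<phi> t"
        using sum_squared_le_sum_of_squares[of "\<lambda>s. \<bar>\<psi> s (p t)\<bar>" UNIV] by (simp add: \<phi>_def mult.commute)
    qed (use V0 in simp)
    finally show ?thesis by (simp add: D_def mult_ac)
  qed
  have "exp (- D * 1) * \<phi> 1 \<le> exp (- D * 0) * \<phi> 0"
  proof (rule DERIV_nonpos_imp_nonincreasing[where f = "\<lambda>t. exp (- D * t) * \<phi> t"])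
    fix t :: real assume t: "0 \<le> t" "t \<le> 1"
    have "((\<lambda>t. exp (- D * t) * \<phi> t) has_real_derivative (exp (- D * t) * (d\<phi> t - D * \<phi> t))) (at t)"
      by (auto intro!: derivative_eq_intros der[OF t] simp: algebra_simps)
    moreover have "exp (- D * t) * (d\<phi> t - D * \<phi> t) \<le> 0"
      using est[OF t] by (simp add: mult_nonneg_nonpos)
    ultimately show "\<exists>y. ((\<lambda>t. exp (- D * t) * \<phi> t) has_real_derivative y) (at t) \<and> y \<le> 0" by blast
  qed simp
  also have "\<phi> 0 = 0" by (simp add: \<phi>_def p_def assms(5))
  finally have "\<phi> 1 \<le> 0" by (simp add: mult_le_0_iff)
  moreover have "0 \<le> \<phi> 1" by (simp add: \<phi>_def sum_nonneg)
  ultimately have "\<phi> 1 = 0" by simp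
  then have "\<psi> s (p 1) = 0" unfolding \<phi>_def by (subst (asm) sum_nonneg_eq_0_iff) auto
  then show ?thesis by (simp add: p_def v_def)
qed

text \<open>By \<open>partial_cov\<close> the components of \<open>X\<close> and
  \<open>cov X\<close> satisfy a linear system whose coefficients, Christoffel symbols and
  curvature, are bounded on the compact closed ball.\<close>

lemma (in local_metric) killing_zero_ball:
  assumes "killing X" "cball z r \<subseteq> U" "y \<in> ball z r" "X y = 0" "\<And>i j. cov X i j y = 0" "x \<in> ball z r"
  shows "X x = 0"
proof -
  have c: "continuous_on U (christoffel G i j k)" "continuous_on U (riemann G i j k l)" for i j k l
    by (auto intro: smooth_on_continuous_on smooth_christoffel smooth_riemann)
  let ?B = "\<lambda>x. (\<Sum>i\<in>UNIV. \<Sum>j\<in>UNIV. \<Sum>k\<in>UNIV. \<bar>christoffel G i j k x\<bar>)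
      + (\<Sum>i\<in>UNIV. \<Sum>j\<in>UNIV. \<Sum>k\<in>UNIV. \<Sum>l\<in>UNIV. \<bar>riemann G i j k l x\<bar>)"
  have "continuous_on (cball z r) ?B"
    using c by (intro continuous_on_add continuous_on_sum continuous_on_rabs) (auto intro:
        continuous_on_subset[OF _ assms(2)])
  then have "bounded (?B ` cball z r)"
    using compact_continuous_image compact_imp_bounded compact_cball by blast
  then obtain M where M0: "\<forall>b\<in>?B ` cball z r. norm b \<le> M"
    unfolding bounded_iff by blast
  have M: "\<bar>?B x\<bar> \<le> M" if "x \<in> cball z r" for x
    using M0[rule_format, OF imageI[OF that]] by simp
  have \<Gamma>: "\<bar>christoffel G i j k x\<bar> \<le> M" and R: "\<bar>riemann G i j k l x\<bar> \<le> M" if "x \<in> cball z r" for i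
      j k l x
  proof -
    let ?a = "\<Sum>i\<in>UNIV. \<Sum>j\<in>UNIV. \<Sum>k\<in>UNIV. \<bar>christoffel G i j k x\<bar>"
    let ?b = "\<Sum>i\<in>UNIV. \<Sum>j\<in>UNIV. \<Sum>k\<in>UNIV. \<Sum>l\<in>UNIV. \<bar>riemann G i j k l x\<bar>"
    have le: "f i \<le> (\<Sum>i\<in>UNIV. f i)" if "\<And>i. 0 \<le> f i" for f :: "3 \<Rightarrow> real" and i
      by (rule member_le_sum) (use that in auto)
    have "\<bar>christoffel G i j k x\<bar> \<le> (\<Sum>k\<in>UNIV. \<bar>christoffel G i j k x\<bar>)" by (rule le) simp
    also have "\<dots> \<le> (\<Sum>j\<in>UNIV. \<Sum>k\<in>UNIV. \<bar>christoffel G i j k x\<bar>)" by (rule le) (simp add: sum_nonneg)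
    also have "\<dots> \<le> ?a" by (rule le) (simp add: sum_nonneg)
    finally have "\<bar>christoffel G i j k x\<bar> \<le> ?a" .
    moreover have "\<bar>riemann G i j k l x\<bar> \<le> ?b"
    proof -
      have "\<bar>riemann G i j k l x\<bar> \<le> (\<Sum>l\<in>UNIV. \<bar>riemann G i j k l x\<bar>)" by (rule le) simp
      also have "\<dots> \<le> (\<Sum>k\<in>UNIV. \<Sum>l\<in>UNIV. \<bar>riemann G i j k l x\<bar>)" by (rule le) (simp add: sum_nonneg)
      also have "\<dots> \<le> (\<Sum>j\<in>UNIV. \<Sum>k\<in>UNIV. \<Sum>l\<in>UNIV. \<bar>riemann G i j k l x\<bar>)" by (rule le) (simp add:
          sum_nonneg)
      also have "\<dots> \<le> ?b" by (rule le) (simp add: sum_nonneg)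
      finally show ?thesis .
    qed
    moreover have "0 \<le> ?a" "0 \<le> ?b" by (intro sum_nonneg abs_ge_zero)+
    ultimately show "\<bar>christoffel G i j k x\<bar> \<le> M" "\<bar>riemann G i j k l x\<bar> \<le> M" using M[OF that] by
        linarith+
  qed
  have "0 \<le> M" using M[of y] assms(3) by (meson abs_ge_zero ball_subset_cball order_trans subsetD)
  \<comment> \<open>One index type for all twelve unknowns: \<open>None\<close> selects the
    components of \<open>X\<close>, \<open>Some j\<close> those of \<open>cov X\<close> in direction
    \<open>j\<close>.\<close>
  define \<psi> where "\<psi> = (\<lambda>(s, i). case s of None \<Rightarrow> (\<lambda>x. X x $ i) | Some j \<Rightarrow> cov X i j)"
  have "\<psi> (None, i) x = 0" for i
  \<comment> \<open>A derivative of \<open>X\<close> costs one entry of \<open>cov X\<close> and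
    three Christoffel products; a derivative of \<open>cov X\<close> costs nine products with factor
    at most \<open>M\<close>.\<close>
  proof (rule linear_pde_unique[where B = "ball z r" and C = "1 + 9 * M" and \<psi> = \<psi> and y = y])
    fix s x assume "x \<in> ball z r"
    with assms(2) have "x \<in> U" using ball_subset_cball by blast
    then show "\<psi> s differentiable at x"
      using assms(1) by (cases s; cases "fst s") (auto simp: \<psi>_def intro!: smooth_on_differentiable
          killing_smooth_nth smooth_cov killing_smooth)
  next
    fix s k x assume xb: "x \<in> ball z r"
    then have xc: "x \<in> cball z r" and xU: "x \<in> U" using assms(2) ball_subset_cball by blast+
    let ?S = "\<Sum>t\<in>UNIV. \<bar>\<psi> t x\<bar>"
    have le: "\<bar>\<psi> t x\<bar> \<le> ?S" for t by (rule member_le_sum) auto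
    have leX: "\<bar>X x $ i\<bar> \<le> ?S" and leC: "\<bar>cov X i j x\<bar> \<le> ?S" for i j
      using le[of "(None, i)"] le[of "(Some j, i)"] by (auto simp: \<psi>_def)
    have m: "\<bar>a * b\<bar> \<le> M * ?S" if "\<bar>a\<bar> \<le> M" "\<bar>b\<bar> \<le> ?S" for a b
      using that by (simp add: abs_mult mult_mono)
    have MS: "0 \<le> M * ?S" using \<open>0 \<le> M\<close> by (simp add: sum_nonneg)
    have 1: "\<bar>partial k (\<lambda>x. X x $ i) x\<bar> \<le> (1 + 9 * M) * ?S" for i
    proof -
      have "partial k (\<lambda>x. X x $ i) x = cov X i k x - (\<Sum>l\<in>UNIV. christoffel G i k l x * X x $ l)"
        by (simp add: cov_def)
      moreover have "\<bar>\<Sum>l\<in>UNIV. christoffel G i k l x * X x $ l\<bar> \<le> (\<Sum>l\<in>(UNIV::3 set). M * ?S)"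
        by (intro order_trans[OF sum_abs] sum_mono m \<Gamma> xc leX)
      ultimately show ?thesis using leC[of i k] MS by (simp add: algebra_simps)
    qed
    have 2: "\<bar>partial k (cov X i j) x\<bar> \<le> (1 + 9 * M) * ?S" for i j
    proof -
      have "\<bar>partial k (cov X i j) x\<bar> \<le> (\<Sum>l\<in>(UNIV::3 set). 3 * (M * ?S))"
        unfolding partial_cov[OF assms(1) xU]
      proof (intro order_trans[OF sum_abs] sum_mono)
        fix l
        have "\<bar>riemann G i j k l x * X x $ l\<bar> \<le> M * ?S" "\<bar>christoffel G i k l x * cov X l j x\<bar> \<le> M * ?S"
          "\<bar>christoffel G l k j x * cov X i l x\<bar> \<le> M * ?S"
          using \<Gamma>[OF xc] R[OF xc] leX leC by (intro m; blast)+
        then show "\<bar>riemann G i j k l x * X x $ l - christoffel G i k l x * cov X l j x +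
            christoffel G l k j x * cov X i l x\<bar>
          \<le> 3 * (M * ?S)" by linarith
      qed
      also have "\<dots> \<le> (1 + 9 * M) * ?S" by (simp add: algebra_simps sum_nonneg)
      finally show ?thesis .
    qed
    show "\<bar>partial k (\<psi> s) x\<bar> \<le> (1 + 9 * M) * ?S"
      using 1 2 by (cases s; cases "fst s") (simp_all add: \<psi>_def)
  qed (use assms in \<open>auto simp: \<psi>_def split: option.splits\<close>)
  then show ?thesis by (simp add: \<psi>_def vec_eq_iff)
qed

section \<open>Charts, and the identity theorem for Killing fields\<close>

lemma vf_eq_on_subset: "vf_eq_on A W X Y \<Longrightarrow> W' \<subseteq> W \<Longrightarrow> vf_eq_on A W' X Y"
  by (auto simp: vf_eq_on_def coords_def)

lemma vf_eq_on_sym: "vf_eq_on A W X Y \<Longrightarrow> vf_eq_on A W Y X"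
  by (simp add: vf_eq_on_def)

lemma vf_eq_on_trans: "vf_eq_on A W X Y \<Longrightarrow> vf_eq_on A W Y Z \<Longrightarrow> vf_eq_on A W X Z"
  by (simp add: vf_eq_on_def)

locale riemannian_3manifold =
  fixes A :: "('m::{t2_space, second_countable_topology}, 3) chart set"
    and g :: "('m, 3) metric"
  assumes atlas: "smooth_atlas A" and metric: "riemannian_metric A g"
begin

lemma chart: "c \<in> A \<Longrightarrow> is_chart c"
  using atlas by (simp add: smooth_atlas_def)

lemma chart_cover: obtains c where "c \<in> A" "p \<in> fst c"
proof -
  have "p \<in> (\<Union>c\<in>A. fst c)" using atlas by (simp add: smooth_atlas_def)
  then show ?thesis using that by blast
qed

lemma chart_homeo: "c \<in> A \<Longrightarrow> homeomorphism (fst c) (coords c UNIV) (snd c) (chart_inv c)"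
  using chart by (simp add: is_chart_def)

lemma open_chart: "c \<in> A \<Longrightarrow> open (fst c)" "c \<in> A \<Longrightarrow> open (coords c UNIV)"
  using chart by (auto simp: is_chart_def)

lemma chart_inv_snd: "c \<in> A \<Longrightarrow> q \<in> fst c \<Longrightarrow> chart_inv c (snd c q) = q"
  using chart_homeo by (metis homeomorphism_apply1)

lemma coordsE:
  assumes "c \<in> A" "x \<in> coords c W"
  obtains "chart_inv c x \<in> fst c" "chart_inv c x \<in> W" "snd c (chart_inv c x) = x"
proof -
  obtain q where q: "q \<in> fst c" "q \<in> W" "x = snd c q" using assms(2) by (auto simp: coords_def)
  show ?thesis using q chart_inv_snd[OF assms(1) q(1)] by (intro that) simp_all
qed

lemma coordsI: "q \<in> fst c \<Longrightarrow> q \<in> W \<Longrightarrow> snd c q \<in> coords c W"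
  by (auto simp: coords_def)

lemma coords_mono: "W \<subseteq> W' \<Longrightarrow> coords c W \<subseteq> coords c W'"
  by (auto simp: coords_def)

lemma open_coords:
  assumes "c \<in> A" "open W" shows "open (coords c W)"
proof -
  have "openin (top_of_set (coords c UNIV)) (snd c ` (fst c \<inter> W))"
    by (rule homeomorphism_imp_open_map[OF chart_homeo[OF assms(1)]]) (use assms(2) in auto)
  then show ?thesis
    using open_chart(2)[OF assms(1)] openin_open_trans by (auto simp: coords_def)
qed

lemma open_chart_preimage:
  assumes "c \<in> A" "open B" shows "open {q \<in> fst c. snd c q \<in> B}"
proof -
  have "continuous_on (fst c) (snd c)" using chart_homeo[OF assms(1)] by (simp add: homeomorphism_def)
  from continuous_open_preimage[OF this open_chart(1)[OF assms(1)] assms(2)] have "open (fst c \<inter> snd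
      c -` B)" .
  moreover have "{q \<in> fst c. snd c q \<in> B} = fst c \<inter> snd c -` B" by auto
  ultimately show ?thesis by simp
qed

text \<open>Such neighbourhoods are connected, as algebras of Killing fields require, and convex in
  coordinates, as the uniqueness and potential arguments require.\<close>

definition chart_ball :: "('m, 3) chart \<Rightarrow> real^3 \<Rightarrow> real \<Rightarrow> 'm set" where
  "chart_ball c z r = {q \<in> fst c. snd c q \<in> ball z r}"

lemma chart_ball:
  assumes "c \<in> A" "ball z r \<subseteq> coords c W"
  shows "open (chart_ball c z r)" "connected (chart_ball c z r)" "chart_ball c z r \<subseteq> W"
    "chart_ball c z r \<subseteq> fst c" "coords c (chart_ball c z r) = ball z r"
proof -
  show "open (chart_ball c z r)" unfolding chart_ball_def by (rule open_chart_preimage) (use assms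
      in auto)
  have "chart_ball c z r = chart_inv c ` ball z r"
  proof (intro equalityI subsetI)
    fix q assume "q \<in> chart_ball c z r"
    then show "q \<in> chart_inv c ` ball z r"
      using chart_inv_snd[OF assms(1)] by (force simp: chart_ball_def)
  next
    fix q assume "q \<in> chart_inv c ` ball z r"
    then obtain x where x: "x \<in> ball z r" "q = chart_inv c x" by blast
    with assms(2) have "x \<in> coords c W" by blast
    with x show "q \<in> chart_ball c z r" by (auto simp: chart_ball_def elim!: coordsE[OF assms(1)])
  qed
  moreover have "continuous_on (ball z r) (chart_inv c)"
    using chart_homeo[OF assms(1)] assms(2) coords_mono[of W UNIV c]
    by (auto simp: homeomorphism_def intro: continuous_on_subset)
  ultimately show "connected (chart_ball c z r)"
    by (metis connected_continuous_image connected_ball)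
  show "chart_ball c z r \<subseteq> W"
  proof
    fix q assume q: "q \<in> chart_ball c z r"
    then have "snd c q \<in> coords c W" using assms(2) by (auto simp: chart_ball_def)
    then show "q \<in> W" using q chart_inv_snd[OF assms(1), of q] by (auto simp: chart_ball_def elim!:
        coordsE[OF assms(1)])
  qed
  show "chart_ball c z r \<subseteq> fst c" by (auto simp: chart_ball_def)
  show "coords c (chart_ball c z r) = ball z r"
  proof (intro equalityI subsetI)
    fix x assume "x \<in> ball z r"
    moreover from this assms(2) have "x \<in> coords c W" by blast
    ultimately show "x \<in> coords c (chart_ball c z r)"
      using coordsI[of "chart_inv c x" c "chart_ball c z r"]
      by (auto simp: chart_ball_def elim!: coordsE[OF assms(1)])
  qed (auto simp: coords_def chart_ball_def)
qed

lemma chart_ball_exists: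
  assumes "c \<in> A" "open W" "p \<in> W" "p \<in> fst c"
  obtains r where "r > 0" "cball (snd c p) r \<subseteq> coords c W" "p \<in> chart_ball c (snd c p) r"
proof -
  obtain r where "r > 0" "cball (snd c p) r \<subseteq> coords c W"
    using open_contains_cball open_coords[OF assms(1,2)] coordsI[OF assms(4,3)] by blast
  then show ?thesis using that assms(4) by (auto simp: chart_ball_def)
qed

lemma transition:
  assumes "c \<in> A" "d \<in> A" "x \<in> coords c (fst d \<inter> W)"
  shows "transition c d x = snd d (chart_inv c x)" "transition c d x \<in> coords d (fst c \<inter> W)"
    "chart_inv d (transition c d x) = chart_inv c x"
proof -
  show 1: "transition c d x = snd d (chart_inv c x)" by (simp add: transition_def)
  show "transition c d x \<in> coords d (fst c \<inter> W)" "chart_inv d (transition c d x) = chart_inv c x"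
    unfolding 1 using assms chart_inv_snd[OF assms(2)] by (auto elim!: coordsE[OF assms(1)] intro:
        coordsI)
qed

lemma transition_has_derivative:
  assumes "c \<in> A" "d \<in> A" "x \<in> coords c (fst d)"
  shows "(transition c d has_derivative (\<lambda>v. jacobian c d x *v v)) (at x)"
proof -
  have "smooth_on (coords c (fst d)) (transition c d)"
    using atlas assms by (auto simp: smooth_atlas_def)
  then have d: "transition c d differentiable (at x)" using assms(3) by (rule smooth_on_differentiable)
  show ?thesis
    unfolding jacobian_def
    using matrix_works[OF iffD2[OF linear_matrix_vector_mul_eq linear_frechet_derivative[OF d]]]
        frechet_derivative_works_at[OF d]
    by simp
qed

lemma local_metric:
  assumes "c \<in> A" "open W" shows "local_metric (coords c W) (g c)"
proof
  show "open (coords c W)" using open_coords assms by blast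
  show "smooth_on (coords c W) (g c)"
    using metric assms(1) coords_mono[of W UNIV c] by (auto simp: riemannian_metric_def intro:
        smooth_on_subset)
qed (use metric assms(1) coords_mono[of W UNIV c] in \<open>auto simp: riemannian_metric_def\<close>)

lemma metric_transform:
  assumes "c \<in> A" "d \<in> A" "x \<in> coords c (fst d)"
  shows "v \<bullet> (g c x *v w) = (jacobian c d x *v v) \<bullet> (g d (transition c d x) *v (jacobian c d x *v w))"
proof -
  have "g c x = transpose (jacobian c d x) ** g d (transition c d x) ** jacobian c d x"
    using metric assms by (auto simp: riemannian_metric_def)
  moreover have "v \<bullet> (transpose (jacobian c d x) *v z) = (jacobian c d x *v v) \<bullet> z" for z
    by (simp only: dot_lmul_matrix[symmetric] vector_transpose_matrix)
  ultimately show ?thesis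
    by (simp only: matrix_vector_mul_assoc[symmetric])
qed

text \<open>A non-zero vector killed by the Jacobian would have length zero by the transformation
  law of the metric.\<close>

lemma jacobian_inj:
  assumes "c \<in> A" "d \<in> A" "x \<in> coords c (fst d)" "jacobian c d x *v v = 0"
  shows "v = 0"
proof (rule ccontr)
  assume "v \<noteq> 0"
  moreover have "x \<in> coords c UNIV" using assms(3) coords_mono[of "fst d" UNIV c] by blast
  ultimately have "v \<bullet> (g c x *v v) > 0"
    using metric assms(1) unfolding riemannian_metric_def by blast
  then show False using metric_transform[OF assms(1-3), of v v] assms(4) by simp
qed

lemma killing_field_on_local:
  assumes "c \<in> A" "open W" "killing_field_on A g W X"
  shows "local_metric.killing (coords c W) (g c) (X c)"
proof -
  interpret local_metric "coords c W" "g c" by (rule local_metric[OF assms(1,2)])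
  show ?thesis
    unfolding killing_def
  proof (intro conjI ballI allI)
    show "smooth_on (coords c W) (X c)"
      using assms by (auto simp: killing_field_on_def vector_field_on_def)
    fix x i j assume "x \<in> coords c W"
    then have "lie_derivative_metric X g c x $ i $ j = 0"
      using assms by (auto simp: killing_field_on_def)
    then show "(\<Sum>k\<in>UNIV. X c x $ k * partial k (\<lambda>y. g c y $ i $ j) x + g c x $ k $ j * partial i
        (\<lambda>y. X c y $ k) x +
            g c x $ i $ k * partial j (\<lambda>y. X c y $ k) x) = 0"
      by (simp add: lie_derivative_metric_def)
  qed
qed

lemma vector_field_transform:
  assumes "vector_field_on A W X" "c \<in> A" "d \<in> A" "x \<in> coords c (fst d \<inter> W)"
  shows "X d (transition c d x) = jacobian c d x *v X c x"
  using assms by (auto simp: vector_field_on_def)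

lemma vf_zero_in_chart:
  assumes "vector_field_on A W X" "c \<in> A" "N \<subseteq> fst c" "N \<subseteq> W" "\<And>x. x \<in> coords c N \<Longrightarrow> X c x = 0"
  shows "vf_eq_on A N X vf_zero"
  unfolding vf_eq_on_def
proof (intro ballI)
  fix d y assume d: "d \<in> A" "y \<in> coords d N"
  then obtain q where q: "q \<in> fst d" "q \<in> N" "y = snd d q" by (auto simp: coords_def)
  have x: "snd c q \<in> coords c (fst d \<inter> W)" using q assms by (auto intro: coordsI)
  have "transition c d (snd c q) = y"
    using q assms(2,3) chart_inv_snd[of c q] by (auto simp: transition_def)
  moreover have "X c (snd c q) = 0" using q(2) assms(3) by (intro assms(5) coordsI) auto
  ultimately show "X d y = 0"
    using vector_field_transform[OF assms(1,2) d(1) x] by simp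
qed

text \<open>At a zero of \<open>X\<close> the Christoffel terms drop out of \<open>cov\<close>, so
  this is the vanishing of the 1-jet.\<close>

definition jet_zero :: "('m, 3) chart \<Rightarrow> ('m, 3) vfield \<Rightarrow> real^3 \<Rightarrow> bool" where
  "jet_zero c X x \<longleftrightarrow> X c x = 0 \<and> (\<forall>i j. local_metric.cov (g c) (X c) i j x = 0)"

text \<open>The neighbourhood is chosen before the point \<open>p\<close>: a zero of the jet
  anywhere in \<open>N\<close> spreads over all of \<open>N\<close>. This uniformity gives the
  openness of the complement in \<open>killing_zero\<close>.\<close>

lemma killing_zero_near:
  assumes "killing_field_on A g W X" "open W" "q \<in> W" "c \<in> A" "q \<in> fst c"
  obtains N where "open N" "q \<in> N" "N \<subseteq> W" "N \<subseteq> fst c"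
    "\<And>p. p \<in> N \<Longrightarrow> jet_zero c X (snd c p) \<Longrightarrow> vf_eq_on A N X vf_zero"
proof -
  obtain r where r: "r > 0" "cball (snd c q) r \<subseteq> coords c W" "q \<in> chart_ball c (snd c q) r"
    using chart_ball_exists[OF assms(4,2,3,5)] by blast
  then have ball: "ball (snd c q) r \<subseteq> coords c W" using ball_subset_cball by blast
  note N = chart_ball[OF assms(4) ball]
  interpret local_metric "coords c W" "g c" by (rule local_metric[OF assms(4,2)])
  show ?thesis
  proof (rule that[OF N(1) r(3) N(3,4)])
    fix p assume p: "p \<in> chart_ball c (snd c q) r" "jet_zero c X (snd c p)"
    show "vf_eq_on A (chart_ball c (snd c q) r) X vf_zero"
    proof (rule vf_zero_in_chart[OF _ assms(4) N(4,3)])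
      show "vector_field_on A W X" using assms(1) by (simp add: killing_field_on_def)
      fix x assume "x \<in> coords c (chart_ball c (snd c q) r)"
      then show "X c x = 0"
        using killing_zero_ball[OF killing_field_on_local[OF assms(4,2,1)] r(2), of "snd c p"] p N(5)
        by (simp add: jet_zero_def chart_ball_def)
    qed
  qed
qed

lemma jet_zero_of_zero:
  assumes "open N" "vf_eq_on A N X vf_zero" "c \<in> A" "x \<in> coords c N"
  shows "jet_zero c X x"
proof -
  interpret local_metric "coords c N" "g c" by (rule local_metric[OF assms(3,1)])
  have "X c y = 0" if "y \<in> coords c N" for y
    using assms(2,3) that by (auto simp: vf_eq_on_def)
  then have "partial j (\<lambda>y. X c y $ i) x = 0" and "X c x = 0" for i j
    using partial_cong[OF open_U assms(4), of "\<lambda>y. X c y $ i" "\<lambda>y. 0" j] assms(4) by auto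
  then show ?thesis by (simp add: jet_zero_def cov_def)
qed

text \<open>The points near which \<open>X\<close> vanishes form an open set \<open>Z\<close>. A
  point of \<open>W\<close> whose uniform neighbourhood meets \<open>Z\<close> belongs to
  \<open>Z\<close>, so the rest of \<open>W\<close> is open too, and connectedness of
  \<open>W\<close> concludes.\<close>

lemma killing_zero:
  assumes "killing_field_on A g W X" "open W" "connected W" "c \<in> A" "x \<in> coords c W" "jet_zero c X x"
  shows "vf_eq_on A W X vf_zero"
proof -
  define Z where "Z = \<Union>{N. open N \<and> N \<subseteq> W \<and> vf_eq_on A N X vf_zero}"
  have "open Z" unfolding Z_def by auto
  have "\<exists>N. open N \<and> q \<in> N \<and> N \<subseteq> W \<and> N \<inter> Z = {}" if q: "q \<in> W" "q \<notin> Z" for q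
  proof -
    obtain d where d: "d \<in> A" "q \<in> fst d" using chart_cover by blast
    obtain N where N: "open N" "q \<in> N" "N \<subseteq> W" "N \<subseteq> fst d"
      "\<And>p. p \<in> N \<Longrightarrow> jet_zero d X (snd d p) \<Longrightarrow> vf_eq_on A N X vf_zero"
      using killing_zero_near[OF assms(1,2) q(1) d] by blast
    have "N \<inter> Z = {}"
    proof (rule ccontr)
      assume "N \<inter> Z \<noteq> {}"
      then obtain p N' where p: "p \<in> N" "p \<in> N'" "open N'" "vf_eq_on A N' X vf_zero" by (auto simp:
          Z_def)
      have "snd d p \<in> coords d N'" using p(1,2) N(4) by (intro coordsI) auto
      from jet_zero_of_zero[OF p(3,4) d(1) this] have "q \<in> Z" using N p(1) by (auto simp: Z_def)
      with q show False by simp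
    qed
    then show ?thesis using N by blast
  qed
  then have "\<exists>N. open N \<and> q \<in> N \<and> N \<subseteq> W - Z" if "q \<in> W - Z" for q
    using that by fast
  then have "open (W - Z)"
    using open_subopen[of "W - Z"] by simp
  moreover have "Z \<inter> W \<noteq> {}"
  proof -
    obtain p where p: "p \<in> fst c" "p \<in> W" "x = snd c p" using assms(5) by (auto simp: coords_def)
    obtain N where "open N" "p \<in> N" "N \<subseteq> W" "vf_eq_on A N X vf_zero"
    proof (rule killing_zero_near[OF assms(1,2) p(2) assms(4) p(1)])
      fix N assume "open N" "p \<in> N" "N \<subseteq> W" "\<And>p. p \<in> N \<Longrightarrow> jet_zero c X (snd c p) \<Longrightarrow> vf_eq_on A N X
          vf_zero"
      with assms(6) p(3) that show thesis by simp
    qed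
    then show ?thesis using p by (auto simp: Z_def)
  qed
  ultimately have "W - Z = {}"
    using connectedD[OF assms(3) \<open>open Z\<close>, of "W - Z"] by auto
  then have "W \<subseteq> Z" by blast
  show ?thesis
    unfolding vf_eq_on_def
  proof (intro ballI)
    fix d y assume d: "d \<in> A" "y \<in> coords d W"
    then obtain q where q: "q \<in> fst d" "q \<in> W" "y = snd d q" by (auto simp: coords_def)
    with \<open>W \<subseteq> Z\<close> obtain N where N: "q \<in> N" "vf_eq_on A N X vf_zero" by (auto simp: Z_def)
    then show "X d y = 0" using q d(1) by (auto simp: vf_eq_on_def intro: coordsI)
  qed
qed

section \<open>Linear combinations and restrictions of Killing fields\<close>

lemma vector_field_on_comb:
  assumes "open W" "\<And>i. vector_field_on A W (\<xi> i)"
  shows "vector_field_on A W (vf_comb a \<xi>)"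
  unfolding vector_field_on_def vf_comb_def
proof (intro conjI ballI)
  fix c assume c: "c \<in> A"
  show "smooth_on (coords c W) (\<lambda>x. \<Sum>k\<in>UNIV. a k *\<^sub>R \<xi> k c x)"
    using assms open_coords[OF c assms(1)] c
    by (intro smooth_on_sum smooth_on_scaleR smooth_on_const) (auto simp: vector_field_on_def)
  fix d x assume "d \<in> A" "x \<in> coords c (fst d \<inter> W)"
  then show "(\<Sum>k\<in>UNIV. a k *\<^sub>R \<xi> k d (transition c d x)) = jacobian c d x *v (\<Sum>k\<in>UNIV. a k *\<^sub>R \<xi> k c x)"
    using vector_field_transform[OF assms(2) c] by (simp add: linear_sum[OF
        matrix_vector_mul_linear] linear_scale[OF matrix_vector_mul_linear])
qed

lemma killing_field_on_comb:
  fixes \<xi> :: "'k::finite \<Rightarrow> ('m, 3) vfield"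
  assumes "open W" "\<And>i. killing_field_on A g W (\<xi> i)"
  shows "killing_field_on A g W (vf_comb a \<xi>)"
  unfolding killing_field_on_def
proof (intro conjI ballI)
  show "vector_field_on A W (vf_comb a \<xi>)"
    by (rule vector_field_on_comb) (use assms in \<open>auto simp: killing_field_on_def\<close>)
  fix c x assume c: "c \<in> A" "x \<in> coords c W"
  have d: "(\<lambda>y. \<xi> k c y $ i) differentiable (at x)" for k i
    using assms(2)[of k] c open_coords[OF c(1) assms(1)]
    by (auto simp: killing_field_on_def vector_field_on_def intro!: smooth_on_differentiable[OF
        smooth_on_nth c(2)])
  have "lie_derivative_metric (vf_comb a \<xi>) g c x $ i $ j = (\<Sum>k\<in>UNIV. a k * lie_derivative_metric (\<xi>
      k) g c x $ i $ j)" for i j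
    unfolding lie_derivative_metric_def vf_comb_def
    by (simp add: partial_sum partial_mult d sum_3 sum_distrib_left sum.distrib algebra_simps)
  moreover have "lie_derivative_metric (\<xi> k) g c x = 0" for k
    using assms(2)[of k] c by (auto simp: killing_field_on_def)
  ultimately show "lie_derivative_metric (vf_comb a \<xi>) g c x = 0" by (simp add: vec_eq_iff)
qed

lemma killing_field_on_subset: "killing_field_on A g W X \<Longrightarrow> W' \<subseteq> W \<Longrightarrow> killing_field_on A g W' X"
  unfolding killing_field_on_def vector_field_on_def
  by (meson Int_mono coords_mono order_refl smooth_on_subset subsetD)

end

lemma local_bracket_comb:
  fixes X :: "'k::finite \<Rightarrow> real^'n::finite \<Rightarrow> real^'n" and Y :: "'l::finite \<Rightarrow> real^'n \<Rightarrow> real^'n"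
  assumes "\<And>k i. (\<lambda>y. X k y $ i) differentiable (at x)" "\<And>k i. (\<lambda>y. Y k y $ i) differentiable (at x)"
  shows "local_bracket (\<lambda>x. \<Sum>k\<in>UNIV. a k *\<^sub>R X k x) (\<lambda>x. \<Sum>l\<in>UNIV. b l *\<^sub>R Y l x) x =
    (\<Sum>k\<in>UNIV. \<Sum>l\<in>UNIV. (a k * b l) *\<^sub>R local_bracket (X k) (Y l) x)"
proof -
  have "local_bracket (\<lambda>x. \<Sum>k\<in>UNIV. a k *\<^sub>R X k x) (\<lambda>x. \<Sum>l\<in>UNIV. b l *\<^sub>R Y l x) x $ i =
    (\<Sum>k\<in>UNIV. \<Sum>l\<in>UNIV. (a k * b l) *\<^sub>R local_bracket (X k) (Y l) x) $ i" for i
  proof -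
    have "local_bracket (\<lambda>x. \<Sum>k\<in>UNIV. a k *\<^sub>R X k x) (\<lambda>x. \<Sum>l\<in>UNIV. b l *\<^sub>R Y l x) x $ i =
      (\<Sum>j\<in>UNIV. (\<Sum>k\<in>UNIV. a k * X k x $ j) * (\<Sum>l\<in>UNIV. b l * partial j (\<lambda>y. Y l y $ i) x)
        - (\<Sum>l\<in>UNIV. b l * Y l x $ j) * (\<Sum>k\<in>UNIV. a k * partial j (\<lambda>y. X k y $ i) x))"
      using assms by (simp add: local_bracket_def partial_sum partial_mult)
    also have "\<dots> = (\<Sum>j\<in>UNIV. \<Sum>k\<in>UNIV. \<Sum>l\<in>UNIV. a k * b l * (X k x $ j * partial j (\<lambda>y. Y l y $ i) x
        - Y l x $ j * partial j (\<lambda>y. X k y $ i) x))"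
    proof (rule sum.cong[OF refl])
      fix j
      have "(\<Sum>l\<in>UNIV. b l * Y l x $ j) * (\<Sum>k\<in>UNIV. a k * partial j (\<lambda>y. X k y $ i) x) =
        (\<Sum>k\<in>UNIV. a k * partial j (\<lambda>y. X k y $ i) x) * (\<Sum>l\<in>UNIV. b l * Y l x $ j)" by simp
      then show "(\<Sum>k\<in>UNIV. a k * X k x $ j) * (\<Sum>l\<in>UNIV. b l * partial j (\<lambda>y. Y l y $ i) x)
        - (\<Sum>l\<in>UNIV. b l * Y l x $ j) * (\<Sum>k\<in>UNIV. a k * partial j (\<lambda>y. X k y $ i) x) = 
        (\<Sum>k\<in>UNIV. \<Sum>l\<in>UNIV. a k * b l * (X k x $ j * partial j (\<lambda>y. Y l y $ i) x - Y l x $ j *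
            partial j (\<lambda>y. X k y $ i) x))"
        by (simp only: sum_product sum_subtractf[symmetric]) (simp add: algebra_simps)
    qed
    also have "\<dots> = (\<Sum>k\<in>UNIV. \<Sum>l\<in>UNIV. \<Sum>j\<in>UNIV. a k * b l * (X k x $ j * partial j (\<lambda>y. Y l y $ i) x
        - Y l x $ j * partial j (\<lambda>y. X k y $ i) x))"
      by (subst sum.swap, rule sum.cong[OF refl], subst sum.swap, rule refl)
    finally show ?thesis by (simp add: local_bracket_def sum_distrib_left)
  qed
  then show ?thesis by (simp add: vec_eq_iff)
qed

lemma local_bracket_cong:
  assumes "open S" "x \<in> S" "\<And>y. y \<in> S \<Longrightarrow> X y = X' y" "\<And>y. y \<in> S \<Longrightarrow> Y y = Y' y"
  shows "local_bracket X Y x = local_bracket X' Y' x"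
proof -
  have "partial j (\<lambda>y. X y $ i) x = partial j (\<lambda>y. X' y $ i) x" "partial j (\<lambda>y. Y y $ i) x = partial
      j (\<lambda>y. Y' y $ i) x" for i j
    using assms by (auto intro!: partial_cong[OF assms(1,2)])
  then show ?thesis using assms by (simp add: local_bracket_def)
qed

section \<open>The Lie algebra structure of a six-dimensional algebra of Killing fields\<close>

text \<open>The usual identification of R^3 with so(3), taking the cross product to the commutator.
  The inverse \<open>vee\<close> is defined on all matrices so as to be linear.\<close>

definition hat :: "real^3 \<Rightarrow> real^3^3" where
  "hat a = vector [vector [0, - a$3, a$2], vector [a$3, 0, - a$1], vector [- a$2, a$1, 0]]"

definition vee :: "real^3^3 \<Rightarrow> real^3" where
  "vee B = vector [B$3$2, B$1$3, B$2$1]"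

lemmas mat3_simps = vec_eq_iff forall_3 sum_3 matrix_matrix_mult_def matrix_vector_mult_def
    transpose_def

lemma
  fixes A B :: "real^'n::finite^'m::finite" and C :: "real^'k::finite^'n"
  shows matrix_add_rdistrib: "(A + B) ** C = A ** C + B ** C"
    and matrix_diff_rdistrib: "(A - B) ** C = A ** C - B ** C"
    and matrix_minus_left: "(- A) ** C = - (A ** C)"
  by (simp_all add: matrix_matrix_mult_def vec_eq_iff sum.distrib sum_subtractf sum_negf
      distrib_right left_diff_distrib)

lemma
  fixes A B :: "real^'n::finite^'m::finite" and C :: "real^'m^'k::finite"
  shows matrix_diff_ldistrib: "C ** (A - B) = C ** A - C ** B"
    and matrix_minus_right: "C ** (- A) = - (C ** A)"
  by (simp_all add: matrix_matrix_mult_def vec_eq_iff sum_subtractf sum_negf right_diff_distrib)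

lemma hat_mult: "hat a *v s = cross3 a s"
  by (simp add: hat_def cross3_def mat3_simps)

lemma hat_vee:
  assumes "transpose B = - B" shows "hat (vee B) = B"
proof -
  have "B $ j $ i = - B $ i $ j" for i j
    using arg_cong[OF assms, of "\<lambda>M. M $ i $ j"] by (simp add: transpose_def)
  from this[of 1 1] this[of 2 2] this[of 3 3] this[of 1 2] this[of 1 3] this[of 2 3] show ?thesis
    by (simp add: hat_def vee_def vec_eq_iff forall_3)
qed

lemma hat_commutator: "hat a ** hat b - hat b ** hat a = hat (cross3 a b)"
  by (simp add: hat_def cross3_def mat3_simps algebra_simps)

lemma hat_minus: "hat (- a) = - hat a"
  by (simp add: hat_def mat3_simps)

lemma vee_hat: "vee (hat a) = a"
  by (simp add: hat_def vee_def mat3_simps)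

lemma linear_vee: "linear vee"
  by (rule linearI) (simp_all add: vee_def mat3_simps)

text \<open>The Gram-Schmidt process for the form \<open>B\<close>, started from the standard basis;
  this makes \<open>E\<close> upper triangular. The shape matters for type V, where a change of
  frame has to preserve the abelian ideal.\<close>

lemma gram_schmidt3:
  fixes B :: "real^3^3"
  assumes sym: "transpose B = B" and pos: "\<And>v. v \<noteq> 0 \<Longrightarrow> v \<bullet> (B *v v) > 0"
  obtains E :: "real^3^3" where "transpose E ** B ** E = mat 1" "E $ 2 $ 1 = 0" "E $ 3 $ 1 = 0" "E $
      3 $ 2 = 0"
    "E $ 1 $ 1 > 0" "E $ 2 $ 2 > 0" "E $ 3 $ 3 > 0"
proof -
  define b where "b v w = v \<bullet> (B *v w)" for v w
  have bsym: "b v w = b w v" for v w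
    unfolding b_def by (metis dot_lmul_matrix inner_commute sym transpose_matrix_vector)
  have badd: "b (v + v') w = b v w + b v' w" "b (v - v') w = b v w - b v' w" "b (a *\<^sub>R v) w = a * b v w"
    for v v' w a by (simp_all add: b_def inner_simps)
  then have badd': "b w (v + v') = b w v + b w v'" "b w (v - v') = b w v - b w v'" "b w (a *\<^sub>R v) =
      a * b w v"
    for v v' w a using bsym by metis+
  define p1 where "p1 = (axis 1 1 :: real^3)"
  define p2 where "p2 = axis 2 1 - (b (axis 2 1) p1 / b p1 p1) *\<^sub>R p1"
  define p3 where "p3 = axis 3 1 - (b (axis 3 1) p1 / b p1 p1) *\<^sub>R p1 - (b (axis 3 1) p2 / b p2 p2)
      *\<^sub>R p2"
  have tri: "p1 $ 1 = 1" "p1 $ 2 = 0" "p1 $ 3 = 0" "p2 $ 2 = 1" "p2 $ 3 = 0" "p3 $ 3 = 1"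
    by (simp_all add: p3_def p2_def p1_def axis_def)
  then have "p1 \<noteq> 0" "p2 \<noteq> 0" "p3 \<noteq> 0" by (metis zero_index zero_neq_one)+
  then have pos': "b p1 p1 > 0" "b p2 p2 > 0" "b p3 p3 > 0" using pos by (auto simp: b_def)
  have o12: "b p2 p1 = 0" using pos' by (simp add: p2_def badd)
  have o13: "b p3 p1 = 0" using pos' o12 by (simp add: p3_def badd)
  have o23: "b p3 p2 = 0" using pos' o12 bsym[of p1 p2] by (simp add: p3_def badd)
  define p where "p = (\<lambda>j::3. if j = 1 then p1 else if j = 2 then p2 else p3)"
  have p: "p 1 = p1" "p 2 = p2" "p 3 = p3" by (simp_all add: p_def)
  define n where "n j = 1 / sqrt (b (p j) (p j))" for j
  define E :: "real^3^3" where "E = (\<chi> i j. n j * p j $ i)"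
  have npos: "n j > 0" for j using pos' p by (auto simp: n_def p_def)
  have nsq: "n j * n j * b (p j) (p j) = 1" for j
  proof -
    have "b (p j) (p j) > 0" using pos' by (simp add: p_def)
    then show ?thesis by (simp add: n_def real_div_sqrt)
  qed
  have ortho: "b (p i) (p j) = 0" if "i \<noteq> j" for i j
    using that o12 o13 o23 bsym[of p1 p2] bsym[of p1 p3] bsym[of p2 p3] by (auto simp: p_def) (metis
        exhaust_3)+
  have col: "E *v axis j 1 = n j *\<^sub>R p j" for j
    by (simp add: matrix_vector_mult_basis column_def E_def vec_eq_iff)
  have "(transpose E ** B ** E) $ i $ j = b (E *v axis i 1) (E *v axis j 1)" for i j
  proof -
    have "b (E *v axis i 1) (E *v axis j 1) = axis i 1 \<bullet> ((transpose E ** B ** E) *v axis j 1)"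
      unfolding b_def by (metis dot_lmul_matrix matrix_vector_mul_assoc vector_transpose_matrix)
    then show ?thesis by (simp add: matrix_vector_mult_basis column_def inner_axis')
  qed
  then have "transpose E ** B ** E = mat 1"
    using ortho nsq by (simp add: col badd badd' vec_eq_iff mat_def mult.assoc)
  moreover have "E $ i $ j = n j * p j $ i" for i j by (simp add: E_def)
  ultimately show ?thesis using npos tri p by (intro that[of E]) simp_all
qed

text \<open>The rotation about the third axis leaves \<open>Q\<close> of the first two basis vectors
  fixed, so this value is a multiple of the third; the rotations about the other axes carry it to
  the remaining pairs.\<close>

lemma isotropic_skew_bilinear:
  fixes Q :: "real^3 \<Rightarrow> real^3 \<Rightarrow> real^3"
  assumes bil: "bilinear Q" and skew: "\<And>s t. Q s t = - Q t s"
    and inv: "\<And>a y z. Q (cross3 a y) z + Q y (cross3 a z) = cross3 a (Q y z)"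
  shows "\<exists>K. \<forall>s t. Q s t = K *\<^sub>R cross3 s t"
proof -
  let ?e1 = "axis 1 1 :: real^3" and ?e2 = "axis 2 1 :: real^3" and ?e3 = "axis 3 1 :: real^3"
  have cb: "cross3 ?e1 ?e2 = ?e3" "cross3 ?e2 ?e1 = - ?e3" "cross3 ?e2 ?e3 = ?e1" "cross3 ?e3 ?e2 =
      - ?e1"
    "cross3 ?e3 ?e1 = ?e2" "cross3 ?e1 ?e3 = - ?e2"
    by (simp_all add: cross3_def axis_def vec_eq_iff forall_3)
  have Q0: "Q s s = 0" for s using skew[of s s] by (simp add: vec_eq_iff)
  have Qm: "Q s (- t) = - Q s t" "Q (- s) t = - Q s t" for s t
    using bilinear_rneg[OF bil] bilinear_lneg[OF bil] by auto
  have 1: "cross3 ?e3 (Q ?e1 ?e2) = 0" using inv[of ?e3 ?e1 ?e2] by (simp add: cb Q0 Qm)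
  have 2: "cross3 ?e1 (Q ?e1 ?e2) = Q ?e1 ?e3" using inv[of ?e1 ?e1 ?e2] by (simp add: cb Q0 Qm
      bilinear_lzero[OF bil])
  have 3: "cross3 ?e2 (Q ?e1 ?e2) = - Q ?e3 ?e2" using inv[of ?e2 ?e1 ?e2] by (simp add: cb Q0 Qm
      bilinear_rzero[OF bil])
  define K where "K = Q ?e1 ?e2 $ 3"
  have q12: "Q ?e1 ?e2 = K *\<^sub>R ?e3"
    using 1 by (simp add: cross3_def axis_def vec_eq_iff forall_3 K_def)
  have q13: "Q ?e1 ?e3 = - K *\<^sub>R ?e2" using 2 by (simp add: q12 cross_mult_right cb)
  have q23: "Q ?e2 ?e3 = K *\<^sub>R ?e1" using 3 skew[of ?e2 ?e3] by (simp add: q12 cross_mult_right cb)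
  have exp: "s = s$1 *\<^sub>R ?e1 + s$2 *\<^sub>R ?e2 + s$3 *\<^sub>R ?e3" for s :: "real^3"
    by (simp add: axis_def vec_eq_iff forall_3)
  have "Q s t = K *\<^sub>R cross3 s t" for s t
  proof -
    have Qst: "Q s t = (s$1 * t$2 - s$2 * t$1) *\<^sub>R Q ?e1 ?e2 + (s$1 * t$3 - s$3 * t$1) *\<^sub>R Q ?e1 ?e3
        + (s$2 * t$3 - s$3 * t$2) *\<^sub>R Q ?e2 ?e3"
      by (subst exp[of s], subst exp[of t], simp only: bilinear_ladd[OF bil] bilinear_radd[OF bil]
          bilinear_lmul[OF bil] bilinear_rmul[OF bil] Q0 skew[of ?e2 ?e1] skew[of ?e3 ?e1] skew[of
              ?e3 ?e2])
        (simp add: algebra_simps)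
    show ?thesis unfolding Qst q12 q13 q23 by (simp add: cross3_def axis_def vec_eq_iff forall_3
        algebra_simps)
  qed
  then show ?thesis by blast
qed

text \<open>\<open>space_form_bracket K\<close> is the bracket of the Killing fields of the space of constant
  curvature \<open>K\<close>: the pair \<open>(s, a)\<close> stands for the field with value \<open>s\<close> and rotation part \<open>a\<close>
  at the base point.\<close>

definition space_form_bracket :: "real \<Rightarrow> (real^3) \<times> (real^3) \<Rightarrow> (real^3) \<times> (real^3) \<Rightarrow> (real^3) \<times>
    (real^3)" where
  "space_form_bracket K p q = (cross3 (snd p) (fst q) - cross3 (snd q) (fst p),
     cross3 (snd p) (snd q) + K *\<^sub>R cross3 (fst p) (fst q))"

text \<open>Everything is evaluated at the fixed point \<open>x\<close>. The columns of
  \<open>E\<close> are orthonormal there and identify the tangent space with R^3, so that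
  infinitesimal rotations become skew matrices.\<close>

locale killing_algebra6 = riemannian_3manifold A g
  for A :: "('m::{t2_space, second_countable_topology}, 3) chart set" and g +
  fixes W :: "'m set" and \<xi> :: "6 \<Rightarrow> ('m, 3) vfield" and c :: "('m, 3) chart" and x :: "real^3"
    and E :: "real^3^3"
  assumes basis: "killing_algebra_basis A g W \<xi>" and c: "c \<in> A" and x: "x \<in> coords c W"
    and E: "transpose E ** g c x ** E = mat 1"
begin

lemma W: "open W" "connected W" "\<And>i. killing_field_on A g W (\<xi> i)"
  using basis by (auto simp: killing_algebra_basis_def)

sublocale local_metric "coords c W" "g c"
  by (rule local_metric[OF c W(1)])

definition V :: "real^6 \<Rightarrow> ('m, 3) vfield" where
  "V z = vf_comb (\<lambda>k. z $ k) \<xi>"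

lemma V_apply: "V z d y = (\<Sum>k\<in>UNIV. z $ k *\<^sub>R \<xi> k d y)"
  by (simp add: V_def vf_comb_def)

lemma V_killing: "killing_field_on A g W (V z)"
  unfolding V_def by (rule killing_field_on_comb[OF W(1,3)])

lemma V_local: "killing (V z c)"
  by (rule killing_field_on_local[OF c W(1) V_killing])

lemma \<xi>_differentiable: "d \<in> A \<Longrightarrow> y \<in> coords d W \<Longrightarrow> (\<lambda>y. \<xi> k d y $ i) differentiable (at y)"
  using W(3)[of k]
  by (intro smooth_on_differentiable[OF smooth_on_nth[OF open_coords[OF _ W(1)]]])
    (auto simp: killing_field_on_def vector_field_on_def)

lemma V_zero: "vf_eq_on A W (V z) vf_zero \<Longrightarrow> z = 0"
  using basis by (auto simp: killing_algebra_basis_def V_def vec_eq_iff)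

lemma V_bracket: "\<exists>u. vf_eq_on A W (lie_bracket (V z) (V w)) (V u)"
proof -
  obtain a where a: "\<And>k l. vf_eq_on A W (lie_bracket (\<xi> k) (\<xi> l)) (vf_comb (a k l) \<xi>)"
    using basis unfolding killing_algebra_basis_def by metis
  define u :: "real^6" where "u = (\<chi> m. \<Sum>k\<in>UNIV. \<Sum>l\<in>UNIV. z$k * w$l * a k l m)"
  have "lie_bracket (V z) (V w) d y = V u d y" if d: "d \<in> A" "y \<in> coords d W" for d y
  proof -
    have "lie_bracket (V z) (V w) d y = local_bracket (\<lambda>x. \<Sum>k\<in>UNIV. z$k *\<^sub>R \<xi> k d x) (\<lambda>x. \<Sum>l\<in>UNIV.
        w$l *\<^sub>R \<xi> l d x) y"
      by (simp add: lie_bracket_local V_apply[abs_def])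
    also have "\<dots> = (\<Sum>k\<in>UNIV. \<Sum>l\<in>UNIV. (z$k * w$l) *\<^sub>R local_bracket (\<xi> k d) (\<xi> l d) y)"
      by (rule local_bracket_comb) (use \<xi>_differentiable d in auto)
    also have "\<dots> = (\<Sum>k\<in>UNIV. \<Sum>l\<in>UNIV. (z$k * w$l) *\<^sub>R (\<Sum>m\<in>UNIV. a k l m *\<^sub>R \<xi> m d y))"
      using a d by (simp add: vf_eq_on_def lie_bracket_local vf_comb_def)
    also have "\<dots> = (\<Sum>k\<in>UNIV. \<Sum>m\<in>UNIV. \<Sum>l\<in>UNIV. (z$k * w$l * a k l m) *\<^sub>R \<xi> m d y)"
      by (simp add: scaleR_sum_right) (rule sum.cong[OF refl], rule sum.swap)
    also have "\<dots> = V u d y"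
      by (subst sum.swap) (simp add: V_apply u_def scaleR_sum_left)
    finally show ?thesis .
  qed
  then show ?thesis unfolding vf_eq_on_def by blast
qed

text \<open>The inverse of \<open>E\<close>, by orthonormality. Conjugation with it rewrites
  endomorphisms of the tangent space in the orthonormal frame.\<close>

definition H :: "real^3^3" where "H = transpose E ** g c x"

lemma HE: "H ** E = mat 1" and EH: "E ** H = mat 1"
proof -
  show "H ** E = mat 1" using E by (simp add: H_def)
  then show "E ** H = mat 1" by (simp add: matrix_left_right_inverse)
qed

lemma EHv: "E *v (H *v v) = v"
  by (simp add: matrix_vector_mul_assoc EH)

lemma conj_mult: "H ** (P ** P') ** E = (H ** P ** E) ** (H ** P' ** E)"
proof -
  have "(H ** P ** E) ** (H ** P' ** E) = H ** P ** (E ** H) ** P' ** E"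
    by (simp only: matrix_mul_assoc)
  then show ?thesis by (simp only: EH matrix_mul_rid matrix_mul_assoc)
qed

lemma conj_inverse: "E ** (H ** P ** E) ** H = P"
proof -
  have "E ** (H ** P ** E) ** H = (E ** H) ** P ** (E ** H)"
    by (simp only: matrix_mul_assoc)
  then show ?thesis by (simp only: EH matrix_mul_rid matrix_mul_lid)
qed

definition covm :: "real^6 \<Rightarrow> real^3^3" where
  "covm z = (\<chi> i j. cov (V z c) i j x)"

text \<open>Value and rotation part at \<open>x\<close>. The sign is chosen because the covariant
  derivative of a bracket of X and Y contains cov Y cov X - cov X cov Y, which is minus the
  commutator of cov X with cov Y.\<close>

definition T :: "real^6 \<Rightarrow> (real^3) \<times> (real^3)" where
  "T z = (H *v V z c x, - vee (H ** covm z ** E))"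

definition curv :: "real^3 \<Rightarrow> real^3 \<Rightarrow> real^3^3" where
  "curv y w = (\<chi> i k. \<Sum>j\<in>UNIV. \<Sum>l\<in>UNIV. riemann (g c) i k j l x * y $ j * w $ l)"

text \<open>The curvature endomorphism R(s, t) in the orthonormal frame, read as a vector with the
  sign convention of \<open>T\<close>.\<close>

definition Q :: "real^3 \<Rightarrow> real^3 \<Rightarrow> real^3" where
  "Q s t = - vee (H ** curv (E *v s) (E *v t) ** E)"

text \<open>The matrix is congruent, through \<open>E\<close>, to the metric times the covariant
  derivative, which is skew by \<open>cov_skew\<close>.\<close>

lemma covm_skew: "transpose (H ** covm z ** E) = - (H ** covm z ** E)"
proof -
  define M where "M = g c x ** covm z"
  have "transpose M $ i $ j = (- M) $ i $ j" for i j
    using cov_skew[OF V_local x, where i = i and j = j]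
    by (simp add: M_def matrix_matrix_mult_def covm_def sum.distrib transpose_def add_eq_0_iff)
  then have M: "transpose M = - M" unfolding vec_eq_iff by blast
  have "transpose (transpose E ** M ** E) = - (transpose E ** M ** E)"
    by (simp only: matrix_transpose_mul transpose_transpose M matrix_minus_left matrix_minus_right
        matrix_mul_assoc)
  then show ?thesis by (simp add: H_def M_def matrix_mul_assoc)
qed

lemma conj_covm: "H ** covm z ** E = - hat (snd (T z))"
  using hat_vee[OF covm_skew] by (simp add: T_def hat_minus)

lemma V_T: "V z c x = E *v fst (T z)"
  by (simp add: T_def EHv)

text \<open>The value of the bracket comes from \<open>local_bracket_cov\<close>, its covariant
  derivative from \<open>cov_local_bracket\<close>; both are rewritten in the orthonormal
  frame.\<close>

lemma T_bracket:
  assumes "vf_eq_on A W (lie_bracket (V z) (V w)) (V u)"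
  shows "T u = (cross3 (snd (T z)) (fst (T w)) - cross3 (snd (T w)) (fst (T z)),
     cross3 (snd (T z)) (snd (T w)) + Q (fst (T z)) (fst (T w)))"
    and "covm u = covm w ** covm z - covm z ** covm w + curv (V z c x) (V w c x)"
proof -
  have eq: "V u c y = local_bracket (V z c) (V w c) y" if "y \<in> coords c W" for y
    using assms c that by (auto simp: vf_eq_on_def lie_bracket_local)
  have Vu: "V u c x = covm w *v V z c x - covm z *v V w c x"
    using local_bracket_cov[OF x] eq[OF x] by (simp add: vec_eq_iff matrix_vector_mult_def covm_def
        sum_subtractf mult.commute)
  have "cov (V u c) i k x = cov (local_bracket (V z c) (V w c)) i k x" for i k
    unfolding cov_def using eq x partial_cong[OF open_U x, of "\<lambda>y. V u c y $ i" "\<lambda>y. local_bracket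
        (V z c) (V w c) y $ i"] by simp
  then show cu: "covm u = covm w ** covm z - covm z ** covm w + curv (V z c x) (V w c x)"
    using cov_local_bracket[OF V_local V_local x]
    by (simp add: vec_eq_iff matrix_matrix_mult_def covm_def curv_def sum_subtractf)
  have cE: "H *v (covm z *v (E *v s)) = - cross3 (snd (T z)) s" for z s
  proof -
    have "H *v (covm z *v (E *v s)) = (H ** covm z ** E) *v s" by (simp add: matrix_vector_mul_assoc
        matrix_mul_assoc)
    then show ?thesis by (simp add: conj_covm hat_mult[symmetric] matrix_vector_mult_def vec_eq_iff
        sum_negf)
  qed
  have 1: "fst (T u) = cross3 (snd (T z)) (fst (T w)) - cross3 (snd (T w)) (fst (T z))"
    unfolding T_def[of u] by (simp add: Vu V_T[of z] V_T[of w] matrix_vector_mult_diff_distrib cE)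
  have "H ** covm u ** E = (H ** covm w ** E) ** (H ** covm z ** E) - (H ** covm z ** E) ** (H **
      covm w ** E)
      + H ** curv (V z c x) (V w c x) ** E"
    unfolding cu conj_mult[symmetric]
    by (simp add: matrix_add_ldistrib matrix_add_rdistrib matrix_diff_ldistrib matrix_diff_rdistrib)
  also have "\<dots> = - hat (cross3 (snd (T z)) (snd (T w))) + H ** curv (V z c x) (V w c x) ** E"
    unfolding conj_covm hat_commutator[symmetric] by (simp add: matrix_minus_left matrix_minus_right)
  finally have "vee (H ** covm u ** E) = - cross3 (snd (T z)) (snd (T w)) - Q (fst (T z)) (fst (T w))"
    unfolding Q_def V_T[symmetric] by (simp add: linear_add[OF linear_vee] linear_neg[OF linear_vee]
        linear_diff[OF linear_vee] vee_hat)
  then have "snd (T u) = cross3 (snd (T z)) (snd (T w)) + Q (fst (T z)) (fst (T w))"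
    unfolding T_def[of u] by simp
  with 1 show "T u = (cross3 (snd (T z)) (fst (T w)) - cross3 (snd (T w)) (fst (T z)),
     cross3 (snd (T z)) (snd (T w)) + Q (fst (T z)) (fst (T w)))" by (simp add: prod_eq_iff)
qed

end

section \<open>Realisation of all pairs, and isotropy of the curvature\<close>

context killing_algebra6
begin

lemma linear_conj: "linear (\<lambda>M. - vee (H ** M ** E))"
proof (rule linearI)
  show "- vee (H ** (M + N) ** E) = - vee (H ** M ** E) + - vee (H ** N ** E)" for M N
    by (simp add: matrix_add_ldistrib matrix_add_rdistrib linear_add[OF linear_vee])
  have "H ** (r *\<^sub>R M) ** E = r *\<^sub>R (H ** M ** E)" for r M
    by (simp add: matrix_matrix_mult_def vec_eq_iff sum_distrib_left sum_distrib_right mult_ac)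
  then show "- vee (H ** (r *\<^sub>R M) ** E) = r *\<^sub>R - vee (H ** M ** E)" for r M
    by (simp add: linear_scale[OF linear_vee])
qed

lemma linear_covm: "linear covm"
proof (rule linearI)
  define C where "C k = (\<chi> i j. cov (\<xi> k c) i j x)" for k
  have "covm z = (\<Sum>k\<in>UNIV. z $ k *\<^sub>R C k)" for z
  proof -
    have "cov (V z c) i j x = (\<Sum>k\<in>UNIV. z $ k * cov (\<xi> k c) i j x)" for i j
    proof -
      have "cov (V z c) i j x = (\<Sum>k\<in>UNIV. z $ k * partial j (\<lambda>y. \<xi> k c y $ i) x)
          + (\<Sum>l\<in>UNIV. \<Sum>k\<in>UNIV. z $ k * (christoffel (g c) i j l x * \<xi> k c x $ l))"
        using \<xi>_differentiable[OF c x]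
        by (simp add: cov_def V_apply partial_sum partial_mult sum_distrib_left mult.left_commute)
      also have "\<dots> = (\<Sum>k\<in>UNIV. z $ k * cov (\<xi> k c) i j x)"
        by (subst sum.swap) (simp add: cov_def sum.distrib sum_distrib_left distrib_left)
      finally show ?thesis .
    qed
    then show ?thesis by (simp add: covm_def C_def vec_eq_iff)
  qed
  then show "covm (z + w) = covm z + covm w" "covm (r *\<^sub>R z) = r *\<^sub>R covm z" for z w r
    by (simp_all add: scaleR_left_distrib sum.distrib scaleR_sum_right)
qed

lemma V_linear: "V (z + w) d y = V z d y + V w d y" "V (r *\<^sub>R z) d y = r *\<^sub>R V z d y"
  by (simp_all add: V_apply scaleR_left_distrib sum.distrib scaleR_sum_right)

lemma linear_T: "linear T"
proof (rule linearI)
  show "T (z + w) = T z + T w" for z w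
    using linear_add[OF linear_compose[OF linear_covm linear_conj], of z w]
    by (simp add: T_def V_linear matrix_vector_right_distrib)
  show "T (r *\<^sub>R z) = r *\<^sub>R T z" for r z
    using linear_scale[OF linear_compose[OF linear_covm linear_conj], of r z]
    by (simp add: T_def V_linear linear_scale[OF matrix_vector_mul_linear])
qed

text \<open>A field with vanishing value and covariant derivative at \<open>x\<close> vanishes on
  all of \<open>W\<close> by \<open>killing_zero\<close>, and the basis is independent.\<close>

lemma T_zero:
  assumes "T z = 0" shows "z = 0"
proof -
  have "V z c x = 0" using V_T[of z] assms by simp
  moreover have "covm z = 0"
    using conj_inverse[of "covm z"] conj_covm[of z] assms by (simp add: hat_def mat3_simps)
  ultimately have "jet_zero c (V z) x" by (simp add: jet_zero_def covm_def vec_eq_iff)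
  then show ?thesis by (intro V_zero killing_zero[OF V_killing W(1,2) c x])
qed

text \<open>Both sides have dimension six, so injectivity suffices. This is where the dimension of
  the algebra enters.\<close>

lemma bij_T: "bij T"
proof -
  have "inj T" using linear_T T_zero by (simp add: linear_injective_0)
  moreover have "surj T"
  proof -
    obtain h where "linear h" "h \<circ> T = id"
      using linear_injective_left_inverse[OF linear_T \<open>inj T\<close>] by blast
    have "dim (range T) = DIM(real^6)"
      using dim_image_eq[OF linear_T, of UNIV] \<open>inj T\<close> by (simp add: dim_UNIV)
    then have "dim (range T) = DIM((real^3) \<times> (real^3))" by simp
    then have "span (range T) = UNIV" by (rule dim_eq_full[THEN iffD1])
    then show ?thesis
      by (metis linear_T linear_subspace_image span_eq_iff subspace_UNIV)
  qed
  ultimately show ?thesis by (simp add: bij_def)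
qed

definition F :: "(real^3) \<times> (real^3) \<Rightarrow> real^6" where "F = inv T"

lemma TF [simp]: "T (F p) = p"
  unfolding F_def using bij_T by (simp add: bij_def surj_f_inv_f)

lemma FT [simp]: "F (T z) = z"
  unfolding F_def using bij_T by (simp add: bij_def)

lemma bij_F: "bij F"
  unfolding F_def using bij_T by (rule bij_imp_bij_inv)

lemma linear_F: "linear F"
proof (rule linearI)
  show "F (p + q) = F p + F q" for p q
    using linear_add[OF linear_T, of "F p" "F q"] by (metis FT TF)
  show "F (r *\<^sub>R p) = r *\<^sub>R F p" for r p
    using linear_scale[OF linear_T, of r "F p"] by (metis FT TF)
qed

text \<open>Two fields without rotation part have a bracket whose covariant derivative at
  \<open>x\<close> is the curvature alone. As the bracket is a Killing field, the curvature inherits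
  skewness from \<open>covm_skew\<close>.\<close>

lemma curv_conj: "H ** curv (E *v s) (E *v t) ** E = hat (- Q s t)"
proof -
  obtain u where u: "vf_eq_on A W (lie_bracket (V (F (s, 0))) (V (F (t, 0)))) (V u)"
    using V_bracket by blast
  have "covm (F (s, 0)) = 0" for s
    using conj_inverse[of "covm (F (s, 0))"] conj_covm[of "F (s, 0)"] by (simp add: hat_def mat3_simps)
  then have "covm u = curv (E *v s) (E *v t)"
    using T_bracket(2)[OF u] by (simp add: V_T matrix_matrix_mult_def vec_eq_iff)
  then have "transpose (H ** curv (E *v s) (E *v t) ** E) = - (H ** curv (E *v s) (E *v t) ** E)"
    using covm_skew[of u] by simp
  from hat_vee[OF this] show ?thesis by (simp add: Q_def)
qed

lemma curv_swap: "curv y w = - curv w y"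
proof -
  have "(\<Sum>j\<in>UNIV. \<Sum>l\<in>UNIV. riemann (g c) i k j l x * y $ j * w $ l) = - (\<Sum>j\<in>UNIV. \<Sum>l\<in>UNIV. riemann
      (g c) i k j l x * w $ j * y $ l)" for i k
    by (subst sum.swap, subst riemann_skew) (simp add: sum_negf mult_ac)
  then show ?thesis by (simp add: curv_def vec_eq_iff)
qed

lemma linear_curv: "linear (\<lambda>y. curv y w)"
  by (rule linearI) (simp_all add: curv_def vec_eq_iff algebra_simps sum.distrib sum_distrib_left)

lemma Q_skew: "Q s t = - Q t s"
  unfolding Q_def by (subst curv_swap) (simp add: matrix_minus_left matrix_minus_right linear_neg[OF
      linear_vee])

lemma bilinear_Q: "bilinear Q"
proof -
  have lin: "linear (\<lambda>s. Q s t)" for t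
    unfolding Q_def
    using linear_compose[OF linear_compose[OF matrix_vector_mul_linear[of E] linear_curv]
        linear_conj] by (simp add: comp_def)
  have "linear (\<lambda>t. - Q t s)" for s
    using lin[of s] by (rule linear_compose_neg)
  then have "linear (Q s)" for s
    by (subst Q_skew[abs_def]) 
  with lin show ?thesis by (simp add: bilinear_def)
qed

text \<open>The bracket of the algebra carried to pairs by \<open>T\<close>, with the curvature
  \<open>Q\<close> still unspecified.\<close>

definition Q_bracket :: "(real^3) \<times> (real^3) \<Rightarrow> (real^3) \<times> (real^3) \<Rightarrow> (real^3) \<times> (real^3)" where
  "Q_bracket p q = (cross3 (snd p) (fst q) - cross3 (snd q) (fst p), cross3 (snd p) (snd q) + Q (fst
      p) (fst q))"

lemma V_F_bracket: "vf_eq_on A W (lie_bracket (V (F p)) (V (F q))) (V (F (Q_bracket p q)))"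
proof -
  obtain u where u: "vf_eq_on A W (lie_bracket (V (F p)) (V (F q))) (V u)"
    using V_bracket by blast
  have "T u = Q_bracket p q" using T_bracket(1)[OF u] by (simp add: Q_bracket_def)
  then have "u = F (Q_bracket p q)" by (metis FT)
  with u show ?thesis by simp
qed

text \<open>The Jacobi identity holds for the fields on all of \<open>coords c W\<close>, so the
  field of the cyclic sum \<open>u\<close> vanishes there together with its derivatives, and
  \<open>T u = 0\<close>.\<close>

lemma Q_bracket_jacobi:
  "Q_bracket (Q_bracket p q) r + Q_bracket (Q_bracket q r) p + Q_bracket (Q_bracket r p) q = 0"
proof -
  define u where "u = F (Q_bracket (Q_bracket p q) r + Q_bracket (Q_bracket q r) p + Q_bracket
      (Q_bracket r p) q)"
  have br: "V (F (Q_bracket p q)) c y = local_bracket (V (F p) c) (V (F q) c) y" if "y \<in> coords c W"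
      for p q y
    using V_F_bracket[of p q] c that by (simp add: vf_eq_on_def lie_bracket_local)
  have br2: "V (F (Q_bracket (Q_bracket p q) r)) c y = local_bracket (local_bracket (V (F p) c) (V
      (F q) c)) (V (F r) c) y"
    if "y \<in> coords c W" for p q r y
    unfolding br[OF that] by (rule local_bracket_cong[OF open_U that]) (use br in auto)
  have zero: "V u c y = 0" if "y \<in> coords c W" for y
    unfolding u_def linear_add[OF linear_F] V_linear br2[OF that]
    by (rule local_bracket_jacobi[OF open_U _ _ _ that]) (use V_local killing_smooth in blast)+
  have "partial j (\<lambda>y. V u c y $ i) x = 0" for i j
    using partial_cong[OF open_U x, of "\<lambda>y. V u c y $ i" "\<lambda>y. 0" j] zero by simp
  then have "covm u = 0" by (simp add: covm_def cov_def zero[OF x] vec_eq_iff)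
  then have "T u = 0" using linear_0[OF linear_conj] by (simp add: T_def zero[OF x] zero_prod_def)
  then show ?thesis by (simp add: u_def)
qed

text \<open>The rotation part of the Jacobi identity for the rotation \<open>(0, a)\<close> and the
  translations \<open>(y, 0)\<close> and \<open>(z, 0)\<close>.\<close>

lemma Q_invariant: "Q (cross3 a y) z + Q y (cross3 a z) = cross3 a (Q y z)"
proof -
  have "Q_bracket (Q_bracket (0, a) (y, 0)) (z, 0) + Q_bracket (Q_bracket (y, 0) (z, 0)) (0, a)
      + Q_bracket (Q_bracket (z, 0) (0, a)) (y, 0) = 0"
    by (rule Q_bracket_jacobi)
  then have "Q (cross3 a y) z + cross3 (Q y z) a + Q (- cross3 a z) y = 0"
    by (simp add: Q_bracket_def prod_eq_iff bilinear_lzero[OF bilinear_Q] bilinear_rzero[OF bilinear_Q])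
  moreover have "Q (- cross3 a z) y = Q y (cross3 a z)"
    using Q_skew[of "- cross3 a z" y] bilinear_rneg[OF bilinear_Q] by simp
  ultimately show ?thesis
    using cross_skew[of a "Q y z"] by (simp add: add_eq_0_iff algebra_simps)
qed

text \<open>The sectional curvature at \<open>x\<close>, as \<open>riemann_eq\<close>
  confirms.\<close>

definition K :: real where "K = (SOME K. \<forall>s t. Q s t = K *\<^sub>R cross3 s t)"

lemma Q_eq: "Q s t = K *\<^sub>R cross3 s t"
proof -
  have "\<forall>s t. Q s t = K *\<^sub>R cross3 s t"
    unfolding K_def by (rule someI_ex) (rule isotropic_skew_bilinear[OF bilinear_Q Q_skew Q_invariant])
  then show ?thesis by blast
qed

lemma bracket: "vf_eq_on A W (lie_bracket (V (F p)) (V (F q))) (V (F (space_form_bracket K p q)))"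
  using V_F_bracket[of p q] by (simp add: Q_bracket_def space_form_bracket_def Q_eq)

lemma curv_eq: "curv y w *v v = K *\<^sub>R ((w \<bullet> (g c x *v v)) *\<^sub>R y - (y \<bullet> (g c x *v v)) *\<^sub>R w)"
proof -
  define s t r where "s = H *v y" and "t = H *v w" and "r = H *v v"
  have yv: "y = E *v s" "w = E *v t" "v = E *v r" by (simp_all add: s_def t_def r_def EHv)
  have dot: "(E *v a) \<bullet> (g c x *v (E *v b)) = a \<bullet> b" for a b
  proof -
    have "(E *v a) \<bullet> (g c x *v (E *v b)) = a \<bullet> ((transpose E ** g c x ** E) *v b)"
      by (simp only: matrix_vector_mul_assoc[symmetric] dot_lmul_matrix[symmetric]
          vector_transpose_matrix)
    then show ?thesis by (simp add: E)
  qed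
  have "curv y w = E ** hat (- Q s t) ** H"
    using conj_inverse[of "curv y w"] curv_conj[of s t] by (simp only: yv[symmetric])
  then have "curv y w *v v = E *v (hat (- Q s t) *v r)"
    by (simp only: r_def matrix_vector_mul_assoc matrix_mul_assoc)
  \<comment> \<open>The triple product rule for the cross product of \<open>r\<close> with that of
    \<open>s\<close> and \<open>t\<close>.\<close>
  also have "hat (- Q s t) *v r = K *\<^sub>R ((t \<bullet> r) *\<^sub>R s - (s \<bullet> r) *\<^sub>R t)"
    by (simp add: hat_mult Q_eq cross3_def vec_eq_iff forall_3 inner_vec_def sum_3 algebra_simps)
  also have "E *v \<dots> = K *\<^sub>R ((t \<bullet> r) *\<^sub>R y - (s \<bullet> r) *\<^sub>R w)"
    by (simp add: yv linear_diff[OF matrix_vector_mul_linear] linear_scale[OF matrix_vector_mul_linear])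
  finally have "curv y w *v v = K *\<^sub>R ((t \<bullet> r) *\<^sub>R y - (s \<bullet> r) *\<^sub>R w)" .
  moreover have "t \<bullet> r = w \<bullet> (g c x *v v)" "s \<bullet> r = y \<bullet> (g c x *v v)"
    by (simp_all only: yv dot)
  ultimately show ?thesis by simp
qed

lemma riemann_eq: "riemann (g c) i k j l x = K * (g c x $ l $ k * (if i = j then 1 else 0) - g c x $
    j $ k * (if i = l then 1 else 0))"
proof -
  have "riemann (g c) i k j l x = (curv (axis j 1) (axis l 1) *v axis k 1) $ i"
  proof -
    have "(curv (axis j 1) (axis l 1) *v axis k 1) $ i = curv (axis j 1) (axis l 1) $ i $ k"
      by (simp add: matrix_vector_mult_basis column_def)
    then show ?thesis
      by (simp add: curv_def axis_def if_distrib[of "\<lambda>a. _ * a"] cong: if_cong)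
  qed
  also have "\<dots> = K * (g c x $ l $ k * (if i = j then 1 else 0) - g c x $ j $ k * (if i = l then 1
      else 0))"
    unfolding curv_eq by (simp add: matrix_vector_mult_basis column_def inner_axis') (simp add:
        axis_def)
  finally show ?thesis .
qed

text \<open>Contraction gives 2K times the metric as Ricci tensor, and the metric has trace
  3.\<close>

lemma scalar_curvature_eq: "scalar_curvature (g c) x = 6 * K"
proof -
  have ric: "ricci (g c) j l x = 2 * K * g c x $ l $ j" for j l
    using exhaust_3[of l] by (auto simp: ricci_def riemann_eq sum_3)
  have "scalar_curvature (g c) x = 2 * K * (\<Sum>l\<in>UNIV. \<Sum>j\<in>UNIV. g c x $ l $ j * matrix_inv (g c x) $ j
      $ l)"
    unfolding scalar_curvature_def ric by (subst sum.swap) (simp add: sum_distrib_left mult_ac)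
  also have "\<dots> = 6 * K" by (simp add: G_inv[OF x])
  finally show ?thesis .
qed

lemma V_F_value: "V (F p) c x = E *v fst p"
  by (simp add: V_T)

end

text \<open>The counterpart of \<open>V\<close> that is free of a chosen chart, point and
  orthonormal frame.\<close>

definition vf_vec :: "('k::finite \<Rightarrow> ('m, 'n::finite) vfield) \<Rightarrow> real^'k \<Rightarrow> ('m, 'n) vfield" where
  "vf_vec \<xi> z = vf_comb (\<lambda>k. z $ k) \<xi>"

lemma vf_vec_linear:
  "vf_vec \<xi> (z + w) c x = vf_vec \<xi> z c x + vf_vec \<xi> w c x"
  "vf_vec \<xi> (r *\<^sub>R z) c x = r *\<^sub>R vf_vec \<xi> z c x"
  "vf_vec \<xi> 0 c x = 0"
  by (simp_all add: vf_vec_def vf_comb_def scaleR_left_distrib sum.distrib scaleR_sum_right)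

lemma vf_vec_axis: "vf_vec \<xi> (axis i 1) = \<xi> i"
  by (rule ext)+ (simp add: vf_vec_def vf_comb_def axis_def if_distrib[of "\<lambda>a. a *\<^sub>R _"] cong: if_cong)

lemma lie_bracket_swap: "lie_bracket Y X c x = - lie_bracket X Y c x"
  by (simp add: lie_bracket_def vec_eq_iff sum_subtractf)

lemma lie_bracket_self: "lie_bracket X X c x = 0"
  by (simp add: lie_bracket_def vec_eq_iff)

lemma span_range_iff_det:
  fixes v :: "3 \<Rightarrow> real^3"
  shows "span (range v) = UNIV \<longleftrightarrow> det (\<chi> i j. v j $ i) \<noteq> 0"
proof -
  let ?M = "\<chi> i j. v j $ i"
  have "columns ?M = range v" by (auto simp: columns_def column_def)
  then show ?thesis
    using matrix_right_invertible_span_columns[of ?M]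
    by (simp add: invertible_det_nz[symmetric] invertible_right_inverse span_vec_eq)
qed

section \<open>Subalgebras acting transitively near a point\<close>

context riemannian_3manifold
begin

text \<open>Summary of the analysis at a point: \<open>F\<close> parametrises the algebra by pairs,
  and \<open>E\<close> translates the first component of a pair into the value of the field at
  \<open>x\<close>.\<close>

lemma killing_algebra6_structure:
  fixes \<xi> :: "6 \<Rightarrow> ('m, 3) vfield"
  assumes "killing_algebra_basis A g W \<xi>" "c \<in> A" "x \<in> coords c W"
  obtains K E F where "bij F" "linear F" "det E \<noteq> 0" "scalar_curvature (g c) x = 6 * K"
    "\<And>p q. vf_eq_on A W (lie_bracket (vf_vec \<xi> (F p)) (vf_vec \<xi> (F q))) (vf_vec \<xi> (F
        (space_form_bracket K p q)))"
    "\<And>p. vf_vec \<xi> (F p) c x = E *v fst p"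
proof -
  have W: "open W" using assms(1) by (simp add: killing_algebra_basis_def)
  interpret l: local_metric "coords c W" "g c" by (rule local_metric[OF assms(2) W])
  obtain E :: "real^3^3" where E: "transpose E ** g c x ** E = mat 1"
    using gram_schmidt3[OF l.transpose_G[OF assms(3)] l.pos_G[OF assms(3)]] by blast
  interpret k: killing_algebra6 A g W \<xi> c x E
    by unfold_locales (use assms E in auto)
  have "invertible E" using k.HE k.EH by (auto simp: invertible_def)
  then show ?thesis
    using that[OF k.bij_F k.linear_F _ k.scalar_curvature_eq] k.bracket k.V_F_value
    by (simp add: vf_vec_def k.V_def invertible_det_nz)
qed

lemma span_transform:
  assumes "\<And>i. vector_field_on A W (\<eta> i)" "c \<in> A" "d \<in> A" "q \<in> fst c" "q \<in> fst d" "q \<in> W"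
    and "span (range (\<lambda>i::'k::finite. \<eta> i c (snd c q))) = UNIV"
  shows "span (range (\<lambda>i. \<eta> i d (snd d q))) = UNIV"
proof -
  let ?J = "jacobian c d (snd c q)"
  have x: "snd c q \<in> coords c (fst d \<inter> W)" "snd c q \<in> coords c (fst d)" using assms by (auto intro:
      coordsI)
  have "transition c d (snd c q) = snd d q" using chart_inv_snd assms by (simp add: transition_def)
  then have eq: "\<eta> i d (snd d q) = ?J *v \<eta> i c (snd c q)" for i
    using vector_field_transform[OF assms(1) assms(2,3) x(1)] by metis
  have "inj ((*v) ?J)"
    using jacobian_inj[OF assms(2,3) x(2)] by (simp add: linear_injective_0 matrix_vector_mul_linear)
  then have "surj ((*v) ?J)" by (simp add: linear_injective_imp_surjective matrix_vector_mul_linear)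
  have "range (\<lambda>i. \<eta> i d (snd d q)) = (*v) ?J ` range (\<lambda>i. \<eta> i c (snd c q))"
    by (simp add: eq image_image)
  then show ?thesis
    using \<open>surj ((*v) ?J)\<close> assms(7) by (simp add: linear_span_image)
qed

text \<open>Spanning means a non-zero determinant of the components in \<open>c\<close>, an open
  condition; \<open>span_transform\<close> carries it to the other charts.\<close>

lemma transitive_near:
  fixes \<eta> :: "3 \<Rightarrow> ('m, 3) vfield"
  assumes "open W" "\<And>i. vector_field_on A W (\<eta> i)" "c \<in> A" "p \<in> fst c" "p \<in> W"
    and "span (range (\<lambda>i. \<eta> i c (snd c p))) = UNIV"
  obtains W' where "open W'" "connected W'" "p \<in> W'" "W' \<subseteq> W" "transitive_on A W' \<eta>"
proof -
  let ?D = "\<lambda>x. det (\<chi> i j. \<eta> j c x $ i)"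
  let ?S = "coords c W"
  have S: "open ?S" by (rule open_coords[OF assms(3,1)])
  have "smooth_on ?S (\<eta> j c)" for j using assms(2)[of j] assms(3) by (simp add: vector_field_on_def)
  then have "smooth_on ?S ?D" by (intro smooth_on_det3 S) (auto intro: smooth_on_nth S)
  then have cont: "continuous_on ?S ?D" by (rule smooth_on_continuous_on)
  have px: "snd c p \<in> ?S" using assms by (intro coordsI)
  have "open (?S \<inter> ?D -` (- {0}))" by (rule continuous_open_preimage[OF cont S]) auto
  moreover have "snd c p \<in> ?S \<inter> ?D -` (- {0})" using px assms(6) by (simp add: span_range_iff_det)
  ultimately obtain r where r: "r > 0" "ball (snd c p) r \<subseteq> ?S \<inter> ?D -` (- {0})"
    using open_contains_ball by blast
  then have b: "ball (snd c p) r \<subseteq> ?S" by blast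
  note N = chart_ball[OF assms(3) b]
  show ?thesis
  proof (rule that[OF N(1,2) _ N(3)])
    show "p \<in> chart_ball c (snd c p) r" using r assms by (simp add: chart_ball_def)
    show "transitive_on A (chart_ball c (snd c p) r) \<eta>"
      unfolding transitive_on_def
    proof (intro ballI)
      fix d y assume d: "d \<in> A" "y \<in> coords d (chart_ball c (snd c p) r)"
      then obtain q where q: "q \<in> fst d" "q \<in> chart_ball c (snd c p) r" "y = snd d q" by (auto simp:
          coords_def)
      then have q2: "q \<in> fst c" "q \<in> W" "snd c q \<in> ball (snd c p) r" using N(3) by (auto simp:
          chart_ball_def)
      then have "span (range (\<lambda>i. \<eta> i c (snd c q))) = UNIV"
        using r(2) by (auto simp: span_range_iff_det)
      from span_transform[OF assms(2,3) d(1) q2(1) q(1) q2(2) this]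
      show "span (range (\<lambda>i. \<eta> i d y)) = UNIV" by (simp add: q(3))
    qed
  qed
qed

lemma transitive_independent:
  fixes \<eta> :: "3 \<Rightarrow> ('m, 3) vfield"
  assumes "transitive_on A W \<eta>" "p \<in> W" "vf_eq_on A W (vf_comb a \<eta>) vf_zero"
  shows "a i = 0"
proof -
  obtain c where c: "c \<in> A" "p \<in> fst c" using chart_cover by blast
  let ?x = "snd c p"
  have x: "?x \<in> coords c W" using c assms(2) by (intro coordsI)
  let ?M = "\<chi> i j. \<eta> j c ?x $ i"
  have "det ?M \<noteq> 0"
    using assms(1) c x by (simp add: transitive_on_def span_range_iff_det)
  moreover have "?M *v (\<chi> i. a i) = 0"
    using assms(3) c x
    by (simp add: vf_eq_on_def vf_comb_def matrix_vector_mult_def vec_eq_iff mult.commute)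
  ultimately have "(\<chi> i. a i) = 0"
    by (metis invertible_det_nz invertible_left_inverse matrix_left_invertible_ker)
  then show ?thesis by (metis vec_lambda_beta zero_index)
qed

text \<open>Independent first components make the fields span the tangent space at \<open>p\<close>,
  hence nearby; the bracket relations pass from pairs to fields through the linear map
  \<open>F\<close>.\<close>

lemma subalgebra_G3:
  fixes \<xi> :: "6 \<Rightarrow> ('m, 3) vfield" and q :: "3 \<Rightarrow> (real^3) \<times> (real^3)"
  assumes "killing_algebra_basis A g W \<xi>" "c \<in> A" "p \<in> fst c" "p \<in> W"
    and F: "linear F" "det E \<noteq> 0"
    "\<And>s t. vf_eq_on A W (lie_bracket (vf_vec \<xi> (F s)) (vf_vec \<xi> (F t))) (vf_vec \<xi> (F
        (space_form_bracket K s t)))"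
    "\<And>s. vf_vec \<xi> (F s) c (snd c p) = E *v fst s"
    and det: "det (\<chi> i j. fst (q j) $ i) \<noteq> 0"
    and b12: "space_form_bracket K (q 1) (q 2) = (\<Sum>k\<in>UNIV. a12 k *\<^sub>R q k)"
    and b23: "space_form_bracket K (q 2) (q 3) = (\<Sum>k\<in>UNIV. a23 k *\<^sub>R q k)"
    and b31: "space_form_bracket K (q 3) (q 1) = (\<Sum>k\<in>UNIV. a31 k *\<^sub>R q k)"
  obtains W' \<eta> where "p \<in> W'" "killing_algebra_basis A g W' \<eta>" "transitive_on A W' \<eta>"
    "vf_eq_on A W' (lie_bracket (\<eta> 1) (\<eta> 2)) (vf_comb a12 \<eta>)"
    "vf_eq_on A W' (lie_bracket (\<eta> 2) (\<eta> 3)) (vf_comb a23 \<eta>)"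
    "vf_eq_on A W' (lie_bracket (\<eta> 3) (\<eta> 1)) (vf_comb a31 \<eta>)"
proof -
  define \<eta> where "\<eta> i = vf_vec \<xi> (F (q i))" for i
  have W: "open W" "\<And>i. killing_field_on A g W (\<xi> i)" using assms(1) by (auto simp:
      killing_algebra_basis_def)
  have kill: "killing_field_on A g W (\<eta> i)" for i
    unfolding \<eta>_def vf_vec_def by (rule killing_field_on_comb[OF W])
  then have vf: "vector_field_on A W (\<eta> i)" for i by (simp add: killing_field_on_def)
  have "(\<chi> i j. \<eta> j c (snd c p) $ i) = E ** (\<chi> i j. fst (q j) $ i)"
    using F(4) by (simp add: \<eta>_def vec_eq_iff matrix_matrix_mult_def matrix_vector_mult_def)
  then have sp: "span (range (\<lambda>i. \<eta> i c (snd c p))) = UNIV"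
    using det F(2) by (simp add: span_range_iff_det det_mul)
  obtain W' where W': "open W'" "connected W'" "p \<in> W'" "W' \<subseteq> W" "transitive_on A W' \<eta>"
    by (rule transitive_near[OF W(1) vf assms(2-4) sp])
  have comb: "vf_vec \<xi> (F (\<Sum>k\<in>UNIV. a k *\<^sub>R q k)) = vf_comb a \<eta>" for a
    by (rule ext)+ (simp add: \<eta>_def vf_comb_def sum_3 linear_add[OF F(1)] linear_scale[OF F(1)]
        vf_vec_linear)
  have br: "vf_eq_on A W' (lie_bracket (\<eta> i) (\<eta> j)) (vf_comb a \<eta>)"
    if "space_form_bracket K (q i) (q j) = (\<Sum>k\<in>UNIV. a k *\<^sub>R q k)" for i j a
    using vf_eq_on_subset[OF F(3)[of "q i" "q j"] W'(4)] that by (simp add: \<eta>_def[symmetric] comb)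
  note br123 = br[OF b12] br[OF b23] br[OF b31]
  have swap: "\<exists>a. vf_eq_on A W' (lie_bracket (\<eta> j) (\<eta> i)) (vf_comb a \<eta>)"
    if "vf_eq_on A W' (lie_bracket (\<eta> i) (\<eta> j)) (vf_comb a \<eta>)" for i j a
    using that by (intro exI[of _ "\<lambda>k. - a k"])
      (simp add: vf_eq_on_def lie_bracket_swap[of "\<eta> j"] vf_comb_def sum_negf)
  have self: "vf_eq_on A W' (lie_bracket (\<eta> i) (\<eta> i)) (vf_comb (\<lambda>_. 0) \<eta>)" for i
    by (simp add: vf_eq_on_def lie_bracket_self vf_comb_def)
  have "\<exists>a. vf_eq_on A W' (lie_bracket (\<eta> i) (\<eta> j)) (vf_comb a \<eta>)" for i j
    using exhaust_3[of i] exhaust_3[of j] self br123 br123[THEN swap] by (elim disjE) blast+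
  then have "killing_algebra_basis A g W' \<eta>"
    unfolding killing_algebra_basis_def
    using W' killing_field_on_subset[OF kill W'(4)] transitive_independent[OF W'(5,3)] by blast
  then show ?thesis using that W'(3,5) br123 by blast
qed

end

section \<open>Subalgebras and matrix representations\<close>

definition tri :: "'a \<Rightarrow> 'a \<Rightarrow> 'a \<Rightarrow> 3 \<Rightarrow> 'a" where
  "tri a b c i = (if i = 1 then a else if i = 2 then b else c)"

lemma tri_simps [simp]: "tri a b c 1 = a" "tri a b c 2 = b" "tri a b c 3 = c"
  by (simp_all add: tri_def)

lemma vf_comb_tri: "vf_comb (tri a b c) \<eta> d y = a *\<^sub>R \<eta> 1 d y + b *\<^sub>R \<eta> 2 d y + c *\<^sub>R \<eta> 3 d y"
  by (simp add: vf_comb_def sum_3)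

lemma bianchi_I_iff:
  "bianchi_I A W \<eta> \<longleftrightarrow> vf_eq_on A W (lie_bracket (\<eta> 1) (\<eta> 2)) vf_zero \<and>
    vf_eq_on A W (lie_bracket (\<eta> 2) (\<eta> 3)) vf_zero \<and> vf_eq_on A W (lie_bracket (\<eta> 3) (\<eta> 1)) vf_zero"
  (is "_ \<longleftrightarrow> ?B")
proof
  assume B: ?B
  have "vf_eq_on A W (lie_bracket (\<eta> i) (\<eta> j)) vf_zero" for i j
    using exhaust_3[of i] exhaust_3[of j] B lie_bracket_swap[of "\<eta> 1" "\<eta> 2"] lie_bracket_swap[of "\<eta>
        2" "\<eta> 3"]
      lie_bracket_swap[of "\<eta> 3" "\<eta> 1"]
    by (auto simp: vf_eq_on_def lie_bracket_self)
  then show "bianchi_I A W \<eta>" by (simp add: bianchi_I_def)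
qed (simp add: bianchi_I_def)

text \<open>The algebraic half of the existence statements. The determinant makes the three values
  at the base point independent; the brackets are listed in the cyclic order of the Bianchi-Behr
  tables.\<close>

definition has_subalgebra :: "real \<Rightarrow> (3 \<Rightarrow> real) \<Rightarrow> (3 \<Rightarrow> real) \<Rightarrow> (3 \<Rightarrow> real) \<Rightarrow> bool" where
  "has_subalgebra K a12 a23 a31 \<longleftrightarrow> (\<exists>q. det (\<chi> i j. fst (q j) $ i) \<noteq> 0 \<and>
     space_form_bracket K (q 1) (q 2) = (\<Sum>k\<in>UNIV. a12 k *\<^sub>R q k) \<and>
     space_form_bracket K (q 2) (q 3) = (\<Sum>k\<in>UNIV. a23 k *\<^sub>R q k) \<and>
     space_form_bracket K (q 3) (q 1) = (\<Sum>k\<in>UNIV. a31 k *\<^sub>R q k))"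

lemmas sf_simps = space_form_bracket_def cross3_def prod_eq_iff vec_eq_iff forall_3 sum_3 det_3

context riemannian_3manifold
begin

lemma G6_imp_transitive_G3:
  fixes T :: "('m, 3) bianchi_type"
  assumes G6: "admits_G6 A g"
    and scal: "\<And>c x. c \<in> A \<Longrightarrow> x \<in> coords c UNIV \<Longrightarrow> R (scalar_curvature (g c) x)"
    and sub: "\<And>K. R (6 * K) \<Longrightarrow> has_subalgebra K a12 a23 a31"
    and T: "\<And>W \<eta>. vf_eq_on A W (lie_bracket (\<eta> 1) (\<eta> 2)) (vf_comb a12 \<eta>) \<Longrightarrow>
      vf_eq_on A W (lie_bracket (\<eta> 2) (\<eta> 3)) (vf_comb a23 \<eta>) \<Longrightarrow>
      vf_eq_on A W (lie_bracket (\<eta> 3) (\<eta> 1)) (vf_comb a31 \<eta>) \<Longrightarrow> T A W \<eta>"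
  shows "admits_transitive_G3 A g T"
  unfolding admits_transitive_G3_def
proof
  fix p
  obtain W and \<xi> :: "6 \<Rightarrow> ('m, 3) vfield" where W: "p \<in> W" "killing_algebra_basis A g W \<xi>"
    using G6 unfolding admits_G6_def by blast
  obtain c where c: "c \<in> A" "p \<in> fst c" using chart_cover by blast
  have x: "snd c p \<in> coords c W" "snd c p \<in> coords c UNIV" using c W by (auto intro: coordsI)
  obtain K E F where F: "bij F" "linear F" "det E \<noteq> 0" "scalar_curvature (g c) (snd c p) = 6 * K"
    "\<And>p q. vf_eq_on A W (lie_bracket (vf_vec \<xi> (F p)) (vf_vec \<xi> (F q))) (vf_vec \<xi> (F
        (space_form_bracket K p q)))"
    "\<And>s. vf_vec \<xi> (F s) c (snd c p) = E *v fst s"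
    using killing_algebra6_structure[OF W(2) c(1) x(1)] by metis
  obtain q where q: "det (\<chi> i j. fst (q j) $ i) \<noteq> 0"
      "space_form_bracket K (q 1) (q 2) = (\<Sum>k\<in>UNIV. a12 k *\<^sub>R q k)"
      "space_form_bracket K (q 2) (q 3) = (\<Sum>k\<in>UNIV. a23 k *\<^sub>R q k)"
      "space_form_bracket K (q 3) (q 1) = (\<Sum>k\<in>UNIV. a31 k *\<^sub>R q k)"
    using sub[of K] scal[OF c(1) x(2)] F(4) by (auto simp: has_subalgebra_def)
  obtain W' \<eta> where W': "p \<in> W'" "killing_algebra_basis A g W' \<eta>" "transitive_on A W' \<eta>"
    "vf_eq_on A W' (lie_bracket (\<eta> 1) (\<eta> 2)) (vf_comb a12 \<eta>)"
    "vf_eq_on A W' (lie_bracket (\<eta> 2) (\<eta> 3)) (vf_comb a23 \<eta>)"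
    "vf_eq_on A W' (lie_bracket (\<eta> 3) (\<eta> 1)) (vf_comb a31 \<eta>)"
    by (rule subalgebra_G3[OF W(2) c W(1) F(2,3,5,6) q])
  then show "\<exists>W \<eta>. p \<in> W \<and> killing_algebra_basis A g W \<eta> \<and> transitive_on A W \<eta> \<and> T A W \<eta>"
    using T[OF W'(4-6)] by blast
qed

lemma G6_flat_imp_I:
  assumes "admits_G6 A g" "\<forall>c\<in>A. \<forall>x\<in>coords c UNIV. scalar_curvature (g c) x = 0"
  shows "admits_transitive_G3 A g bianchi_I"
proof (rule G6_imp_transitive_G3[where R = "\<lambda>r. r = 0" and ?a12.0 = "tri 0 0 0" and ?a23.0 = "tri 0
    0 0" and ?a31.0 = "tri 0 0 0"])
  \<comment> \<open>Three translations, which commute for K = 0.\<close>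
  show "has_subalgebra K (tri 0 0 0) (tri 0 0 0) (tri 0 0 0)" if "6 * K = 0" for K :: real
    unfolding has_subalgebra_def using that by (intro exI[of _ "tri (vector [1,0,0], 0) (vector
        [0,1,0], 0) (vector [0,0,1], 0)"]) (simp add: sf_simps)
qed (use assms in \<open>auto simp: bianchi_I_iff vf_eq_on_def vf_comb_tri\<close>)

lemma G6_flat_imp_VII0:
  assumes "admits_G6 A g" "\<forall>c\<in>A. \<forall>x\<in>coords c UNIV. scalar_curvature (g c) x = 0"
  shows "admits_transitive_G3 A g bianchi_VII0"
proof (rule G6_imp_transitive_G3[where R = "\<lambda>r. r = 0" and ?a12.0 = "tri 0 0 0" and ?a23.0 = "tri
    (-1) 0 0" and ?a31.0 = "tri 0 (-1) 0"])
  \<comment> \<open>Two translations and a screw motion along the third axis, whose rotation part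
    turns the plane of the first two.\<close>
  show "has_subalgebra K (tri 0 0 0) (tri (-1) 0 0) (tri 0 (-1) 0)" if "6 * K = 0" for K :: real
    unfolding has_subalgebra_def using that by (intro exI[of _ "tri (vector [1,0,0], 0) (vector
        [0,1,0], 0) (vector [0,0,1], vector [0,0,-1])"]) (simp add: sf_simps)
qed (use assms in \<open>auto simp: bianchi_VII0_def bianchi_VII_def vf_eq_on_def vf_comb_tri\<close>)

lemma G6_negative_imp_V:
  assumes "admits_G6 A g" "\<forall>c\<in>A. \<forall>x\<in>coords c UNIV. scalar_curvature (g c) x < 0"
  shows "admits_transitive_G3 A g bianchi_V"
proof (rule G6_imp_transitive_G3[where R = "\<lambda>r. r < 0" and ?a12.0 = "tri 0 0 0" and ?a23.0 = "tri 0
    1 0" and ?a31.0 = "tri (-1) 0 0"])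
  show "has_subalgebra K (tri 0 0 0) (tri 0 1 0) (tri (-1) 0 0)" if "6 * K < 0" for K :: real
  proof -
    \<comment> \<open>The first two fields are translations corrected by rotations: the rotation
      parts contribute k^2 times the third basis vector to their bracket, cancelling the curvature
      term. They generate the translations of a horosphere; the third field is the translation
      normal to it, scaled by 1/k to act on them with eigenvalue -1.\<close>
    define k where "k = sqrt (- K)"
    have k: "k > 0" "K = - (k * k)" using that by (simp_all add: k_def)
    show ?thesis
      using k(1) unfolding k(2) has_subalgebra_def
      by (intro exI[of _ "tri (vector [1,0,0], vector [0,k,0]) (vector [0,1,0], vector [-k,0,0])
          (vector [0,0,1/k], 0)"]) (simp add: sf_simps)
  qed
qed (use assms in \<open>auto simp: bianchi_V_def vf_eq_on_def vf_comb_tri\<close>)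

text \<open>In type VII the third field acts on the abelian plane with complex eigenvalues of
  modulus 1. They arise from type V by adding a rotation about the normal axis, in a proportion
  fixed by \<open>q\<close>.\<close>

lemma G6_negative_imp_VIIh:
  assumes "admits_G6 A g" "\<forall>c\<in>A. \<forall>x\<in>coords c UNIV. scalar_curvature (g c) x < 0" "h > 0"
  shows "admits_transitive_G3 A g (bianchi_VIIh h)"
proof -
  \<comment> \<open>The positive solution of \<open>h = q\<^sup>2 / (4 - q\<^sup>2)\<close>.\<close>
  define q where "q = sqrt (4 * h / (1 + h))"
  have q2: "q\<^sup>2 = 4 * h / (1 + h)" and q0: "q \<noteq> 0" using assms(3) by (simp_all add: q_def)
  have q4: "q\<^sup>2 < 4" using assms(3) by (simp add: q2 divide_less_eq)
  have h: "h = q\<^sup>2 / (4 - q\<^sup>2)" using assms(3) by (simp add: q2 field_simps)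
  \<comment> \<open>The eigenvalues are the roots -q/2 + i s and -q/2 - i s of X^2 + q X +
    1.\<close>
  define s where "s = sqrt (1 - q\<^sup>2 / 4)"
  have s: "s > 0" "s * s = 1 - q * q / 4" using q4 by (simp_all add: s_def power2_eq_square)
  show ?thesis
  proof (rule G6_imp_transitive_G3[where R = "\<lambda>r. r < 0" and ?a12.0 = "tri 0 0 0" and ?a23.0 = "tri
      (-1) q 0" and ?a31.0 = "tri 0 (-1) 0"])
    show "has_subalgebra K (tri 0 0 0) (tri (-1) q 0) (tri 0 (-1) 0)" if "6 * K < 0" for K :: real
    proof -
      define k where "k = sqrt (- K)"
      have k: "k > 0" "K = - (k * k)" using that by (simp_all add: k_def)
      have ss: "s * (s * r) = r - q * (q * r) / 4" for r
        using s(2) by (simp add: mult.assoc[symmetric] left_diff_distrib)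
      \<comment> \<open>With P1, P2, P3 the type V fields, these are P1, then (q/2) P1 - s P2, then
        (q/2) P3 plus \<open>s\<close> times the rotation about the third axis. The second is forced
        by the required bracket of the third with the first.\<close>
      show ?thesis
        using k(1) s(1) q0 unfolding k(2) has_subalgebra_def
        by (intro exI[of _ "tri (vector [1,0,0], vector [0,k,0])
            (vector [q/2,-s,0], vector [s*k,q*k/2,0]) (vector [0,0,q/(2*k)], vector [0,0,s])"])
          (simp add: sf_simps field_simps ss s(2))
    qed
  qed (use assms q0 q4 h in \<open>auto simp: bianchi_VIIh_def bianchi_VII_def vf_eq_on_def vf_comb_tri
      intro!: exI[of _ q]\<close>)
qed

lemma G6_positive_imp_IX:
  assumes "admits_G6 A g" "\<forall>c\<in>A. \<forall>x\<in>coords c UNIV. scalar_curvature (g c) x > 0"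
  shows "admits_transitive_G3 A g bianchi_IX"
proof (rule G6_imp_transitive_G3[where R = "\<lambda>r. r > 0" and ?a12.0 = "tri 0 0 1" and ?a23.0 = "tri 1
    0 0" and ?a31.0 = "tri 0 1 0"])
  show "has_subalgebra K (tri 0 0 1) (tri 1 0 0) (tri 0 1 0)" if "6 * K > 0" for K :: real
  proof -
    define k where "k = sqrt K"
    have k: "k > 0" "K = k * k" using that by (simp_all add: k_def)
    \<comment> \<open>One of the two commuting so(3) summands of so(4), acting like the
      left-invariant fields of the 3-sphere. Each bracket receives two equal contributions, which
      the factors 1/2 make up for.\<close>
    show ?thesis
      using k(1) unfolding k(2) has_subalgebra_def
      by (intro exI[of _ "tri (vector [1/(2*k),0,0], vector [1/2,0,0]) (vector [0,1/(2*k),0], vector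
          [0,1/2,0])
         (vector [0,0,1/(2*k)], vector [0,0,1/2])"]) (simp add: sf_simps)
  qed
qed (use assms in \<open>auto simp: bianchi_IX_def vf_eq_on_def vf_comb_tri\<close>)

end

section \<open>Matrix models of the three Lie algebras\<close>

definition quad :: "'a \<Rightarrow> 'a \<Rightarrow> 'a \<Rightarrow> 'a \<Rightarrow> 'a^4" where
  "quad a b c d = (\<chi> i. if i = 1 then a else if i = 2 then b else if i = 3 then c else d)"

lemma quad_simps [simp]: "quad a b c d $ 1 = a" "quad a b c d $ 2 = b" "quad a b c d $ 3 = c" "quad
    a b c d $ 4 = d"
  by (simp_all add: quad_def)

text \<open>The block \<open>hat a\<close> bordered by the column l s and the row m s realises K = -
  l m. The choices (1, 0), (k, - k) and (k, k) give the algebras of E(3), SO(4) and SO(3,1).\<close>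

definition motion_matrix :: "real \<Rightarrow> real \<Rightarrow> (real^3) \<times> (real^3) \<Rightarrow> real^4^4" where
  "motion_matrix l m p = (let s = fst p; a = snd p in
     quad (quad 0 (- a$3) (a$2) (l * s$1)) (quad (a$3) 0 (- a$1) (l * s$2)) (quad (- a$2) (a$1) 0 (l
         * s$3))
       (quad (m * s$1) (m * s$2) (m * s$3) 0))"

lemmas mat4_simps = vec_eq_iff forall_4 sum_4 matrix_matrix_mult_def transpose_def

lemma motion_matrix_commutator:
  "motion_matrix l m p ** motion_matrix l m q - motion_matrix l m q ** motion_matrix l m p
    = motion_matrix l m (space_form_bracket (- (l * m)) p q)"
  by (simp add: motion_matrix_def Let_def space_form_bracket_def cross3_def mat4_simps algebra_simps)

lemma linear_motion_matrix: "linear (motion_matrix l m)"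
  by (rule linearI) (simp_all add: motion_matrix_def Let_def mat4_simps algebra_simps)

lemma inj_motion_matrix: "l \<noteq> 0 \<Longrightarrow> inj (motion_matrix l m)"
  by (rule injI) (simp add: motion_matrix_def Let_def mat4_simps prod_eq_iff forall_3)

lemma range_motion_matrix:
  assumes "l \<noteq> 0" "\<And>i j. i \<noteq> 4 \<Longrightarrow> j \<noteq> 4 \<Longrightarrow> X $ i $ j = - X $ j $ i" "\<And>i. i \<noteq> 4 \<Longrightarrow> l * X $ 4 $ i = m * X
      $ i $ 4" "X $ 4 $ 4 = 0"
  shows "X \<in> range (motion_matrix l m)"
proof -
  have "X = motion_matrix l m (vector [X$1$4 / l, X$2$4 / l, X$3$4 / l], vector [X$3$2, X$1$3, X$2$1])"
    using assms(1,4) assms(2)[of 1 1] assms(2)[of 2 2] assms(2)[of 3 3] assms(2)[of 1 2] assms(2)[of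
        2 3] assms(2)[of 3 1]
      assms(3)[of 1] assms(3)[of 2] assms(3)[of 3]
    by (simp add: motion_matrix_def Let_def vec_eq_iff forall_4 field_simps)
  then show ?thesis by blast
qed

lemma e_3_eq: "e_3 = range (motion_matrix 1 0)"
proof (intro equalityI subsetI)
  fix X assume X: "X \<in> e_3"
  then have "1 * X $ 4 $ i = 0 * X $ i $ 4" "X $ 4 $ 4 = 0" for i by (simp_all add: e_3_def)
  moreover have "X $ i $ j = - X $ j $ i" if "i \<noteq> 4" "j \<noteq> 4" for i j
    using X that unfolding e_3_def by blast
  moreover have "(1::real) \<noteq> 0" by simp
  ultimately show "X \<in> range (motion_matrix 1 0)"
    by (intro range_motion_matrix) blast+
next
  fix X assume "X \<in> range (motion_matrix 1 0)"
  then obtain p where "X = motion_matrix 1 0 p" by blast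
  then show "X \<in> e_3" by (simp add: e_3_def motion_matrix_def Let_def vec_eq_iff forall_4)
qed

lemma lie_so_diagonal:
  "X \<in> lie_so (\<chi> i j. if i = j then d i else 0) \<longleftrightarrow> (\<forall>i j. d i * X $ i $ j + d j * X $ j $ i = 0)"
proof -
  have 1: "(transpose X ** (\<chi> i j. if i = j then d i else 0)) $ i $ j = d j * X $ j $ i" for i j
    by (simp add: matrix_matrix_mult_def transpose_def if_distrib[of "\<lambda>a. _ * a"] mult.commute cong:
        if_cong)
  have 2: "((\<chi> i j. if i = j then d i else 0) ** X) $ i $ j = d i * X $ i $ j" for i j
    by (simp add: matrix_matrix_mult_def if_distrib[of "\<lambda>a. a * _"] cong: if_cong)
  show ?thesis
    unfolding lie_so_def mem_Collect_eq vec_eq_iff vector_add_component 1 2 by (simp add: add.commute)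
qed

text \<open>The factor \<open>k\<close> only rescales the translation part, so one matrix algebra
  serves all positive curvatures; \<open>k\<close> is adjusted later to match a given one.\<close>

lemma so_4_eq:
  assumes "k > 0" shows "so_4 = range (motion_matrix k (- k))"
proof (intro equalityI subsetI)
  have mat: "mat 1 = ((\<chi> i j. if i = j then 1 else 0) :: real^4^4)" by (simp add: mat_def)
  note so_4 = so_4_def mat lie_so_diagonal[where d = "\<lambda>_. 1"]
  {
    fix X assume "X \<in> so_4"
    then have X: "X $ i $ j + X $ j $ i = 0" for i j by (simp add: so_4)
    have "X $ i $ j = - X $ j $ i" "k * X $ 4 $ i = - k * X $ i $ 4" "X $ 4 $ 4 = 0" for i j
      using X[of i j] X[of 4 i] X[of 4 4] by (simp_all add: add_eq_0_iff)
    then show "X \<in> range (motion_matrix k (- k))"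
      using assms by (intro range_motion_matrix) blast+
  next
    fix X assume "X \<in> range (motion_matrix k (- k))"
    then obtain p where "X = motion_matrix k (- k) p" by blast
    then show "X \<in> so_4" by (simp add: so_4 motion_matrix_def Let_def forall_4)
  }
qed

lemma so_31_eq:
  assumes "k > 0" shows "so_31 = range (motion_matrix k k)"
proof (intro equalityI subsetI)
  note so_31 = so_31_def lie_so_diagonal[where d = "\<lambda>i. if i = 4 then - 1 else 1"]
  {
    fix X assume "X \<in> so_31"
    then have X: "(if i = 4 then - 1 else 1) * X $ i $ j + (if j = 4 then - 1 else 1) * X $ j $ i =
        0" for i j
      unfolding so_31 by blast
    have "X $ i $ j = - X $ j $ i" if "i \<noteq> 4" "j \<noteq> 4" for i j using X[of i j] that by simp
    moreover have "k * X $ 4 $ i = k * X $ i $ 4" if "i \<noteq> 4" for i using X[of i 4] that by simp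
    moreover have "X $ 4 $ 4 = 0" using X[of 4 4] by simp
    ultimately show "X \<in> range (motion_matrix k k)"
      using assms by (intro range_motion_matrix) blast+
  next
    fix X assume "X \<in> range (motion_matrix k k)"
    then obtain p where "X = motion_matrix k k p" by blast
    then show "X \<in> so_31" unfolding so_31 by (simp add: motion_matrix_def Let_def forall_4)
  }
qed

context riemannian_3manifold
begin

text \<open>The inverse of the parametrisation \<open>F\<close> by pairs, followed by
  \<open>motion_matrix\<close>, is the isomorphism onto \<open>S\<close>.\<close>

lemma G6_locally_isomorphicI:
  assumes scal: "\<And>c x. c \<in> A \<Longrightarrow> x \<in> coords c UNIV \<Longrightarrow> R (scalar_curvature (g c) x)"
    and M: "\<And>K. R (6 * K) \<Longrightarrow> \<exists>l m. l \<noteq> 0 \<and> K = - (l * m) \<and> S = range (motion_matrix l m)"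
  shows "G6_locally_isomorphic A g S"
  unfolding G6_locally_isomorphic_def
proof (intro allI impI)
  fix W and \<xi> :: "6 \<Rightarrow> ('m, 3) vfield"
  assume basis: "killing_algebra_basis A g W \<xi>"
  \<comment> \<open>On the empty set all fields agree, which would contradict independence; so there
    is a base point.\<close>
  have "W \<noteq> {}"
  proof
    assume "W = {}"
    then have "vf_eq_on A W (vf_comb (\<lambda>_. 1) \<xi>) vf_zero" by (simp add: vf_eq_on_def coords_def)
    with basis have "\<forall>i::6. (1::real) = 0" unfolding killing_algebra_basis_def by blast
    then show False by simp
  qed
  then obtain p where p: "p \<in> W" by blast
  obtain c where c: "c \<in> A" "p \<in> fst c" using chart_cover by blast
  have x: "snd c p \<in> coords c W" "snd c p \<in> coords c UNIV" using c p by (auto intro: coordsI)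
  obtain K E F where F: "bij F" "linear F" "det E \<noteq> 0" "scalar_curvature (g c) (snd c p) = 6 * K"
    "\<And>p q. vf_eq_on A W (lie_bracket (vf_vec \<xi> (F p)) (vf_vec \<xi> (F q))) (vf_vec \<xi> (F
        (space_form_bracket K p q)))"
    "\<And>s. vf_vec \<xi> (F s) c (snd c p) = E *v fst s"
    using killing_algebra6_structure[OF basis c(1) x(1)] by metis
  obtain l m where lm: "l \<noteq> 0" "K = - (l * m)" "S = range (motion_matrix l m)"
    using M[of K] scal[OF c(1) x(2)] F(4) by auto
  define T where "T = inv F"
  have FT: "F (T z) = z" and TF: "T (F p) = p" for z p
    using F(1) by (simp_all add: T_def bij_def surj_f_inv_f)
  have "linear T"
  proof (rule linearI)
    show "T (z + w) = T z + T w" for z w using linear_add[OF F(2), of "T z" "T w"] by (metis FT TF)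
    show "T (r *\<^sub>R z) = r *\<^sub>R T z" for r z using linear_scale[OF F(2), of r "T z"] by (metis FT TF)
  qed
  define \<Phi> where "\<Phi> = motion_matrix l m \<circ> T"
  have lin: "linear \<Phi>" unfolding \<Phi>_def by (rule linear_compose[OF \<open>linear T\<close> linear_motion_matrix])
  have bijT: "bij T" unfolding T_def using F(1) by (rule bij_imp_bij_inv)
  then have inj: "inj \<Phi>" unfolding \<Phi>_def by (intro inj_compose inj_motion_matrix lm(1)) (simp add:
      bij_def)
  define B where "B i = \<Phi> (axis i 1)" for i
  have exp: "\<Phi> z = (\<Sum>k\<in>UNIV. z $ k *\<^sub>R B k)" for z
  proof -
    have "z = (\<Sum>k\<in>UNIV. z $ k *\<^sub>R axis k 1)" using basis_expansion[of z] by (simp add: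
        scalar_mult_eq_scaleR)
    then have "\<Phi> z = \<Phi> (\<Sum>k\<in>UNIV. z $ k *\<^sub>R axis k 1)" by simp
    then show ?thesis by (simp add: linear_sum[OF lin] linear_scale[OF lin] B_def)
  qed
  have rB: "range B = \<Phi> ` Basis"
    by (auto simp: B_def Basis_vec_def image_iff)
  show "isomorphic_to_matrix_algebra A W \<xi> S"
    unfolding isomorphic_to_matrix_algebra_def
  proof (intro exI[of _ B] conjI allI)
    show "inj B" by (rule injI) (metis B_def axis_eq_axis inj injD zero_neq_one)
    show "independent (range B)"
      unfolding rB using lin inj independent_Basis by (metis linear_independent_injective_image
          inj_on_subset subset_UNIV)
    have "span (range B) = \<Phi> ` UNIV" unfolding rB linear_span_image[OF lin] by simp
    then show "span (range B) = S"
      using bijT unfolding lm(3) \<Phi>_def image_comp[symmetric] by (simp add: bij_def)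
    fix i j
    let ?z = "F (space_form_bracket K (T (axis i 1)) (T (axis j 1)))"
    have 1: "vf_eq_on A W (lie_bracket (\<xi> i) (\<xi> j)) (vf_comb (\<lambda>k. ?z $ k) \<xi>)"
      using F(5)[of "T (axis i 1)" "T (axis j 1)"] by (simp add: FT vf_vec_axis) (simp add: vf_vec_def)
    have "B i ** B j - B j ** B i = \<Phi> ?z"
      using motion_matrix_commutator[of l m] by (simp add: B_def \<Phi>_def TF lm(2))
    then have 2: "B i ** B j - B j ** B i = (\<Sum>k\<in>UNIV. ?z $ k *\<^sub>R B k)" by (simp only: exp)
    show "\<exists>a. vf_eq_on A W (lie_bracket (\<xi> i) (\<xi> j)) (vf_comb a \<xi>) \<and> B i ** B j - B j ** B i =
        (\<Sum>k\<in>UNIV. a k *\<^sub>R B k)"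
      using 1 2 by blast
  qed
qed

lemma G6_flat_e_3:
  assumes "\<forall>c\<in>A. \<forall>x\<in>coords c UNIV. scalar_curvature (g c) x = 0"
  shows "G6_locally_isomorphic A g e_3"
proof (rule G6_locally_isomorphicI[where R = "\<lambda>r. r = 0"])
  show "\<exists>l m. l \<noteq> 0 \<and> K = - (l * m) \<and> e_3 = range (motion_matrix l m)" if "6 * K = 0" for K
    using that e_3_eq by (intro exI[of _ 1] exI[of _ 0]) simp
qed (use assms in auto)

lemma G6_negative_so_31:
  assumes "\<forall>c\<in>A. \<forall>x\<in>coords c UNIV. scalar_curvature (g c) x < 0"
  shows "G6_locally_isomorphic A g so_31"
proof (rule G6_locally_isomorphicI[where R = "\<lambda>r. r < 0"])
  show "\<exists>l m. l \<noteq> 0 \<and> K = - (l * m) \<and> so_31 = range (motion_matrix l m)" if "6 * K < 0" for K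
    using that so_31_eq[of "sqrt (- K)"] by (intro exI[of _ "sqrt (- K)"]) simp
qed (use assms in auto)

lemma G6_positive_so_4:
  assumes "\<forall>c\<in>A. \<forall>x\<in>coords c UNIV. scalar_curvature (g c) x > 0"
  shows "G6_locally_isomorphic A g so_4"
proof (rule G6_locally_isomorphicI[where R = "\<lambda>r. r > 0"])
  show "\<exists>l m. l \<noteq> 0 \<and> K = - (l * m) \<and> so_4 = range (motion_matrix l m)" if "6 * K > 0" for K
    using that so_4_eq[of "sqrt K"] by (intro exI[of _ "sqrt K"] exI[of _ "- sqrt K"]) simp
qed (use assms in auto)

end

section \<open>Closed one-forms\<close>

lemma frechet_derivative_nth:
  assumes "f differentiable (at x)"
  shows "frechet_derivative f (at x) v $ i = frechet_derivative (\<lambda>y. f y $ i) (at x) v"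
proof -
  have "((\<lambda>y. f y $ i) has_derivative (\<lambda>v. frechet_derivative f (at x) v $ i)) (at x)"
    by (rule bounded_linear.has_derivative[OF bounded_linear_vec_nth frechet_derivative_works_at[OF
        assms]])
  then show ?thesis by (simp add: frechet_derivative_eqI)
qed

text \<open>The potential is the integral of \<omega> along the segment from \<open>z\<close> to
  \<open>x\<close>. After differentiation under the integral sign, closedness turns the gradient of
  the integrand into the t-derivative of t \<omega>(z + t (x - z)), which integrates to
  \<omega>(x).\<close>

lemma poincare_ball:
  fixes \<omega> :: "real^'n::finite \<Rightarrow> real^'n"
  assumes smooth: "smooth_on (ball z r) \<omega>"
    and closed: "\<And>x i j. x \<in> ball z r \<Longrightarrow> partial j (\<lambda>y. \<omega> y $ i) x = partial i (\<lambda>y. \<omega> y $ j) x"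
  obtains f where "\<And>x. x \<in> ball z r \<Longrightarrow> (f has_derivative (\<lambda>v. v \<bullet> \<omega> x)) (at x)" "f z = 0"
proof -
  let ?B = "ball z r"
  define D where "D x = frechet_derivative \<omega> (at x)" for x
  have d: "(\<omega> has_derivative D x) (at x)" if "x \<in> ?B" for x
    unfolding D_def using smooth_on_differentiable[OF smooth that] by (rule frechet_derivative_works_at)
  have lin: "linear (D x)" if "x \<in> ?B" for x
    using d[OF that] has_derivative_linear by blast
  have D_nth: "D x v $ i = (\<Sum>j\<in>UNIV. v $ j * partial j (\<lambda>y. \<omega> y $ i) x)" if "x \<in> ?B" for x v i
    using smooth_on_differentiable[OF smooth that] smooth_on_differentiable[OF smooth_on_nth[OF
        open_ball smooth] that]
    by (simp add: D_def frechet_derivative_nth frechet_derivative_partial)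
  \<comment> \<open>Closedness says that the derivative of \<omega> is self-adjoint.\<close>
  have sym: "D x u \<bullet> v = D x v \<bullet> u" if "x \<in> ?B" for x u v
  proof -
    have "D x u \<bullet> v = (\<Sum>i\<in>UNIV. \<Sum>j\<in>UNIV. u $ j * partial j (\<lambda>y. \<omega> y $ i) x * v $ i)"
      by (simp add: inner_vec_def D_nth[OF that] sum_distrib_right)
    also have "\<dots> = (\<Sum>i\<in>UNIV. \<Sum>j\<in>UNIV. v $ j * partial j (\<lambda>y. \<omega> y $ i) x * u $ i)"
      by (subst sum.swap) (simp add: closed[OF that] mult_ac)
    also have "\<dots> = D x v \<bullet> u"
      by (simp add: inner_vec_def D_nth[OF that] sum_distrib_right)
    finally show ?thesis .
  qed
  define p where "p x t = z + t *\<^sub>R (x - z)" for x t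
  have pB: "p x t \<in> ?B" if "x \<in> ?B" "t \<in> cbox 0 1" for x and t :: real
  proof -
    have "z \<in> ?B" using that(1) by (metis centre_in_ball dist_not_less_zero ball_eq_empty empty_iff
        not_less)
    then show ?thesis
      using convexD_alt[OF convex_ball[of z r], of z x t] that by (simp add: p_def algebra_simps)
  qed
  \<comment> \<open>Both the gradient in \<open>x\<close> of the integrand and the derivative in
    \<open>t\<close> of \<open>t *\<^sub>R \<omega> (p x t)\<close>.\<close>
  define w where "w x t = \<omega> (p x t) + t *\<^sub>R D (p x t) (x - z)" for x t
  let ?f = "\<lambda>x t. \<omega> (p x t) \<bullet> (x - z)"
  have cont_p: "continuous_on UNIV (\<lambda>(x, t). p x t)"
    by (auto simp: p_def split_beta intro!: continuous_intros)
  have cont_D: "continuous_on ?B (\<lambda>x. D x v)" for v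
    unfolding D_def by (rule smooth_on_continuous_on[OF smooth_on_frechet_derivative[OF smooth]])
  have cont_\<omega>: "continuous_on ?B \<omega>" by (rule smooth_on_continuous_on[OF smooth])
  have cp: "continuous_on (?B \<times> cbox 0 1) (\<lambda>u. h (p (fst u) (snd u)))" if "continuous_on ?B h" for h
      :: "real^'n \<Rightarrow> real^'n"
    by (rule continuous_on_compose2[OF that, where f = "\<lambda>u. p (fst u) (snd u)"])
      (use pB in \<open>auto simp: p_def intro!: continuous_intros\<close>)
  \<comment> \<open>\<open>cont_D\<close> controls the derivative in one fixed direction at a time;
    joint continuity of \<open>w\<close> therefore goes through the basis vectors.\<close>
  have D_expand: "D (p x t) v = (\<Sum>i\<in>UNIV. v $ i *\<^sub>R D (p x t) (axis i 1))" if "x \<in> ?B" "t \<in> cbox 0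
      1" for x t v
  proof -
    have "D (p x t) v = D (p x t) (\<Sum>i\<in>UNIV. v $ i *\<^sub>R axis i 1)"
      using basis_expansion[of v] by (simp add: scalar_mult_eq_scaleR)
    then show ?thesis by (simp add: linear_sum[OF lin[OF pB[OF that]]] linear_scale[OF lin[OF pB[OF
        that]]])
  qed
  have "continuous_on (?B \<times> cbox 0 1) (\<lambda>u. \<omega> (p (fst u) (snd u)) + snd u *\<^sub>R
      (\<Sum>i\<in>UNIV. (fst u - z) $ i *\<^sub>R D (p (fst u) (snd u)) (axis i 1)))"
    by (intro continuous_intros cp[OF cont_\<omega>] cp[OF cont_D])
  then have cont_w: "continuous_on (?B \<times> cbox 0 1) (\<lambda>(x, t). w x t)"
    by (rule continuous_on_eq) (auto simp: w_def D_expand)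
  have fx: "((\<lambda>x. ?f x t) has_derivative blinfun_apply (blinfun_inner_left (w x t))) (at x within ?B)"
    if "x \<in> ?B" "t \<in> cbox 0 1" for x t
  proof -
    have "((\<lambda>x. p x t) has_derivative (\<lambda>v. t *\<^sub>R v)) (at x)"
      unfolding p_def by (auto intro!: derivative_eq_intros)
    from has_derivative_compose[OF this d[OF pB[OF that]]]
    have "((\<lambda>x. \<omega> (p x t)) has_derivative (\<lambda>v. D (p x t) (t *\<^sub>R v))) (at x)" .
    then have "((\<lambda>x. ?f x t) has_derivative (\<lambda>v. \<omega> (p x t) \<bullet> v + D (p x t) (t *\<^sub>R v) \<bullet> (x - z))) (at x)"
      by (auto intro!: derivative_eq_intros)
    moreover have "\<omega> (p x t) \<bullet> v + D (p x t) (t *\<^sub>R v) \<bullet> (x - z) = v \<bullet> w x t" for v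
      using sym[OF pB[OF that], of v "x - z"]
      by (simp add: w_def linear_scale[OF lin[OF pB[OF that]]] inner_add_right inner_commute)
    ultimately show ?thesis by (simp add: has_derivative_at_withinI)
  qed
  have int_w: "(w x has_integral \<omega> x) (cbox 0 1)" if x: "x \<in> ?B" for x
  proof -
    have "((\<lambda>t. t *\<^sub>R \<omega> (p x t)) has_vector_derivative w x t) (at t within {0..1})" if "t \<in> {0..1}"
        for t
    proof -
      have pb: "p x t \<in> ?B" using pB[OF x, of t] that by simp
      have "(p x has_derivative (\<lambda>h. h *\<^sub>R (x - z))) (at t)"
        unfolding p_def by (auto intro!: derivative_eq_intros)
      from has_derivative_compose[OF this d[OF pb]]
      have "((\<lambda>t. \<omega> (p x t)) has_derivative (\<lambda>h. D (p x t) (h *\<^sub>R (x - z)))) (at t)" .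
      then have "((\<lambda>t. t *\<^sub>R \<omega> (p x t)) has_derivative (\<lambda>h. t *\<^sub>R D (p x t) (h *\<^sub>R (x - z)) + h *\<^sub>R
          \<omega> (p x t))) (at t)"
        by (auto intro!: derivative_eq_intros)
      moreover have "t *\<^sub>R D (p x t) (h *\<^sub>R (x - z)) + h *\<^sub>R \<omega> (p x t) = h *\<^sub>R w x t" for h
        by (simp only: w_def linear_scale[OF lin[OF pb]]) (simp add: scaleR_add_right add.commute
            mult.commute)
      ultimately show ?thesis by (simp add: has_vector_derivative_def has_derivative_at_withinI)
    qed
    from fundamental_theorem_of_calculus[OF _ this]
    have "(w x has_integral 1 *\<^sub>R \<omega> (p x 1) - 0 *\<^sub>R \<omega> (p x 0)) {0..1}" by simp
    then show ?thesis by (simp add: p_def)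
  qed
  define f where "f x = integral (cbox 0 1) (?f x)" for x
  show ?thesis
  proof (rule that[of f])
    show "f z = 0" by (simp add: f_def)
    fix x assume x: "x \<in> ?B"
    have "continuous_on (cbox 0 1) (?f y)" if "y \<in> ?B" for y
    proof -
      have "continuous_on (cbox 0 1) (\<lambda>t. \<omega> (p y t))"
        by (rule continuous_on_compose2[OF cont_\<omega>]) (use pB[OF that] in \<open>auto simp: p_def intro!:
            continuous_intros\<close>)
      then show ?thesis by (intro continuous_intros)
    qed
    then have integrable: "?f y integrable_on cbox 0 1" if "y \<in> ?B" for y
      using that integrable_continuous by blast
    have cont: "continuous_on (?B \<times> cbox 0 1) (\<lambda>(x, t). blinfun_inner_left (w x t))"
      using bounded_linear.continuous_on[OF bounded_linear_blinfun_inner_left cont_w] by (simp add: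
          split_beta)
    have "(f has_derivative integral (cbox 0 1) (\<lambda>t. blinfun_inner_left (w x t))) (at x within ?B)"
      unfolding f_def by (rule leibniz_rule[OF fx integrable cont x convex_ball])
    moreover have "((\<lambda>t. blinfun_inner_left (w x t)) has_integral blinfun_inner_left (\<omega> x)) (cbox 0 1)"
      using has_integral_linear[OF int_w[OF x] bounded_linear_blinfun_inner_left] by (simp add: o_def)
    then have "integral (cbox 0 1) (\<lambda>t. blinfun_inner_left (w x t)) = blinfun_inner_left (\<omega> x)"
      by (rule integral_unique)
    ultimately have "(f has_derivative blinfun_apply (blinfun_inner_left (\<omega> x))) (at x within ?B)"
        by simp
    then have "(f has_derivative blinfun_apply (blinfun_inner_left (\<omega> x))) (at x)"
      by (simp add: at_within_open[OF x open_ball])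
    then show "(f has_derivative (\<lambda>v. v \<bullet> \<omega> x)) (at x)"
      by (rule has_derivative_eq_rhs) (simp add: fun_eq_iff)
  qed
qed

section \<open>Frames of Killing fields\<close>

context local_metric
begin

text \<open>The Leibniz rule for the Lie derivative along \<open>X\<close>, in which the term
  differentiating the metric vanishes.\<close>

lemma directional_metric:
  assumes "killing X" "smooth_on U Y" "smooth_on U Z" "x \<in> U"
  shows "(\<Sum>k\<in>UNIV. X x $ k * partial k (\<lambda>y. Y y \<bullet> (G y *v Z y)) x) =
    local_bracket X Y x \<bullet> (G x *v Z x) + Y x \<bullet> (G x *v local_bracket X Z x)"
proof -
  have d: "(\<lambda>y. Y y $ i) differentiable (at x)" "(\<lambda>y. Z y $ i) differentiable (at x)" "(\<lambda>y. G y $ i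
      $ j) differentiable (at x)" for i j
    using assms by (auto intro!: smooth_on_differentiable[OF _ assms(4)] smooth_on_nth open_U
        smooth_G_nth)
  have p: "partial k (\<lambda>y. Y y \<bullet> (G y *v Z y)) x = (\<Sum>i\<in>UNIV. \<Sum>j\<in>UNIV.
      partial k (\<lambda>y. Y y $ i) x * G x $ i $ j * Z x $ j + Y x $ i * partial k (\<lambda>y. G y $ i $ j) x *
          Z x $ j
      + Y x $ i * G x $ i $ j * partial k (\<lambda>y. Z y $ j) x)" for k
  proof -
    have "(\<lambda>y. Y y \<bullet> (G y *v Z y)) = (\<lambda>y. \<Sum>i\<in>UNIV. \<Sum>j\<in>UNIV. Y y $ i * (G y $ i $ j * Z y $ j))"
      by (simp add: fun_eq_iff inner_vec_def matrix_vector_mult_def sum_distrib_left)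
    then show ?thesis using d by (simp add: partial_sum partial_mult algebra_simps)
  qed
  have K: "(\<Sum>k\<in>UNIV. X x $ k * partial k (\<lambda>y. G y $ i $ j) x) = - (\<Sum>k\<in>UNIV. G x $ k $ j * partial i
      (\<lambda>y. X y $ k) x +
     G x $ i $ k * partial j (\<lambda>y. X y $ k) x)" for i j
  proof -
    have "(\<Sum>k\<in>UNIV. X x $ k * partial k (\<lambda>y. G y $ i $ j) x + G x $ k $ j * partial i (\<lambda>y. X y $ k) x +
     G x $ i $ k * partial j (\<lambda>y. X y $ k) x) = 0" using assms by (simp add: killing_def)
    then show ?thesis by (simp add: sum.distrib add_eq_0_iff2)
  qed
  have "(\<Sum>k\<in>UNIV. X x $ k * partial k (\<lambda>y. Y y \<bullet> (G y *v Z y)) x) =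
    (\<Sum>i\<in>UNIV. \<Sum>j\<in>UNIV. Y x $ i * Z x $ j * (\<Sum>k\<in>UNIV. X x $ k * partial k (\<lambda>y. G y $ i $ j) x))
    + (\<Sum>k\<in>UNIV. X x $ k * (\<Sum>i\<in>UNIV. \<Sum>j\<in>UNIV. partial k (\<lambda>y. Y y $ i) x * G x $ i $ j * Z x $ j
      + Y x $ i * G x $ i $ j * partial k (\<lambda>y. Z y $ j) x))"
    unfolding p sum_3 by (simp add: algebra_simps)
  also have "\<dots> = local_bracket X Y x \<bullet> (G x *v Z x) + Y x \<bullet> (G x *v local_bracket X Z x)"
    unfolding K by (simp add: local_bracket_def inner_vec_def matrix_vector_mult_def sum_3
        algebra_simps)
  finally show ?thesis .
qed

text \<open>Since the \<xi> i are Killing, only the terms with derivatives of the coefficients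
  survive: symmetrised products of d\<phi> i with the one-form metrically dual to \<xi> i.\<close>

lemma lie_derivative_frame:
  assumes "\<And>i. killing (\<xi> i)" "\<And>i. \<phi> i differentiable (at x)" "x \<in> U"
  defines "Y \<equiv> \<lambda>y. \<Sum>i\<in>(UNIV::3 set). \<phi> i y *\<^sub>R \<xi> i y"
  defines "L \<equiv> \<chi> i j. \<Sum>k\<in>UNIV. Y x $ k * partial k (\<lambda>y. G y $ i $ j) x +
     G x $ k $ j * partial i (\<lambda>y. Y y $ k) x + G x $ i $ k * partial j (\<lambda>y. Y y $ k) x"
  shows "v \<bullet> (L *v w) = (\<Sum>i\<in>UNIV. (\<Sum>k\<in>UNIV. v $ k * partial k (\<phi> i) x) * (\<xi> i x \<bullet> (G x *v w))
     + (\<Sum>k\<in>UNIV. w $ k * partial k (\<phi> i) x) * (\<xi> i x \<bullet> (G x *v v)))"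
proof -
  have d: "(\<lambda>y. \<xi> i y $ j) differentiable (at x)" for i j
    using assms by (auto intro!: smooth_on_differentiable[OF _ assms(3)] killing_smooth_nth)
  have pY: "partial i (\<lambda>y. Y y $ k) x = (\<Sum>m\<in>UNIV. partial i (\<phi> m) x * \<xi> m x $ k + \<phi> m x * partial i
      (\<lambda>y. \<xi> m y $ k) x)" for i k
    unfolding Y_def using d assms(2) by (simp add: partial_sum partial_mult)
  have K: "(\<Sum>k\<in>UNIV. \<xi> m x $ k * partial k (\<lambda>y. G y $ i $ j) x + G x $ k $ j * partial i (\<lambda>y. \<xi> m y
      $ k) x +
     G x $ i $ k * partial j (\<lambda>y. \<xi> m y $ k) x) = 0" for m i j
    using assms(1,3) by (simp add: killing_def)
  have Lij: "L $ i $ j = (\<Sum>m\<in>UNIV. (\<Sum>k\<in>UNIV. G x $ k $ j * \<xi> m x $ k) * partial i (\<phi> m) x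
      + (\<Sum>k\<in>UNIV. G x $ i $ k * \<xi> m x $ k) * partial j (\<phi> m) x)" for i j
  proof -
    have "L $ i $ j = (\<Sum>m\<in>UNIV. (\<Sum>k\<in>UNIV. G x $ k $ j * \<xi> m x $ k) * partial i (\<phi> m) x
      + (\<Sum>k\<in>UNIV. G x $ i $ k * \<xi> m x $ k) * partial j (\<phi> m) x)
      + (\<Sum>m\<in>UNIV. \<phi> m x * (\<Sum>k\<in>UNIV. \<xi> m x $ k * partial k (\<lambda>y. G y $ i $ j) x + G x $ k $ j *
          partial i (\<lambda>y. \<xi> m y $ k) x +
     G x $ i $ k * partial j (\<lambda>y. \<xi> m y $ k) x))"
      unfolding L_def vec_lambda_beta pY by (simp add: Y_def sum_3 algebra_simps)
    then show ?thesis by (simp only: K) simp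
  qed
  have sym: "G x $ 2 $ 1 = G x $ 1 $ 2" "G x $ 3 $ 1 = G x $ 1 $ 3" "G x $ 3 $ 2 = G x $ 2 $ 3"
      using G_sym[OF assms(3)] by blast+
  show ?thesis
    unfolding inner_vec_def matrix_vector_mult_def vec_lambda_beta Lij inner_real_def sum_3 sym by
        (simp add: algebra_simps)
qed

end

lemma local_bracket_functions:
  fixes \<xi> :: "'k::finite \<Rightarrow> real^'n::finite \<Rightarrow> real^'n"
  assumes "\<And>k i. (\<lambda>y. \<xi> k y $ i) differentiable (at x)" "\<And>k. f k differentiable (at x)" "\<And>k. h k
      differentiable (at x)"
  defines "X \<equiv> \<lambda>y. \<Sum>k\<in>UNIV. f k y *\<^sub>R \<xi> k y" and "Y \<equiv> \<lambda>y. \<Sum>k\<in>UNIV. h k y *\<^sub>R \<xi> k y"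
  shows "local_bracket X Y x = (\<Sum>k\<in>UNIV. (\<Sum>j\<in>UNIV. X x $ j * partial j (h k) x) *\<^sub>R \<xi> k x)
    - (\<Sum>k\<in>UNIV. (\<Sum>j\<in>UNIV. Y x $ j * partial j (f k) x) *\<^sub>R \<xi> k x)
    + (\<Sum>k\<in>UNIV. \<Sum>l\<in>UNIV. (f k x * h l x) *\<^sub>R local_bracket (\<xi> k) (\<xi> l) x)"
proof -
  have pX: "partial j (\<lambda>y. X y $ i) x = (\<Sum>m\<in>UNIV. partial j (f m) x * \<xi> m x $ i) + (\<Sum>m\<in>UNIV. f m x *
      partial j (\<lambda>y. \<xi> m y $ i) x)" for i j
    unfolding X_def using assms(1,2) by (simp add: partial_sum partial_mult sum.distrib)
  have pY: "partial j (\<lambda>y. Y y $ i) x = (\<Sum>m\<in>UNIV. partial j (h m) x * \<xi> m x $ i) + (\<Sum>m\<in>UNIV. h m x *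
      partial j (\<lambda>y. \<xi> m y $ i) x)" for i j
    unfolding Y_def using assms(1,3) by (simp add: partial_sum partial_mult sum.distrib)
  have swap: "(\<Sum>j\<in>UNIV. a j * (\<Sum>m\<in>UNIV. b j m * e m)) = (\<Sum>m\<in>UNIV. (\<Sum>j\<in>UNIV. a j * b j m) * e m)"
    for a :: "'n \<Rightarrow> real" and b :: "'n \<Rightarrow> 'k \<Rightarrow> real" and e
  proof -
    have "(\<Sum>j\<in>UNIV. a j * (\<Sum>m\<in>UNIV. b j m * e m)) = (\<Sum>j\<in>UNIV. \<Sum>m\<in>UNIV. a j * b j m * e m)"
      by (simp add: sum_distrib_left mult.assoc)
    also have "\<dots> = (\<Sum>m\<in>UNIV. \<Sum>j\<in>UNIV. a j * b j m * e m)" by (rule sum.swap)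
    finally show ?thesis by (simp add: sum_distrib_right)
  qed
  \<comment> \<open>Freezing the coefficients at \<open>x\<close> isolates the part of the Leibniz
    rule in which they are not differentiated.\<close>
  have "local_bracket (\<lambda>y. \<Sum>k\<in>UNIV. f k x *\<^sub>R \<xi> k y) (\<lambda>y. \<Sum>k\<in>UNIV. h k x *\<^sub>R \<xi> k y) x =
    (\<Sum>k\<in>UNIV. \<Sum>l\<in>UNIV. (f k x * h l x) *\<^sub>R local_bracket (\<xi> k) (\<xi> l) x)"
    by (rule local_bracket_comb) (use assms(1) in auto)
  then have 1: "(\<Sum>j\<in>UNIV. X x $ j * (\<Sum>m\<in>UNIV. h m x * partial j (\<lambda>y. \<xi> m y $ i) x)
      - Y x $ j * (\<Sum>m\<in>UNIV. f m x * partial j (\<lambda>y. \<xi> m y $ i) x)) =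
    (\<Sum>k\<in>UNIV. \<Sum>l\<in>UNIV. (f k x * h l x) *\<^sub>R local_bracket (\<xi> k) (\<xi> l) x) $ i" for i
    using assms(1) by (simp add: local_bracket_def[of "\<lambda>y. \<Sum>k\<in>UNIV. f k x *\<^sub>R \<xi> k y"] partial_sum
        partial_mult vec_eq_iff X_def Y_def)
  have "local_bracket X Y x $ i = (\<Sum>j\<in>UNIV. X x $ j * (\<Sum>m\<in>UNIV. partial j (h m) x * \<xi> m x $ i))
     - (\<Sum>j\<in>UNIV. Y x $ j * (\<Sum>m\<in>UNIV. partial j (f m) x * \<xi> m x $ i))
     + (\<Sum>j\<in>UNIV. X x $ j * (\<Sum>m\<in>UNIV. h m x * partial j (\<lambda>y. \<xi> m y $ i) x)
      - Y x $ j * (\<Sum>m\<in>UNIV. f m x * partial j (\<lambda>y. \<xi> m y $ i) x))" for i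
    by (simp add: local_bracket_def pX pY sum.distrib sum_subtractf algebra_simps)
  then show ?thesis unfolding 1 swap by (simp add: vec_eq_iff)
qed

lemma matrix_sandwich_zero:
  fixes B :: "real^'n::finite^'n"
  assumes "P ** B ** R = 0" "invertible P" "invertible R"
  shows "B = 0"
proof -
  have "B = (matrix_inv P ** P) ** B ** (R ** matrix_inv R)"
    using assms(2,3) by (simp add: matrix_inv_left matrix_inv_right)
  also have "\<dots> = matrix_inv P ** (P ** B ** R) ** matrix_inv R"
    by (simp only: matrix_mul_assoc)
  finally show ?thesis by (simp add: assms(1))
qed

text \<open>\<open>N\<close> is a coordinate ball of the single chart \<open>c\<close>, so closed
  forms have potentials there; the fields and their constant structure coefficients \<open>C\<close>
  are given in all charts.\<close>

locale killing_frame = riemannian_3manifold A g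
  for A :: "('m::{t2_space, second_countable_topology}, 3) chart set" and g +
  fixes N :: "'m set" and \<xi> :: "3 \<Rightarrow> ('m, 3) vfield" and C :: "3 \<Rightarrow> 3 \<Rightarrow> 3 \<Rightarrow> real"
    and c :: "('m, 3) chart" and z :: "real^3" and r :: real
  assumes c: "c \<in> A" and N: "open N" "connected N" "N \<subseteq> fst c" "coords c N = ball z r" and r: "r > 0"
    and kill: "\<And>i. killing_field_on A g N (\<xi> i)" and trans: "transitive_on A N \<xi>"
    and br: "\<And>i j. vf_eq_on A N (lie_bracket (\<xi> i) (\<xi> j)) (vf_comb (C i j) \<xi>)"
begin

lemma vf: "vector_field_on A N (\<xi> i)"
  using kill by (simp add: killing_field_on_def)

lemma open_N: "d \<in> A \<Longrightarrow> open (coords d N)"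
  by (rule open_coords[OF _ N(1)])

lemma smooth_\<xi>: "d \<in> A \<Longrightarrow> smooth_on (coords d N) (\<xi> i d)"
  using vf[of i] by (simp add: vector_field_on_def)

lemma \<xi>_differentiable: "d \<in> A \<Longrightarrow> y \<in> coords d N \<Longrightarrow> (\<lambda>y. \<xi> i d y $ k) differentiable (at y)"
  by (rule smooth_on_differentiable[OF smooth_on_nth[OF open_N smooth_\<xi>]])

lemma det_\<xi>: "d \<in> A \<Longrightarrow> y \<in> coords d N \<Longrightarrow> det (\<chi> i j. \<xi> j d y $ i) \<noteq> 0"
  using trans by (simp add: transitive_on_def span_range_iff_det[symmetric])

definition coframe :: "('m, 3) chart \<Rightarrow> 3 \<Rightarrow> 3 \<Rightarrow> real^3 \<Rightarrow> real" where
  "coframe d a i y = matrix_inv (\<chi> i j. \<xi> j d y $ i) $ a $ i"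

lemma smooth_coframe: "d \<in> A \<Longrightarrow> smooth_on (coords d N) (coframe d a i)"
  unfolding coframe_def[abs_def]
  by (rule smooth_on_matrix_inv) (auto simp: open_N det_\<xi> intro!: smooth_on_nth smooth_\<xi>)

lemma coframe_expand:
  assumes "d \<in> A" "y \<in> coords d N"
  shows "v = (\<Sum>a\<in>UNIV. (\<Sum>i\<in>UNIV. coframe d a i y * v $ i) *\<^sub>R \<xi> a d y)"
    and "(\<Sum>i\<in>UNIV. coframe d a i y * \<xi> b d y $ i) = (if a = b then 1 else 0)"
proof -
  let ?M = "\<chi> i j. \<xi> j d y $ i"
  have inv: "invertible ?M" using det_\<xi>[OF assms] invertible_det_nz by blast
  have v: "?M *v (matrix_inv ?M *v v) = v"
    by (simp add: matrix_vector_mul_assoc matrix_inv_right[OF inv])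
  have "(?M *v (matrix_inv ?M *v v)) $ i = (\<Sum>a\<in>UNIV. (\<Sum>i\<in>UNIV. coframe d a i y * v $ i) * \<xi> a d y $
      i)" for i
    by (simp add: coframe_def matrix_vector_mult_def mult.commute)
  from this[unfolded v]
  have "v $ i = (\<Sum>a\<in>UNIV. (\<Sum>i\<in>UNIV. coframe d a i y * v $ i) *\<^sub>R \<xi> a d y) $ i" for i
    unfolding sum_component vector_scaleR_component real_scaleR_def by blast
  then show "v = (\<Sum>a\<in>UNIV. (\<Sum>i\<in>UNIV. coframe d a i y * v $ i) *\<^sub>R \<xi> a d y)"
    unfolding vec_eq_iff by blast
  have "matrix_inv ?M ** ?M = mat 1" by (rule matrix_inv_left[OF inv])
  from arg_cong[OF this, of "\<lambda>M. M $ a $ b"]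
  show "(\<Sum>i\<in>UNIV. coframe d a i y * \<xi> b d y $ i) = (if a = b then 1 else 0)"
    by (simp add: coframe_def matrix_matrix_mult_def mat_def)
qed

text \<open>Smoothness of \<open>f\<close> on \<open>N\<close> together with its derivatives
  \<open>F a\<close> along the frame. Both are functions on the manifold, so identities between them
  are independent of charts.\<close>

definition fd :: "('m \<Rightarrow> real) \<Rightarrow> (3 \<Rightarrow> 'm \<Rightarrow> real) \<Rightarrow> bool" where
  "fd f F \<longleftrightarrow> (\<forall>d\<in>A. smooth_on (coords d N) (\<lambda>y. f (chart_inv d y)) \<and>
    (\<forall>y\<in>coords d N. \<forall>a. (\<Sum>k\<in>UNIV. \<xi> a d y $ k * partial k (\<lambda>y. f (chart_inv d y)) y) = F a
        (chart_inv d y)))"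

lemma fd_smooth: "fd f F \<Longrightarrow> d \<in> A \<Longrightarrow> smooth_on (coords d N) (\<lambda>y. f (chart_inv d y))"
  by (simp add: fd_def)

lemma fd_differentiable: "fd f F \<Longrightarrow> d \<in> A \<Longrightarrow> y \<in> coords d N \<Longrightarrow> (\<lambda>y. f (chart_inv d y)) differentiable
    (at y)"
  by (rule smooth_on_differentiable[OF fd_smooth])

lemma fd_derivative: "fd f F \<Longrightarrow> d \<in> A \<Longrightarrow> y \<in> coords d N \<Longrightarrow>
    (\<Sum>k\<in>UNIV. \<xi> a d y $ k * partial k (\<lambda>y. f (chart_inv d y)) y) = F a (chart_inv d y)"
  by (simp add: fd_def)

lemma chart_inv_N:
  assumes "d \<in> A" "y \<in> coords d N" shows "chart_inv d y \<in> N"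
  by (rule coordsE[OF assms])

lemma fd_cong: "fd f F \<Longrightarrow> (\<And>a q. q \<in> N \<Longrightarrow> F a q = F' a q) \<Longrightarrow> fd f F'"
  by (simp add: fd_def chart_inv_N)

lemma fd_const: "fd (\<lambda>q. k) (\<lambda>a q. 0)"
  by (simp add: fd_def open_N)

lemma fd_add:
  assumes f: "fd f F" and h: "fd h H" shows "fd (\<lambda>q. f q + h q) (\<lambda>a q. F a q + H a q)"
  unfolding fd_def[of "\<lambda>q. f q + h q"]
proof (intro ballI conjI allI)
  fix d assume d: "d \<in> A"
  show "smooth_on (coords d N) (\<lambda>y. f (chart_inv d y) + h (chart_inv d y))"
    by (rule smooth_on_add[OF open_N[OF d] fd_smooth[OF f d] fd_smooth[OF h d]])
  fix y a assume y: "y \<in> coords d N"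
  show "(\<Sum>k\<in>UNIV. \<xi> a d y $ k * partial k (\<lambda>y. f (chart_inv d y) + h (chart_inv d y)) y) =
      F a (chart_inv d y) + H a (chart_inv d y)"
    unfolding fd_derivative[OF f d y, symmetric] fd_derivative[OF h d y, symmetric]
      partial_add[OF fd_differentiable[OF f d y] fd_differentiable[OF h d y]]
    by (simp add: sum_3 algebra_simps)
qed

lemma fd_mult:
  assumes f: "fd f F" and h: "fd h H" shows "fd (\<lambda>q. f q * h q) (\<lambda>a q. F a q * h q + f q * H a q)"
  unfolding fd_def[of "\<lambda>q. f q * h q"]
proof (intro ballI conjI allI)
  fix d assume d: "d \<in> A"
  show "smooth_on (coords d N) (\<lambda>y. f (chart_inv d y) * h (chart_inv d y))"
    by (rule smooth_on_mult[OF open_N[OF d] fd_smooth[OF f d] fd_smooth[OF h d]])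
  fix y a assume y: "y \<in> coords d N"
  show "(\<Sum>k\<in>UNIV. \<xi> a d y $ k * partial k (\<lambda>y. f (chart_inv d y) * h (chart_inv d y)) y) =
      F a (chart_inv d y) * h (chart_inv d y) + f (chart_inv d y) * H a (chart_inv d y)"
    unfolding fd_derivative[OF f d y, symmetric] fd_derivative[OF h d y, symmetric]
      partial_mult[OF fd_differentiable[OF f d y] fd_differentiable[OF h d y]]
    by (simp add: sum_3 algebra_simps)
qed

text \<open>The system \<open>\<xi> a f = F a\<close> expresses the partial derivatives of \<open>f\<close> by the \<open>F a\<close>, so that
  regularity of \<open>F\<close> is passed on to \<open>f\<close>. Differentiability and the equations have to be checked
  in one chart only.\<close>

lemma fdI:
  assumes diff: "\<And>x. x \<in> ball z r \<Longrightarrow> (\<lambda>y. f (chart_inv c y)) differentiable (at x)"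
    and der: "\<And>x a. x \<in> ball z r \<Longrightarrow> (\<Sum>k\<in>UNIV. \<xi> a c x $ k * partial k (\<lambda>y. f (chart_inv c y)) x) = F
        a (chart_inv c x)"
    and boot: "\<And>d k a. d \<in> A \<Longrightarrow> Ck_on k (coords d N) (\<lambda>y. f (chart_inv d y)) \<Longrightarrow> Ck_on k (coords d N)
        (\<lambda>y. F a (chart_inv d y))"
  shows "fd f F"
  unfolding fd_def
proof
  fix d assume d: "d \<in> A"
  let ?f = "\<lambda>y. f (chart_inv d y)" and ?fc = "\<lambda>x. f (chart_inv c x)"
  \<comment> \<open>The transition map carries differentiability and the frame equations from
    \<open>c\<close> to \<open>d\<close>, its Jacobian taking the frame in \<open>d\<close> to that
    in \<open>c\<close>.\<close>
  have tr: "?f differentiable (at y) \<and> (\<forall>a. frechet_derivative ?f (at y) (\<xi> a d y) = F a (chart_inv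
      d y))"
    if y: "y \<in> coords d N" for y
  proof -
    have y': "y \<in> coords d (fst c \<inter> N)" "y \<in> coords d (fst c)"
      using y N(3) by (auto simp: coords_def)
    let ?x = "transition d c y"
    note tr = transition[OF d c y'(1)]
    have x: "?x \<in> ball z r" using tr(2) N(4) coords_mono[of "fst d \<inter> N" N c] by blast
    let ?D = "frechet_derivative ?fc (at ?x)"
    have D: "(?fc has_derivative ?D) (at ?x)" by (rule frechet_derivative_works_at[OF diff[OF x]])
    have "((\<lambda>y. ?fc (transition d c y)) has_derivative (\<lambda>v. ?D (jacobian d c y *v v))) (at y)"
      by (rule has_derivative_compose[OF transition_has_derivative[OF d c y'(2)] D])
    then have fder: "(?f has_derivative (\<lambda>v. ?D (jacobian d c y *v v))) (at y)"
    proof (rule has_derivative_transform_within_open[OF _ open_N[OF d] y])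
      fix w assume "w \<in> coords d N"
      then have "w \<in> coords d (fst c \<inter> N)" using N(3) by (auto simp: coords_def)
      then show "?fc (transition d c w) = ?f w" using transition(3)[OF d c] by simp
    qed
    have "?D (jacobian d c y *v \<xi> a d y) = F a (chart_inv d y)" for a
    proof -
      have "jacobian d c y *v \<xi> a d y = \<xi> a c ?x"
        using vector_field_transform[OF vf d c y'(1)] by simp
      then show ?thesis
        using der[OF x, of a] frechet_derivative_partial[OF diff[OF x]] tr(3) by simp
    qed
    then show ?thesis using fder by (auto simp: differentiable_def frechet_derivative_eqI)
  qed
  \<comment> \<open>The frame equations determine the whole derivative with smooth coefficients, so
    order k of \<open>f\<close>, hence of \<open>F\<close> by \<open>boot\<close>, gives order k +
    1.\<close>
  have Dv: "frechet_derivative ?f (at y) v = (\<Sum>a\<in>UNIV. (\<Sum>i\<in>UNIV. coframe d a i y * v $ i) * F a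
      (chart_inv d y))"
    if "y \<in> coords d N" for y v
  proof -
    have lin: "linear (frechet_derivative ?f (at y))" using tr[OF that] by (simp add:
        linear_frechet_derivative)
    have "frechet_derivative ?f (at y) v = frechet_derivative ?f (at y) (\<Sum>a\<in>UNIV. (\<Sum>i\<in>UNIV. coframe
        d a i y * v $ i) *\<^sub>R \<xi> a d y)"
      using coframe_expand(1)[OF d that, of v] by simp
    then show ?thesis using tr[OF that] by (simp add: linear_sum[OF lin] linear_scale[OF lin])
  qed
  have "Ck_on k (coords d N) ?f" for k
  proof (induction k)
    case 0
    show ?case using tr by (auto intro!: continuous_at_imp_continuous_on
        differentiable_imp_continuous_within)
  next
    case (Suc k)
    have sm: "smooth_on (coords d N) (\<lambda>y. \<Sum>i\<in>UNIV. coframe d a i y * v $ i)" for a v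
      using d by (intro smooth_on_sum smooth_on_mult open_N smooth_coframe) (auto simp: open_N)
    have "Ck_on k (coords d N) (\<lambda>y. (\<Sum>i\<in>UNIV. coframe d 1 i y * v $ i) *\<^sub>R F 1 (chart_inv d y)
       + (\<Sum>i\<in>UNIV. coframe d 2 i y * v $ i) *\<^sub>R F 2 (chart_inv d y) + (\<Sum>i\<in>UNIV. coframe d 3 i y * v
           $ i) *\<^sub>R F 3 (chart_inv d y))" for v
      using sm boot[OF d Suc] unfolding smooth_on_def
      by (intro Ck_on_add Ck_on_scaleR open_N[OF d]) auto
    then have "Ck_on k (coords d N) (\<lambda>y. frechet_derivative ?f (at y) v)" for v
      by (rule Ck_on_cong[OF open_N[OF d], rotated]) (simp add: Dv sum_3)
    then show ?case using tr by simp
  qed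
  then have "smooth_on (coords d N) ?f" by (simp add: smooth_on_def)
  moreover have "(\<Sum>k\<in>UNIV. \<xi> a d y $ k * partial k ?f y) = F a (chart_inv d y)" if "y \<in> coords d N"
      for y a
    using tr[OF that] frechet_derivative_partial by metis
  ultimately show "smooth_on (coords d N) ?f \<and> (\<forall>y\<in>coords d N. \<forall>a. (\<Sum>k\<in>UNIV. \<xi> a d y $ k * partial k
      ?f y) = F a (chart_inv d y))"
    by blast
qed

lemma ball_N: "x \<in> ball z r \<Longrightarrow> chart_inv c x \<in> N" "x \<in> ball z r \<Longrightarrow> snd c (chart_inv c x) = x"
  using N(4) by (auto elim: coordsE[OF c])

text \<open>For the one-form with values \<open>F a\<close> on the frame, \<open>closed\<close> is
  the vanishing of d\<omega>(X, Y) = X(\<omega>(Y)) - Y(\<omega>(X)) - \<omega>([X, Y]) on pairs of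
  frame fields.\<close>

lemma fd_potential:
  assumes F: "\<And>b. fd (F b) (dF b)"
    and closed: "\<And>a b q. q \<in> N \<Longrightarrow> dF b a q - dF a b q = (\<Sum>k\<in>UNIV. C a b k * F k q)"
  obtains f where "fd f F" "f (chart_inv c z) = 0"
proof -
  define \<omega> where "\<omega> x = (\<chi> i. \<Sum>a\<in>UNIV. coframe c a i x * F a (chart_inv c x))" for x
  have sm: "smooth_on (ball z r) \<omega>"
    unfolding \<omega>_def using smooth_coframe[OF c] fd_smooth[OF F c] N(4)
    by (intro smooth_on_vec) (auto intro!: smooth_on_sum smooth_on_mult)
  have \<omega>F: "(\<Sum>i\<in>UNIV. \<xi> a c x $ i * \<omega> x $ i) = F a (chart_inv c x)" if "x \<in> ball z r" for a x
  proof -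
    have "(\<Sum>i\<in>UNIV. \<xi> a c x $ i * \<omega> x $ i) = (\<Sum>b\<in>UNIV. (\<Sum>i\<in>UNIV. coframe c b i x * \<xi> a c x $ i) * F
        b (chart_inv c x))"
      by (simp add: \<omega>_def sum_3 algebra_simps)
    also have "\<dots> = F a (chart_inv c x)"
      using coframe_expand(2)[OF c, of x] that N(4) by (simp add: if_distrib[of "\<lambda>a. a * _"] cong:
          if_cong)
    finally show ?thesis .
  qed
  have cl: "partial j (\<lambda>y. \<omega> y $ i) x = partial i (\<lambda>y. \<omega> y $ j) x" if x: "x \<in> ball z r" for x i j
  proof -
    have xN: "x \<in> coords c N" using x N(4) by simp
    define \<beta> where "\<beta> i j = partial i (\<lambda>y. \<omega> y $ j) x - partial j (\<lambda>y. \<omega> y $ i) x" for i j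
    have d\<omega>: "(\<lambda>y. \<omega> y $ i) differentiable (at x)" for i
      by (rule smooth_on_differentiable[OF smooth_on_nth[OF open_ball sm] x])
    note d\<xi> = \<xi>_differentiable[OF c xN]
    have dF': "partial j (\<lambda>y. F b (chart_inv c y)) x = (\<Sum>i\<in>UNIV. partial j (\<lambda>y. \<xi> b c y $ i) x * \<omega> x
        $ i + \<xi> b c x $ i * partial j (\<lambda>y. \<omega> y $ i) x)" for b j
    proof -
      have "partial j (\<lambda>y. F b (chart_inv c y)) x = partial j (\<lambda>y. \<Sum>i\<in>UNIV. \<xi> b c y $ i * \<omega> y $ i) x"
        by (rule partial_cong[OF open_ball x]) (simp add: \<omega>F)
      then show ?thesis using d\<omega> d\<xi> by (simp add: partial_sum partial_mult)
    qed
    have "(\<Sum>i\<in>UNIV. \<Sum>j\<in>UNIV. \<xi> a c x $ j * \<xi> b c x $ i * \<beta> j i) = 0" for a b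
    proof -
      have "dF b a (chart_inv c x) - dF a b (chart_inv c x) =
        (\<Sum>j\<in>UNIV. \<xi> a c x $ j * partial j (\<lambda>y. F b (chart_inv c y)) x) - (\<Sum>j\<in>UNIV. \<xi> b c x $ j *
            partial j (\<lambda>y. F a (chart_inv c y)) x)"
        using fd_derivative[OF F c xN] by simp
      also have "\<dots> = (\<Sum>i\<in>UNIV. lie_bracket (\<xi> a) (\<xi> b) c x $ i * \<omega> x $ i) + (\<Sum>i\<in>UNIV. \<Sum>j\<in>UNIV. \<xi> a c
          x $ j * \<xi> b c x $ i * \<beta> j i)"
        unfolding dF' \<beta>_def by (simp add: lie_bracket_def sum_3 algebra_simps)
      also have "(\<Sum>i\<in>UNIV. lie_bracket (\<xi> a) (\<xi> b) c x $ i * \<omega> x $ i) = (\<Sum>k\<in>UNIV. C a b k * F k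
          (chart_inv c x))"
      proof -
        have "lie_bracket (\<xi> a) (\<xi> b) c x = vf_comb (C a b) \<xi> c x" using br[of a b] c xN by (simp
            add: vf_eq_on_def)
        then have "(\<Sum>i\<in>UNIV. lie_bracket (\<xi> a) (\<xi> b) c x $ i * \<omega> x $ i) = (\<Sum>k\<in>UNIV. C a b k *
            (\<Sum>i\<in>UNIV. \<xi> k c x $ i * \<omega> x $ i))"
          by (simp add: vf_comb_def sum_3 algebra_simps)
        then show ?thesis by (simp add: \<omega>F[OF x])
      qed
      finally show ?thesis using closed[OF ball_N(1)[OF x], of b a] by simp
    qed
    \<comment> \<open>The components of d\<omega> vanish on all pairs of frame vectors; the frame
      matrix is invertible.\<close>
    then have "transpose (\<chi> i j. \<xi> j c x $ i) ** (\<chi> i j. \<beta> i j) ** (\<chi> i j. \<xi> j c x $ i) = 0"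
      by (simp add: mat3_simps algebra_simps)
    moreover have "invertible (\<chi> i j. \<xi> j c x $ i)" using det_\<xi>[OF c xN] invertible_det_nz by blast
    ultimately have "(\<chi> i j. \<beta> i j) = 0"
      by (intro matrix_sandwich_zero[of "transpose (\<chi> i j. \<xi> j c x $ i)"]) (auto simp:
          transpose_invertible)
    then have "\<beta> i j = 0" for i j by (metis vec_lambda_beta zero_index)
    then show ?thesis by (simp add: \<beta>_def)
  qed
  obtain f0 where f0: "\<And>x. x \<in> ball z r \<Longrightarrow> (f0 has_derivative (\<lambda>v. v \<bullet> \<omega> x)) (at x)" "f0 z = 0"
    using poincare_ball[OF sm cl] by blast
  let ?f = "\<lambda>q. f0 (snd c q)"
  have der: "((\<lambda>x. ?f (chart_inv c x)) has_derivative (\<lambda>v. v \<bullet> \<omega> x)) (at x)" if "x \<in> ball z r" for x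
    by (rule has_derivative_transform_within_open[OF f0(1)[OF that] open_ball that]) (simp add: ball_N)
  have "fd ?f F"
  proof (rule fdI)
    fix x assume x: "x \<in> ball z r"
    then show d: "(\<lambda>y. ?f (chart_inv c y)) differentiable (at x)" using der by (auto simp:
        differentiable_def)
    show "(\<Sum>k\<in>UNIV. \<xi> a c x $ k * partial k (\<lambda>y. ?f (chart_inv c y)) x) = F a (chart_inv c x)" for a
      using frechet_derivative_partial[OF d, of "\<xi> a c x"] frechet_derivative_eqI[OF der[OF x]]
          \<omega>F[OF x, of a]
      by (simp add: inner_vec_def)
  next
    fix d k a assume "d \<in> A"
    then show "Ck_on k (coords d N) (\<lambda>y. F a (chart_inv d y))" using fd_smooth[OF F] by (simp add:
        smooth_on_def)
  qed
  moreover have "?f (chart_inv c z) = 0" using r f0(2) by (simp add: ball_N)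
  ultimately show ?thesis using that by blast
qed

lemma fd_constant:
  assumes "fd f F" "\<And>a q. q \<in> N \<Longrightarrow> F a q = 0" "q \<in> N"
  shows "f q = f (chart_inv c z)"
proof -
  let ?f = "\<lambda>y. f (chart_inv c y)"
  have "(?f has_derivative (\<lambda>h. 0)) (at x within ball z r)" if x: "x \<in> ball z r" for x
  proof -
    have xN: "x \<in> coords c N" using x N(4) by simp
    note d = fd_differentiable[OF assms(1) c xN]
    have lin: "linear (frechet_derivative ?f (at x))" using d by (simp add: linear_frechet_derivative)
    have "frechet_derivative ?f (at x) (\<xi> a c x) = 0" for a
      using fd_derivative[OF assms(1) c xN, of a] frechet_derivative_partial[OF d] assms(2)[OF
          ball_N(1)[OF x]] by simp
    then have "frechet_derivative ?f (at x) v = 0" for v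
      by (subst coframe_expand(1)[OF c xN, of v]) (simp add: linear_sum[OF lin] linear_scale[OF lin])
    then have "frechet_derivative ?f (at x) = (\<lambda>h. 0)" by (simp add: fun_eq_iff)
    then show ?thesis using frechet_derivative_works_at[OF d] by (simp add: has_derivative_at_withinI)
  qed
  from has_derivative_zero_constant[OF convex_ball this]
  obtain k where k: "\<And>x. x \<in> ball z r \<Longrightarrow> ?f x = k" by blast
  have "snd c q \<in> ball z r" "chart_inv c (snd c q) = q"
    using assms(3) N(3,4) coordsI[of q c N] chart_inv_snd[OF c, of q] by auto
  then show ?thesis using k[of "snd c q"] k[of z] r by simp
qed

text \<open>The metric in the frame, as functions on the manifold; \<open>gram_chart\<close> shows
  that every chart computes the same values.\<close>

definition gram :: "3 \<Rightarrow> 3 \<Rightarrow> 'm \<Rightarrow> real" where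
  "gram a b q = \<xi> a c (snd c q) \<bullet> (g c (snd c q) *v \<xi> b c (snd c q))"

lemma gram_chart:
  assumes "d \<in> A" "y \<in> coords d N"
  shows "gram a b (chart_inv d y) = \<xi> a d y \<bullet> (g d y *v \<xi> b d y)"
proof -
  have y: "y \<in> coords d (fst c \<inter> N)" "y \<in> coords d (fst c)" using assms(2) N(3) by (auto simp:
      coords_def)
  show ?thesis
    using metric_transform[OF assms(1) c y(2)] vector_field_transform[OF vf assms(1) c y(1)]
        transition(1)[OF assms(1) c y(1)]
    by (simp add: gram_def)
qed

text \<open>By \<open>directional_metric\<close>, differentiation along a Killing frame acts only
  through brackets. The Gram functions thus obey a linear system with constant coefficients.\<close>

lemma fd_gram: "fd (gram a b) (\<lambda>e q. \<Sum>k\<in>UNIV. C e a k * gram k b q + C e b k * gram a k q)"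
  unfolding fd_def
proof (intro ballI conjI allI)
  fix d assume d: "d \<in> A"
  interpret l: local_metric "coords d N" "g d" by (rule local_metric[OF d N(1)])
  have sm: "smooth_on (coords d N) (\<lambda>y. \<xi> a d y \<bullet> (g d y *v \<xi> b d y))"
    unfolding inner_vec_def matrix_vector_mult_def
    by (auto intro!: smooth_on_sum smooth_on_mult open_N[OF d] smooth_on_nth smooth_\<xi>[OF d] l.smooth_G)
  then show "smooth_on (coords d N) (\<lambda>y. gram a b (chart_inv d y))"
    by (rule smooth_on_cong[OF open_N[OF d], rotated]) (simp add: gram_chart d)
  fix y e assume y: "y \<in> coords d N"
  have "(\<Sum>k\<in>UNIV. \<xi> e d y $ k * partial k (\<lambda>y. gram a b (chart_inv d y)) y) =
     (\<Sum>k\<in>UNIV. \<xi> e d y $ k * partial k (\<lambda>y. \<xi> a d y \<bullet> (g d y *v \<xi> b d y)) y)"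
    using partial_cong[OF open_N[OF d] y, of "\<lambda>y. gram a b (chart_inv d y)" "\<lambda>y. \<xi> a d y \<bullet> (g d y *v
        \<xi> b d y)"]
    by (simp add: gram_chart d)
  also have "\<dots> = lie_bracket (\<xi> e) (\<xi> a) d y \<bullet> (g d y *v \<xi> b d y) + \<xi> a d y \<bullet> (g d y *v lie_bracket
      (\<xi> e) (\<xi> b) d y)"
    unfolding lie_bracket_local
    by (rule l.directional_metric[OF killing_field_on_local[OF d N(1) kill] smooth_\<xi>[OF d]
        smooth_\<xi>[OF d] y])
  also have "\<dots> = (\<Sum>k\<in>UNIV. C e a k * gram k b (chart_inv d y) + C e b k * gram a k (chart_inv d y))"
    using br[of e a] br[of e b] d y
    by (simp add: vf_eq_on_def vf_comb_def gram_chart inner_sum_left inner_sum_right linear_sum[OF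
        matrix_vector_mul_linear]
      linear_scale[OF matrix_vector_mul_linear] sum.distrib)
  finally show "(\<Sum>k\<in>UNIV. \<xi> e d y $ k * partial k (\<lambda>y. gram a b (chart_inv d y)) y) =
     (\<Sum>k\<in>UNIV. C e a k * gram k b (chart_inv d y) + C e b k * gram a k (chart_inv d y))" .
qed

lemma gram_sym: "q \<in> N \<Longrightarrow> gram a b q = gram b a q"
proof -
  assume q: "q \<in> N"
  interpret l: local_metric "coords c N" "g c" by (rule local_metric[OF c N(1)])
  have "snd c q \<in> coords c N" using q N(3) by (intro coordsI) auto
  from l.transpose_G[OF this] show ?thesis
    unfolding gram_def by (metis dot_lmul_matrix inner_commute transpose_matrix_vector)
qed

definition field_of :: "(3 \<Rightarrow> 'm \<Rightarrow> real) \<Rightarrow> ('m, 3) vfield" where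
  "field_of \<phi> d y = (\<Sum>i\<in>UNIV. \<phi> i (chart_inv d y) *\<^sub>R \<xi> i d y)"

lemma field_of_zero:
  assumes "d \<in> A" "y \<in> coords d N" "field_of \<phi> d y = 0"
  shows "\<phi> i (chart_inv d y) = 0"
proof -
  have "\<phi> i (chart_inv d y) = (\<Sum>j\<in>UNIV. \<phi> j (chart_inv d y) * (\<Sum>k\<in>UNIV. coframe d i k y * \<xi> j d y $ k))"
    by (simp add: coframe_expand(2)[OF assms(1,2)] if_distrib[of "\<lambda>a. _ * a"] cong: if_cong)
  also have "\<dots> = (\<Sum>k\<in>UNIV. coframe d i k y * field_of \<phi> d y $ k)"
    by (simp add: field_of_def sum_3 algebra_simps)
  finally show ?thesis using assms(3) by simp
qed

text \<open>\<open>lie_derivative_frame\<close> reduces the Killing equation to the derivatives of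
  the coefficients; as the frame spans, testing it on pairs of frame vectors suffices.\<close>

lemma field_of_killing:
  assumes fd: "\<And>i. fd (\<phi> i) (d\<phi> i)"
    and eq: "\<And>q a b. q \<in> N \<Longrightarrow> (\<Sum>i\<in>UNIV. d\<phi> i a q * gram i b q + d\<phi> i b q * gram i a q) = 0"
  shows "killing_field_on A g N (field_of \<phi>)"
  unfolding killing_field_on_def vector_field_on_def
proof (intro conjI ballI)
  fix d assume d: "d \<in> A"
  show "smooth_on (coords d N) (field_of \<phi> d)"
    unfolding field_of_def[abs_def] by (intro smooth_on_sum smooth_on_scaleR open_N[OF d]
        fd_smooth[OF fd d] smooth_\<xi>[OF d])
  {
    fix e y assume e: "e \<in> A" "y \<in> coords d (fst e \<inter> N)"
    show "field_of \<phi> e (transition d e y) = jacobian d e y *v field_of \<phi> d y"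
      using vector_field_transform[OF vf d e(1) e(2)] transition(3)[OF d e]
      by (simp add: field_of_def linear_sum[OF matrix_vector_mul_linear] linear_scale[OF
          matrix_vector_mul_linear])
  }
  fix y assume y: "y \<in> coords d N"
  interpret l: local_metric "coords d N" "g d" by (rule local_metric[OF d N(1)])
  let ?L = "lie_derivative_metric (field_of \<phi>) g d y"
  have q: "chart_inv d y \<in> N" using y by (auto elim: coordsE[OF d])
  have Lvw: "v \<bullet> (?L *v w) = (\<Sum>i\<in>UNIV. (\<Sum>k\<in>UNIV. v $ k * partial k (\<lambda>y. \<phi> i (chart_inv d y)) y) * (\<xi>
      i d y \<bullet> (g d y *v w))
     + (\<Sum>k\<in>UNIV. w $ k * partial k (\<lambda>y. \<phi> i (chart_inv d y)) y) * (\<xi> i d y \<bullet> (g d y *v v)))" for v w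
    using l.lie_derivative_frame[where \<xi> = "\<lambda>i. \<xi> i d" and \<phi> = "\<lambda>i y. \<phi> i (chart_inv d y)" and v = v
        and w = w,
        OF killing_field_on_local[OF d N(1) kill] fd_differentiable[OF fd d y] y]
    by (simp add: lie_derivative_metric_def field_of_def)
  have "\<xi> a d y \<bullet> (?L *v \<xi> b d y) = 0" for a b
    unfolding Lvw fd_derivative[OF fd d y] gram_chart[OF d y, symmetric] by (rule eq[OF q])
  then have 1: "v \<bullet> (?L *v \<xi> b d y) = 0" for v b
    by (subst coframe_expand(1)[OF d y, of v]) (simp add: inner_sum_left)
  have "v \<bullet> (?L *v w) = 0" for v w
    by (subst coframe_expand(1)[OF d y, of w])
      (simp add: linear_sum[OF matrix_vector_mul_linear] linear_scale[OF matrix_vector_mul_linear]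
          inner_sum_right 1)
  then have "?L *v w = 0" for w by (metis inner_eq_zero_iff)
  then show "?L = 0" by (metis matrix_eq matrix_vector_mult_0)
qed

lemma field_of_bracket:
  assumes f: "\<And>i. fd (f i) (df i)" and h: "\<And>i. fd (h i) (dh i)" and d: "d \<in> A" "y \<in> coords d N"
  shows "lie_bracket (field_of f) (field_of h) d y = field_of (\<lambda>m q. (\<Sum>a\<in>UNIV. f a q * dh m a q - h
      a q * df m a q)
     + (\<Sum>i\<in>UNIV. \<Sum>j\<in>UNIV. f i q * h j q * C i j m)) d y"
proof -
  let ?q = "chart_inv d y"
  have along: "(\<Sum>j\<in>UNIV. field_of u d y $ j * partial j (\<lambda>y. w k (chart_inv d y)) y) = (\<Sum>a\<in>UNIV. u a
      ?q * dw k a ?q)"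
    if w: "\<And>i. fd (w i) (dw i)" for u w dw k
  proof -
    have "(\<Sum>j\<in>UNIV. field_of u d y $ j * partial j (\<lambda>y. w k (chart_inv d y)) y) =
      (\<Sum>a\<in>UNIV. u a ?q * (\<Sum>j\<in>UNIV. \<xi> a d y $ j * partial j (\<lambda>y. w k (chart_inv d y)) y))"
      by (simp add: field_of_def sum_3 algebra_simps)
    then show ?thesis by (simp add: fd_derivative[OF w d])
  qed
  have br': "local_bracket (\<xi> i d) (\<xi> j d) y = (\<Sum>m\<in>UNIV. C i j m *\<^sub>R \<xi> m d y)" for i j
    using br[of i j] d by (simp add: vf_eq_on_def lie_bracket_local vf_comb_def)
  have fo: "field_of \<phi> d = (\<lambda>y. \<Sum>k\<in>UNIV. \<phi> k (chart_inv d y) *\<^sub>R \<xi> k d y)" for \<phi>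
    by (simp add: field_of_def fun_eq_iff)
  have "lie_bracket (field_of f) (field_of h) d y =
     (\<Sum>k\<in>UNIV. (\<Sum>j\<in>UNIV. field_of f d y $ j * partial j (\<lambda>y. h k (chart_inv d y)) y) *\<^sub>R \<xi> k d y)
    - (\<Sum>k\<in>UNIV. (\<Sum>j\<in>UNIV. field_of h d y $ j * partial j (\<lambda>y. f k (chart_inv d y)) y) *\<^sub>R \<xi> k d y)
    + (\<Sum>k\<in>UNIV. \<Sum>l\<in>UNIV. (f k ?q * h l ?q) *\<^sub>R local_bracket (\<xi> k d) (\<xi> l d) y)"
    unfolding lie_bracket_local fo
    by (rule local_bracket_functions[OF \<xi>_differentiable[OF d] fd_differentiable[OF f d]
        fd_differentiable[OF h d]])
  also have "\<dots> = (\<Sum>k\<in>UNIV. (\<Sum>a\<in>UNIV. f a ?q * dh k a ?q) *\<^sub>R \<xi> k d y) - (\<Sum>k\<in>UNIV. (\<Sum>a\<in>UNIV. h a ?q *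
      df k a ?q) *\<^sub>R \<xi> k d y)
    + (\<Sum>k\<in>UNIV. \<Sum>l\<in>UNIV. (f k ?q * h l ?q) *\<^sub>R (\<Sum>m\<in>UNIV. C k l m *\<^sub>R \<xi> m d y))"
    by (simp only: along[of f df, OF f] along[of h dh, OF h] br')
  also have "\<dots> = field_of (\<lambda>m q. (\<Sum>a\<in>UNIV. f a q * dh m a q - h a q * df m a q)
     + (\<Sum>i\<in>UNIV. \<Sum>j\<in>UNIV. f i q * h j q * C i j m)) d y"
    by (simp add: field_of_def sum_3 vec_eq_iff algebra_simps)
  finally show ?thesis .
qed

text \<open>Killing equation, closure under brackets and independence all become identities between
  coefficient functions on \<open>N\<close>, which can be checked by case distinction over the
  indices.\<close>

lemma killing_algebra_of_functions:
  fixes \<phi> :: "'k::finite \<Rightarrow> 3 \<Rightarrow> 'm \<Rightarrow> real"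
  assumes fd: "\<And>k i. fd (\<phi> k i) (d\<phi> k i)"
    and killing: "\<And>k q a b. q \<in> N \<Longrightarrow> (\<Sum>i\<in>UNIV. d\<phi> k i a q * gram i b q + d\<phi> k i b q * gram i a q) = 0"
    and closed: "\<And>k l. \<exists>\<alpha>. \<forall>q\<in>N. \<forall>m. (\<Sum>a\<in>UNIV. \<phi> k a q * d\<phi> l m a q - \<phi> l a q * d\<phi> k m a q)
     + (\<Sum>i\<in>UNIV. \<Sum>j\<in>UNIV. \<phi> k i q * \<phi> l j q * C i j m) = (\<Sum>n\<in>UNIV. \<alpha> n * \<phi> n m q)"
    and indep: "\<And>\<alpha>. (\<And>q m. q \<in> N \<Longrightarrow> (\<Sum>n\<in>UNIV. \<alpha> n * \<phi> n m q) = 0) \<Longrightarrow> \<forall>n. \<alpha> n = 0"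
  shows "killing_algebra_basis A g N (\<lambda>k. field_of (\<phi> k))"
proof -
  have comb: "vf_comb \<alpha> (\<lambda>k. field_of (\<phi> k)) = field_of (\<lambda>m q. \<Sum>n\<in>UNIV. \<alpha> n * \<phi> n m q)" for \<alpha>
  proof (intro ext)
    fix d y
    have "vf_comb \<alpha> (\<lambda>k. field_of (\<phi> k)) d y = (\<Sum>m\<in>UNIV. \<Sum>n\<in>UNIV. (\<alpha> n * \<phi> n m (chart_inv d y)) *\<^sub>R
        \<xi> m d y)"
      unfolding vf_comb_def field_of_def by (subst sum.swap) (simp add: scaleR_sum_right)
    then show "vf_comb \<alpha> (\<lambda>k. field_of (\<phi> k)) d y = field_of (\<lambda>m q. \<Sum>n\<in>UNIV. \<alpha> n * \<phi> n m q) d y"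
      by (simp add: field_of_def scaleR_sum_left)
  qed
  have "\<forall>n. \<alpha> n = 0" if "vf_eq_on A N (vf_comb \<alpha> (\<lambda>k. field_of (\<phi> k))) vf_zero" for \<alpha>
  proof (rule indep)
    fix q m assume q: "q \<in> N"
    have y: "snd c q \<in> coords c N" "chart_inv c (snd c q) = q" using q N(3) by (auto intro: coordsI
        chart_inv_snd[OF c])
    have "field_of (\<lambda>m q. \<Sum>n\<in>UNIV. \<alpha> n * \<phi> n m q) c (snd c q) = 0"
      using that c y by (simp add: comb vf_eq_on_def)
    from field_of_zero[OF c y(1) this, of m] show "(\<Sum>n\<in>UNIV. \<alpha> n * \<phi> n m q) = 0" by (simp add: y(2))
  qed
  moreover have "\<exists>\<alpha>. vf_eq_on A N (lie_bracket (field_of (\<phi> k)) (field_of (\<phi> l))) (vf_comb \<alpha> (\<lambda>k.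
      field_of (\<phi> k)))" for k l
  proof -
    obtain \<alpha> where *: "\<forall>q\<in>N. \<forall>m. (\<Sum>a\<in>UNIV. \<phi> k a q * d\<phi> l m a q - \<phi> l a q * d\<phi> k m a q)
     + (\<Sum>i\<in>UNIV. \<Sum>j\<in>UNIV. \<phi> k i q * \<phi> l j q * C i j m) = (\<Sum>n\<in>UNIV. \<alpha> n * \<phi> n m q)"
      using closed[of k l] by blast
    have "lie_bracket (field_of (\<phi> k)) (field_of (\<phi> l)) d y = vf_comb \<alpha> (\<lambda>k. field_of (\<phi> k)) d y"
      if "d \<in> A" "y \<in> coords d N" for d y
    proof -
      have "chart_inv d y \<in> N" using coordsE[OF that] by blast
      with * show ?thesis unfolding comb field_of_bracket[OF fd fd that] field_of_def by (simp only:)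
    qed
    then show ?thesis by (auto simp: vf_eq_on_def)
  qed
  ultimately show ?thesis
    unfolding killing_algebra_basis_def
    using N(1,2) field_of_killing[OF fd killing] by blast
qed

end

section \<open>Simply transitive algebras of types I and V\<close>

lemma exhaust_6: "x = 1 \<or> x = 2 \<or> x = 3 \<or> x = 4 \<or> x = 5 \<or> x = 6" for x :: 6
proof (induct x)
  case (of_int z)
  then have "0 \<le> z" and "z < 6" by simp_all
  then have "z = 0 \<or> z = 1 \<or> z = 2 \<or> z = 3 \<or> z = 4 \<or> z = 5" by arith
  then show ?case by auto
qed

lemma forall_6: "(\<forall>i::6. P i) \<longleftrightarrow> P 1 \<and> P 2 \<and> P 3 \<and> P 4 \<and> P 5 \<and> P 6"
  by (metis exhaust_6)

lemma sum_6: "sum f (UNIV::6 set) = f 1 + f 2 + f 3 + f 4 + f 5 + f 6"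
proof -
  have *: "(UNIV::6 set) = {1, 2, 3, 4, 5, 6}" using exhaust_6 by auto
  show ?thesis unfolding * by (simp add: ac_simps)
qed

definition hexa :: "'a \<Rightarrow> 'a \<Rightarrow> 'a \<Rightarrow> 'a \<Rightarrow> 'a \<Rightarrow> 'a \<Rightarrow> 6 \<Rightarrow> 'a" where
  "hexa a b c d e f i = (if i = 1 then a else if i = 2 then b else if i = 3 then c else if i = 4
      then d else if i = 5 then e else f)"

lemma hexa_simps [simp]:
  "hexa a b c d e f 1 = a" "hexa a b c d e f 2 = b" "hexa a b c d e f 3 = c"
  "hexa a b c d e f 4 = d" "hexa a b c d e f 5 = e" "hexa a b c d e f 6 = f"
  by (simp_all add: hexa_def)

text \<open>The trilinear form \<open>cross3 (a i) (s j) \<bullet> s k\<close> is symmetric in i, j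
  by commutativity and skew in j, k, hence zero. As the \<open>s k\<close> span, all
  \<open>a i\<close> vanish, and the rotation part of the brackets leaves only the curvature
  term.\<close>

lemma space_form_type_I:
  assumes det: "det (\<chi> i j. fst (p j) $ i) \<noteq> 0" and comm: "\<And>i j. space_form_bracket K (p i) (p j) = 0"
  shows "K = 0"
proof -
  define s a where "s i = fst (p i)" and "a i = snd (p i)" for i
  have span: "span (range s) = UNIV" using det by (simp add: span_range_iff_det s_def)
  have sym: "cross3 (a i) (s j) = cross3 (a j) (s i)" for i j
    using comm[of i j] by (simp add: space_form_bracket_def prod_eq_iff s_def a_def)
  have K: "cross3 (a i) (a j) + K *\<^sub>R cross3 (s i) (s j) = 0" for i j
    using comm[of i j] by (simp add: space_form_bracket_def prod_eq_iff s_def a_def)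
  have skew: "cross3 u v \<bullet> w = - (cross3 u w \<bullet> v)" for u v w
    by (simp add: cross3_def inner_vec_def sum_3 algebra_simps)
  have "cross3 (a i) (s j) \<bullet> s k = 0" for i j k
  proof -
    have "cross3 (a i) (s j) \<bullet> s k = - (cross3 (a k) (s i) \<bullet> s j)" using skew sym by metis
    also have "\<dots> = cross3 (a j) (s k) \<bullet> s i" using skew sym by (metis minus_minus)
    also have "\<dots> = - (cross3 (a i) (s j) \<bullet> s k)" using skew sym by metis
    finally show ?thesis by simp
  qed
  then have ortho: "orthogonal (cross3 (a i) (s j)) (s k)" for i j k by (simp add: orthogonal_def)
  have "cross3 (a i) (s j) = 0" for i j
  proof -
    have "orthogonal (cross3 (a i) (s j)) v" for v
      by (rule orthogonal_to_span[of v "range s"]) (use span ortho in auto)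
    then show ?thesis using orthogonal_self by blast
  qed
  then have orth2: "cross3 (a i) v = 0" for i v
  proof -
    have lin: "linear (\<lambda>v. cross3 (a i) v)" using bilinear_cross by (simp add: bilinear_def)
    show ?thesis
      by (rule linear_eq_0_on_span[OF lin, of "range s"]) (use span \<open>\<And>j i. cross3 (a i) (s j) = 0\<close>
          in auto)
  qed
  then have "a i = 0" for i using cross_eq_0 hat_mult vee_hat matrix_eq
    by (metis cross_zero_left)
  then have "K *\<^sub>R cross3 (s i) (s j) = 0" for i j using K[of i j] by simp
  moreover have "cross3 (s 1) (s 2) \<noteq> 0"
  proof
    assume "cross3 (s 1) (s 2) = 0"
    then have "cross3 (s 1) (s 2) $ 1 = 0" "cross3 (s 1) (s 2) $ 2 = 0" "cross3 (s 1) (s 2) $ 3 = 0"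
        by simp_all
    then have "det (\<chi> i j. s j $ i) = 0"
      unfolding cross3_def det_3 by (simp add: algebra_simps) algebra
    with det show False by (simp add: s_def)
  qed
  ultimately show ?thesis by (metis scaleR_eq_0_iff)
qed

text \<open>For \<open>K \<ge> 0\<close> the form \<open>K * fst p \<bullet> fst p + snd p \<bullet> snd p\<close> is invariant and positive
  semidefinite, which leaves no room for real eigenvectors of the adjoint action.\<close>

lemma space_form_type_V:
  assumes "space_form_bracket K p q = - q" "fst q \<noteq> 0"
  shows "K < 0"
proof (rule ccontr)
  assume "\<not> K < 0"
  define s a t b where "s = fst p" and "a = snd p" and "t = fst q" and "b = snd q"
  have 1: "cross3 a t - cross3 b s = - t" and 2: "cross3 a b + K *\<^sub>R cross3 s t = - b"
    using assms(1) by (simp_all add: space_form_bracket_def prod_eq_iff s_def a_def t_def b_def)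
  \<comment> \<open>Invariance of the form: the bracket of \<open>p\<close> and \<open>q\<close> is
    orthogonal to \<open>q\<close>.\<close>
  have "K * ((cross3 a t - cross3 b s) \<bullet> t) + (cross3 a b + K *\<^sub>R cross3 s t) \<bullet> b = 0"
    by (simp add: cross3_def inner_vec_def sum_3 algebra_simps)
  then have "K * (t \<bullet> t) + b \<bullet> b = 0" unfolding 1 2 by simp
  moreover have "0 \<le> K * (t \<bullet> t)" "0 \<le> b \<bullet> b" using \<open>\<not> K < 0\<close> by simp_all
  ultimately have "b \<bullet> b = 0" by linarith
  \<comment> \<open>What remains is a cross product with eigenvalue -1, although it is orthogonal to
    its argument.\<close>
  then have "cross3 a t = - t" using 1 by simp
  then have "t \<bullet> t = - (cross3 a t \<bullet> t)" by simp
  then have "t \<bullet> t = 0" by (simp add: dot_cross_self)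
  then show False using assms(2) by (simp add: t_def)
qed

section \<open>Frames inside a six-dimensional algebra\<close>

context riemannian_3manifold
begin

text \<open>The frame consists of the first three of six basis fields, so pulling their coordinate
  vectors back by \<open>F\<close> yields three pairs with the same brackets. The sign of
  \<open>K\<close> can then be decided in the model.\<close>

lemma G6_containing_frame:
  fixes B :: "6 \<Rightarrow> ('m, 3) vfield"
  assumes basis: "killing_algebra_basis A g N B" and c: "c \<in> A" and x: "x \<in> coords c N"
    and trans: "transitive_on A N (tri (B 1) (B 2) (B 3))"
    and br: "\<And>i j. vf_eq_on A N (lie_bracket (tri (B 1) (B 2) (B 3) i) (tri (B 1) (B 2) (B 3) j))
        (vf_comb (C i j) (tri (B 1) (B 2) (B 3)))"
  obtains K p where "scalar_curvature (g c) x = 6 * K" "det (\<chi> i j. fst (p j) $ i) \<noteq> 0"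
    "\<And>i j. space_form_bracket K (p i) (p j) = (\<Sum>k\<in>UNIV. C i j k *\<^sub>R p k)"
proof -
  obtain K E F where F: "bij F" "linear F" "det E \<noteq> 0" "scalar_curvature (g c) x = 6 * K"
    "\<And>p q. vf_eq_on A N (lie_bracket (vf_vec B (F p)) (vf_vec B (F q))) (vf_vec B (F
        (space_form_bracket K p q)))"
    "\<And>s. vf_vec B (F s) c x = E *v fst s"
    using killing_algebra6_structure[OF basis c x] by metis
  define e :: "3 \<Rightarrow> real^6" where "e = tri (axis 1 1) (axis 2 1) (axis 3 1)"
  define p where "p i = inv F (e i)" for i
  have Fp: "F (p i) = e i" for i using F(1) by (simp add: p_def bij_def surj_f_inv_f)
  have Be: "vf_vec B (e i) = tri (B 1) (B 2) (B 3) i" for i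
    using exhaust_3[of i] by (auto simp: e_def vf_vec_axis)
  have "(\<chi> i j. tri (B 1) (B 2) (B 3) j c x $ i) = E ** (\<chi> i j. fst (p j) $ i)"
    using F(6)[of "p _"] by (simp add: Fp Be vec_eq_iff matrix_matrix_mult_def matrix_vector_mult_def)
  moreover have "det (\<chi> i j. tri (B 1) (B 2) (B 3) j c x $ i) \<noteq> 0"
    using trans c x by (simp add: transitive_on_def span_range_iff_det)
  ultimately have "det (\<chi> i j. fst (p j) $ i) \<noteq> 0" by (auto simp: det_mul)
  moreover have "space_form_bracket K (p i) (p j) = (\<Sum>k\<in>UNIV. C i j k *\<^sub>R p k)" for i j
  proof -
    let ?z = "F (space_form_bracket K (p i) (p j))" and ?w = "\<Sum>k\<in>UNIV. C i j k *\<^sub>R e k"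
    have w: "vf_vec B ?w = vf_comb (C i j) (tri (B 1) (B 2) (B 3))"
      by (rule ext)+ (simp add: vf_comb_def sum_3 vf_vec_linear Be)
    have "vf_eq_on A N (vf_vec B ?z) (vf_vec B ?w)"
      using F(5)[of "p i" "p j"] br[of i j] vf_eq_on_trans[OF vf_eq_on_sym] by (simp add: Fp Be w) blast
    \<comment> \<open>Equal fields have equal coordinates by independence of the basis; injectivity
      of \<open>F\<close> then compares the pairs.\<close>
    then have "vf_eq_on A N (vf_vec B (?z + (-1) *\<^sub>R ?w)) vf_zero"
      by (simp only: vf_eq_on_def vf_vec_linear) simp
    then have "\<forall>k. (?z + (-1) *\<^sub>R ?w) $ k = 0"
      using basis unfolding killing_algebra_basis_def vf_vec_def by blast
    then have "?z = ?w" by (simp add: vec_eq_iff)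
    also have "?w = F (\<Sum>k\<in>UNIV. C i j k *\<^sub>R p k)"
      by (simp add: linear_sum[OF F(2)] linear_scale[OF F(2)] Fp)
    finally show ?thesis using F(1) by (simp add: bij_def inj_eq)
  qed
  ultimately show ?thesis using that F(4) by blast
qed

lemma killing_frame_near:
  assumes "open W" "\<And>i. killing_field_on A g W (\<xi> i)" "transitive_on A W \<xi>" "p \<in> W"
    and "\<And>i j. vf_eq_on A W (lie_bracket (\<xi> i) (\<xi> j)) (vf_comb (C i j) \<xi>)"
  obtains N c z r where "killing_frame A g N \<xi> C c z r" "p \<in> N" "chart_inv c z = p"
proof -
  obtain c where c: "c \<in> A" "p \<in> fst c" using chart_cover by blast
  obtain r where r: "r > 0" "cball (snd c p) r \<subseteq> coords c W" "p \<in> chart_ball c (snd c p) r"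
    using chart_ball_exists[OF c(1) assms(1,4) c(2)] by blast
  then have "ball (snd c p) r \<subseteq> coords c W" using ball_subset_cball by blast
  note N = chart_ball[OF c(1) this]
  have "killing_frame A g (chart_ball c (snd c p) r) \<xi> C c (snd c p) r"
  proof unfold_locales
    show "transitive_on A (chart_ball c (snd c p) r) \<xi>"
      using assms(3) coords_mono[OF N(3)] unfolding transitive_on_def by blast
  qed (use N c r assms vf_eq_on_subset[OF assms(5) N(3)] killing_field_on_subset[OF assms(2) N(3)]
      in blast)+
  then show ?thesis using that r(3) chart_inv_snd[OF c] by blast
qed

end

section \<open>Normalising the frame at the centre\<close>

context killing_frame
begin

lemma center_N: "chart_inv c z \<in> N"
  using r by (simp add: ball_N)

lemma gram_center: "transpose (\<chi> i j. gram i j q) = (\<chi> i j. gram i j q)"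
  "v \<noteq> 0 \<Longrightarrow> v \<bullet> ((\<chi> i j. gram i j q) *v v) > 0" if q: "q \<in> N"
proof -
  show "transpose (\<chi> i j. gram i j q) = (\<chi> i j. gram i j q)"
    using gram_sym[OF q] by (simp add: transpose_def)
  assume v: "v \<noteq> 0"
  interpret l: local_metric "coords c N" "g c" by (rule local_metric[OF c N(1)])
  have x: "snd c q \<in> coords c N" using q N(3) by (intro coordsI) auto
  let ?M = "\<chi> i j. \<xi> j c (snd c q) $ i"
  have "?M *v v \<noteq> 0"
    using det_\<xi>[OF c x] v by (metis invertible_det_nz invertible_left_inverse
        matrix_left_invertible_ker)
  then have "(?M *v v) \<bullet> (g c (snd c q) *v (?M *v v)) > 0" by (rule l.pos_G[OF x])
  also have "(?M *v v) \<bullet> (g c (snd c q) *v (?M *v v)) = v \<bullet> ((\<chi> i j. gram i j q) *v v)"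
    unfolding gram_def by (simp add: inner_vec_def matrix_vector_mult_def sum_3 algebra_simps)
  finally show "v \<bullet> ((\<chi> i j. gram i j q) *v v) > 0" .
qed

text \<open>The columns of \<open>E\<close> hold the coefficients of the new fields.
  \<open>C'\<close> says that the linear map \<open>E\<close> takes brackets with constants
  \<open>C'\<close> to those with constants \<open>C\<close>; the Gram matrix changes by
  congruence.\<close>

lemma frame_change:
  assumes E: "det E \<noteq> 0"
    and C': "\<And>a b k. (\<Sum>i\<in>UNIV. \<Sum>j\<in>UNIV. E $ i $ a * E $ j $ b * C i j k) = (\<Sum>m\<in>UNIV. C' a b m * E $
        k $ m)"
  shows "killing_frame A g N (\<lambda>j. vf_comb (\<lambda>i. E $ i $ j) \<xi>) C' c z r"
    and "killing_frame.gram g (\<lambda>j. vf_comb (\<lambda>i. E $ i $ j) \<xi>) c a b q =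
      (transpose E ** (\<chi> i j. gram i j q) ** E) $ a $ b"
proof -
  let ?\<eta> = "\<lambda>j. vf_comb (\<lambda>i. E $ i $ j) \<xi>"
  have det: "det (\<chi> i j. ?\<eta> j d y $ i) = det (\<chi> i j. \<xi> j d y $ i) * det E" for d y
  proof -
    have "(\<chi> i j. ?\<eta> j d y $ i) = (\<chi> i j. \<xi> j d y $ i) ** E"
      by (simp add: vf_comb_def matrix_matrix_mult_def vec_eq_iff mult.commute)
    then show ?thesis by (simp add: det_mul)
  qed
  show kf: "killing_frame A g N ?\<eta> C' c z r"
  proof unfold_locales
    show "transitive_on A N ?\<eta>"
      using det_\<xi> E by (simp add: transitive_on_def span_range_iff_det det)
    show "vf_eq_on A N (lie_bracket (?\<eta> a) (?\<eta> b)) (vf_comb (C' a b) ?\<eta>)" for a b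
      unfolding vf_eq_on_def
    proof (intro ballI)
      fix d y assume d: "d \<in> A" "y \<in> coords d N"
      have "lie_bracket (?\<eta> a) (?\<eta> b) d y = (\<Sum>i\<in>UNIV. \<Sum>j\<in>UNIV. (E $ i $ a * E $ j $ b) *\<^sub>R
          local_bracket (\<xi> i d) (\<xi> j d) y)"
        unfolding lie_bracket_local vf_comb_def
        by (rule local_bracket_comb) (use \<xi>_differentiable[OF d] in auto)
      also have "\<dots> = (\<Sum>i\<in>UNIV. \<Sum>j\<in>UNIV. (E $ i $ a * E $ j $ b) *\<^sub>R vf_comb (C i j) \<xi> d y)"
        using br d by (simp add: vf_eq_on_def lie_bracket_local)
      also have "\<dots> = (\<Sum>k\<in>UNIV. (\<Sum>i\<in>UNIV. \<Sum>j\<in>UNIV. E $ i $ a * E $ j $ b * C i j k) *\<^sub>R \<xi> k d y)"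
        by (simp add: vf_comb_def sum_3 vec_eq_iff algebra_simps)
      also have "\<dots> = vf_comb (C' a b) ?\<eta> d y"
        unfolding C' by (simp add: vf_comb_def sum_3 vec_eq_iff algebra_simps)
      finally show "lie_bracket (?\<eta> a) (?\<eta> b) d y = vf_comb (C' a b) ?\<eta> d y" .
    qed
  qed (use c N r killing_field_on_comb[OF N(1) kill] in auto)
  show "killing_frame.gram g ?\<eta> c a b q = (transpose E ** (\<chi> i j. gram i j q) ** E) $ a $ b"
    unfolding killing_frame.gram_def[OF kf] gram_def
    by (simp add: vf_comb_def inner_vec_def matrix_vector_mult_def matrix_matrix_mult_def
        transpose_def sum_3 algebra_simps)
qed

lemma fd_minus: "fd f F \<Longrightarrow> fd (\<lambda>q. - f q) (\<lambda>a q. - F a q)"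
  using fd_mult[OF fd_const[of "-1"], of f F] by simp

text \<open>Differentiating a relation that holds throughout \<open>N\<close> yields further
  relations; the independence proofs extract coefficients in this way.\<close>

lemma fd_zero:
  assumes "fd f F" "\<And>q. q \<in> N \<Longrightarrow> f q = 0" "q \<in> N"
  shows "F a q = 0"
proof -
  have y: "snd c q \<in> coords c N" "chart_inv c (snd c q) = q" using assms(3) N(3) by (auto intro:
      coordsI chart_inv_snd[OF c])
  have "partial k (\<lambda>y. f (chart_inv c y)) (snd c q) = 0" for k
    using partial_cong[OF open_N[OF c] y(1), of "\<lambda>y. f (chart_inv c y)" "\<lambda>y. 0"] assms(2)
        chart_inv_N[OF c] by simp
  then show ?thesis using fd_derivative[OF assms(1) c y(1), of a] y(2) by simp
qed

lemma fd_exp: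
  assumes u: "fd u (\<lambda>a q. \<kappa> a)"
  shows "fd (\<lambda>q. exp (u q)) (\<lambda>a q. \<kappa> a * exp (u q))"
proof (rule fdI)
  fix x assume x: "x \<in> ball z r"
  then have xN: "x \<in> coords c N" using N(4) by simp
  let ?u = "\<lambda>y. u (chart_inv c y)"
  note d = fd_differentiable[OF u c xN]
  have D: "((\<lambda>y. exp (?u y)) has_derivative (\<lambda>v. exp (?u x) * (\<Sum>k\<in>UNIV. v $ k * partial k ?u x)))
      (at x)"
    using has_derivative_partial[OF d] by (auto intro!: derivative_eq_intros)
  then show d': "(\<lambda>y. exp (?u y)) differentiable (at x)" by (auto simp: differentiable_def)
  show "(\<Sum>k\<in>UNIV. \<xi> a c x $ k * partial k (\<lambda>y. exp (?u y)) x) = \<kappa> a * exp (?u x)" for a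
    using frechet_derivative_partial[OF d', of "\<xi> a c x"] frechet_derivative_eqI[OF D]
        fd_derivative[OF u c xN, of a]
    by (simp add: mult.commute)
next
  fix d k a assume d: "d \<in> A" and e: "Ck_on k (coords d N) (\<lambda>y. exp (u (chart_inv d y)))"
  show "Ck_on k (coords d N) (\<lambda>y. \<kappa> a * exp (u (chart_inv d y)))"
    using Ck_on_scaleR[OF open_N[OF d] Ck_on_const[OF open_N[OF d]] e] by simp
qed

end

text \<open>An entry \<open>(i, j, m, a)\<close> of the list contributes \<open>a *\<^sub>R B m\<close> to the bracket of \<open>B i\<close> and \<open>B j\<close>.\<close>

definition structure_table :: "(6 \<times> 6 \<times> 6 \<times> real) list \<Rightarrow> 6 \<Rightarrow> 6 \<Rightarrow> 6 \<Rightarrow> real" where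
  "structure_table es k l n = (\<Sum>(i, j, m, a)\<leftarrow>es.
     if m = n then if i = k \<and> j = l then a else if i = l \<and> j = k then - a else 0 else 0)"

text \<open>The algebra of E(3): translations 1, 2, 3 and rotations 4, 5, 6 about the corresponding
  axes.\<close>

definition table_I :: "6 \<Rightarrow> 6 \<Rightarrow> 6 \<Rightarrow> real" where
  "table_I = structure_table
    [(1,5,3,-1), (1,6,2,1), (2,4,3,1), (2,6,1,-1), (3,4,2,-1),
     (3,5,1,1), (4,5,6,-1), (5,6,4,-1), (6,4,5,-1)]"

text \<open>Vanishing brackets make the Gram functions constant and the dual one-forms closed. Their
  potentials \<open>x i\<close> are Cartesian coordinates around the centre, in which the missing
  fields are the rotations.\<close>

lemma (in killing_frame) type_I_algebra6:
  assumes C: "\<And>i j k. C i j k = 0" and gram0: "\<And>a b. gram a b (chart_inv c z) = (if a = b then 1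
      else 0)"
  obtains B :: "6 \<Rightarrow> ('m, 3) vfield" where "killing_algebra_basis A g N B" "tri (B 1) (B 2) (B 3) = \<xi>"
proof -
  define \<delta> where "\<delta> i = (\<lambda>(a::3) (q::'m). if a = i then 1 else 0 :: real)" for i
  have gram: "gram a b q = (if a = b then 1 else 0)" if "q \<in> N" for a b q
    using fd_constant[OF fd_gram[of a b] _ that] gram0 by (simp add: C)
  have "\<exists>f. fd f (\<delta> i) \<and> f (chart_inv c z) = 0" for i
  proof -
    have *: "fd (\<delta> i b) (\<lambda>a q. 0)" for b unfolding \<delta>_def by (rule fd_const)
    show ?thesis
    proof (rule fd_potential[where F = "\<delta> i" and dF = "\<lambda>b a q. 0", OF *])
      show "0 - 0 = (\<Sum>k\<in>UNIV. C a b k * \<delta> i k q)" for a b q by (simp add: C)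
    qed blast
  qed
  then obtain x where x: "\<And>i. fd (x i) (\<delta> i)" "\<And>i. x i (chart_inv c z) = 0" by metis
  let ?k = "\<lambda>c q. c :: real" and ?z = "\<lambda>a q. 0 :: real"
  define \<phi> where "\<phi> = hexa (tri (?k 1) (?k 0) (?k 0)) (tri (?k 0) (?k 1) (?k 0)) (tri (?k 0) (?k 0)
      (?k 1))
    (tri (?k 0) (\<lambda>q. - x 3 q) (x 2)) (tri (x 3) (?k 0) (\<lambda>q. - x 1 q)) (tri (\<lambda>q. - x 2 q) (x 1) (?k 0))"
  define d\<phi> where "d\<phi> = hexa (tri ?z ?z ?z) (tri ?z ?z ?z) (tri ?z ?z ?z)
    (tri ?z (\<lambda>a q. - \<delta> 3 a q) (\<delta> 2)) (tri (\<delta> 3) ?z (\<lambda>a q. - \<delta> 1 a q)) (tri (\<lambda>a q. - \<delta> 2 a q) (\<delta> 1) ?z)"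
  have fd\<phi>: "fd (\<phi> k i) (d\<phi> k i)" for k i
    using exhaust_6[of k] exhaust_3[of i] by (elim disjE) (simp_all add: \<phi>_def d\<phi>_def fd_const x
        fd_minus)
  have basis: "killing_algebra_basis A g N (\<lambda>k. field_of (\<phi> k))"
  proof (rule killing_algebra_of_functions[OF fd\<phi>])
    fix k q a b assume q: "q \<in> N"
    show "(\<Sum>i\<in>UNIV. d\<phi> k i a q * gram i b q + d\<phi> k i b q * gram i a q) = 0"
      using exhaust_6[of k] exhaust_3[of a] exhaust_3[of b]
      by (elim disjE) (simp_all add: d\<phi>_def sum_3 gram[OF q] \<delta>_def)
  next
    fix k l
    have "(\<Sum>a\<in>UNIV. \<phi> k a q * d\<phi> l m a q - \<phi> l a q * d\<phi> k m a q)
     + (\<Sum>i\<in>UNIV. \<Sum>j\<in>UNIV. \<phi> k i q * \<phi> l j q * C i j m) = (\<Sum>n\<in>UNIV. table_I k l n * \<phi> n m q)" for q m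
      using exhaust_6[of k] exhaust_6[of l] exhaust_3[of m]
      by (elim disjE) (simp_all add: \<phi>_def d\<phi>_def sum_3 sum_6 \<delta>_def C table_I_def structure_table_def)
    then show "\<exists>\<alpha>. \<forall>q\<in>N. \<forall>m. (\<Sum>a\<in>UNIV. \<phi> k a q * d\<phi> l m a q - \<phi> l a q * d\<phi> k m a q)
     + (\<Sum>i\<in>UNIV. \<Sum>j\<in>UNIV. \<phi> k i q * \<phi> l j q * C i j m) = (\<Sum>n\<in>UNIV. \<alpha> n * \<phi> n m q)"
      by blast
  next
    fix \<alpha> :: "6 \<Rightarrow> real" assume "\<And>q m. q \<in> N \<Longrightarrow> (\<Sum>n\<in>UNIV. \<alpha> n * \<phi> n m q) = 0"
    then have eq: "(\<Sum>n\<in>UNIV. \<alpha> n * \<phi> n m q) = 0" if "q \<in> N" for q m using that by blast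
    \<comment> \<open>At the centre the rotations vanish, which isolates the translation
      coefficients.\<close>
    have 0: "\<alpha> 1 = 0" "\<alpha> 2 = 0" "\<alpha> 3 = 0"
      using eq[OF center_N, of 1] eq[OF center_N, of 2] eq[OF center_N, of 3]
      by (simp_all add: \<phi>_def sum_6 x(2))
    \<comment> \<open>The first component vanishes throughout \<open>N\<close>; its derivatives
      along the third and second frame field isolate the two coefficients.\<close>
    have "fd (\<lambda>q. \<alpha> 5 * x 3 q + - (\<alpha> 6 * x 2 q)) (\<lambda>a q. (0 * x 3 q + \<alpha> 5 * \<delta> 3 a q) + - (0 * x 2 q +
        \<alpha> 6 * \<delta> 2 a q))"
      by (intro fd_add fd_minus fd_mult fd_const x)
    from fd_zero[OF this _ center_N, of 3] fd_zero[OF this _ center_N, of 2]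
    have 1: "\<alpha> 5 = 0" "\<alpha> 6 = 0"
      using eq[of _ 1] by (simp_all add: \<phi>_def sum_6 0 \<delta>_def)
    have "fd (\<lambda>q. \<alpha> 4 * x 2 q) (\<lambda>a q. 0 * x 2 q + \<alpha> 4 * \<delta> 2 a q)"
      by (intro fd_mult fd_const x)
    from fd_zero[OF this _ center_N, of 2]
    have "\<alpha> 4 = 0" using eq[of _ 3] by (simp add: \<phi>_def sum_6 0 1 \<delta>_def)
    with 0 1 show "\<forall>n. \<alpha> n = 0" by (simp add: forall_6)
  qed
  have "tri (field_of (\<phi> 1)) (field_of (\<phi> 2)) (field_of (\<phi> 3)) i d y = \<xi> i d y" for i d y
    using exhaust_3[of i] by (auto simp: field_of_def \<phi>_def sum_3)
  then have "tri (field_of (\<phi> 1)) (field_of (\<phi> 2)) (field_of (\<phi> 3)) = \<xi>" by blast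
  with basis show ?thesis using that by blast
qed

definition bianchi_V_constants :: "3 \<Rightarrow> 3 \<Rightarrow> 3 \<Rightarrow> real" where
  "bianchi_V_constants = tri (tri (tri 0 0 0) (tri 0 0 0) (tri 1 0 0)) (tri (tri 0 0 0) (tri 0 0 0)
      (tri 0 1 0))
     (tri (tri (-1) 0 0) (tri 0 (-1) 0) (tri 0 0 0))"

text \<open>so(3,1) as the conformal algebra of the boundary plane: translations 1 and 2, dilation
  3, rotation 4, special conformal fields 5 and 6.\<close>

definition table_V :: "6 \<Rightarrow> 6 \<Rightarrow> 6 \<Rightarrow> real" where
  "table_V = structure_table
    [(2,3,2,1), (3,1,1,-1), (1,4,2,1), (2,4,1,-1), (1,5,3,2), (2,5,4,2),
     (3,5,5,1), (1,6,4,-2), (2,6,3,2), (3,6,6,1), (4,5,6,-1), (4,6,5,1)]"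

text \<open>With \<open>y = exp u\<close>, \<open>V = y * v\<close> and \<open>W = y * w\<close> the metric of the following lemma is
  \<open>l * (dy\<^sup>2 + dV\<^sup>2 + dW\<^sup>2) / y\<^sup>2\<close>, that of the half-space model, with \<open>\<xi> 1 = \<partial>\<^sub>V\<close>, \<open>\<xi> 2 = \<partial>\<^sub>W\<close> and
  \<open>\<xi> 3 = y \<partial>\<^sub>y + V \<partial>\<^sub>V + W \<partial>\<^sub>W\<close>. The remaining Killing fields are the rotation
  \<open>V \<partial>\<^sub>W - W \<partial>\<^sub>V\<close> and the special conformal fields.\<close>

lemma (in killing_frame) type_V_algebra6:
  assumes C: "C = bianchi_V_constants" and gram0: "\<And>a b. gram a b (chart_inv c z) = (if a = b then l
      else 0)"
  obtains B :: "6 \<Rightarrow> ('m, 3) vfield" where "killing_algebra_basis A g N B" "tri (B 1) (B 2) (B 3) = \<xi>"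
proof -
  note C_simps = C bianchi_V_constants_def
  let ?k = "\<lambda>c q. c :: real" and ?z = "\<lambda>a q. 0 :: real"
  have fdk: "fd (tri (?k k1) (?k k2) (?k k3) b) ?z" for k1 k2 k3 b
    using exhaust_3[of b] fd_const by auto
  \<comment> \<open>No bracket has a component along \<open>\<xi> 3\<close>, so its dual form is
    closed; \<open>u\<close> is the logarithm of the height.\<close>
  obtain u where u: "fd u (tri (?k 0) (?k 0) (?k 1))" "u (chart_inv c z) = 0"
  proof (rule fd_potential[where dF = "\<lambda>b a q. 0", OF fdk[of 0 0 1]])
    show "0 - 0 = (\<Sum>k\<in>UNIV. C a b k * tri (?k 0) (?k 0) (?k 1) k q)" for a b q
      using exhaust_3[of a] exhaust_3[of b] by (elim disjE) (simp_all add: C_simps sum_3)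
  qed
  have u': "fd u (\<lambda>a q. tri 0 0 1 a)"
    using fd_cong[OF u(1), of "\<lambda>a q. tri 0 0 1 a"] exhaust_3 by (metis tri_simps)
  define y iy where "y q = exp (u q)" and "iy q = exp (- u q)" for q
  have y: "fd y (tri (?k 0) (?k 0) y)"
  proof (rule fd_cong[OF fd_exp[OF u', folded y_def]])
    show "tri 0 0 1 a * y q = tri (?k 0) (?k 0) y a q" for a q using exhaust_3[of a] by auto
  qed
  have iy: "fd iy (tri (?k 0) (?k 0) (\<lambda>q. - iy q))"
  proof (rule fd_cong[OF fd_exp[OF fd_minus[OF u'], folded iy_def]])
    show "- tri 0 0 1 a * iy q = tri (?k 0) (?k 0) (\<lambda>q. - iy q) a q" for a q using exhaust_3[of a]
        by auto
  qed
  have yiy: "y q * iy q = 1" "y q \<noteq> 0" "iy q \<noteq> 0" for q by (simp_all add: y_def iy_def exp_minus)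
  have y0: "y (chart_inv c z) = 1" "iy (chart_inv c z) = 1" by (simp_all add: y_def iy_def u(2))
  have fd_iy_b: "fd (tri iy (?k 0) (?k 0) b) (tri (tri (?k 0) (?k 0) (\<lambda>q. - iy q)) ?z ?z b)"
    "fd (tri (?k 0) iy (?k 0) b) (tri ?z (tri (?k 0) (?k 0) (\<lambda>q. - iy q)) ?z b)" for b
    using exhaust_3[of b] fd_const iy by auto
  \<comment> \<open>The factor 1/y compensates the scaling of \<open>\<xi> 1\<close> by
    \<open>\<xi> 3\<close>, so that 1/y times its dual form is closed.\<close>
  obtain v where v: "fd v (tri iy (?k 0) (?k 0))" "v (chart_inv c z) = 0"
  proof (rule fd_potential[OF fd_iy_b(1)])
    show "tri (tri (?k 0) (?k 0) (\<lambda>q. - iy q)) ?z ?z b a q - tri (tri (?k 0) (?k 0) (\<lambda>q. - iy q)) ?z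
        ?z a b q
        = (\<Sum>k\<in>UNIV. C a b k * tri iy (?k 0) (?k 0) k q)" for a b q
      using exhaust_3[of a] exhaust_3[of b] by (elim disjE) (simp_all add: C_simps sum_3)
  qed
  obtain w where w: "fd w (tri (?k 0) iy (?k 0))" "w (chart_inv c z) = 0"
  proof (rule fd_potential[OF fd_iy_b(2)])
    show "tri ?z (tri (?k 0) (?k 0) (\<lambda>q. - iy q)) ?z b a q - tri ?z (tri (?k 0) (?k 0) (\<lambda>q. - iy q))
        ?z a b q
        = (\<Sum>k\<in>UNIV. C a b k * tri (?k 0) iy (?k 0) k q)" for a b q
      using exhaust_3[of a] exhaust_3[of b] by (elim disjE) (simp_all add: C_simps sum_3)
  qed
  note fds = fd_add fd_minus fd_mult fd_const fd_gram y iy v w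
  have cst: "f q = f (chart_inv c z)" if "q \<in> N" "fd f F" "\<And>q. q \<in> N \<Longrightarrow> F 1 q = 0 \<and> F 2 q = 0 \<and> F 3 q
      = 0" for f F q
    using fd_constant[OF that(2) _ that(1)] that(3) exhaust_3 by metis
  have half: "a = 0" if "y q * y q * a = 0" for a q using that yiy(2) by simp
  have inv: "a = b * iy q" if "y q * a = b" for a b q
    using that yiy(1)[of q] by (metis mult.assoc mult.commute mult_1)
  \<comment> \<open>Two factors \<open>y\<close> compensate the scaling along
    \<open>\<xi> 3\<close>: the product has zero frame derivatives and keeps its central
    value.\<close>
  have G11: "gram 1 1 q = l * iy q * iy q" if q: "q \<in> N" for q
  proof -
    have "y q * (y q * gram 1 1 q) = l"
      using cst[OF q fd_mult[OF y fd_mult[OF y fd_gram[of 1 1]]]]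
      by (simp add: sum_3 C_simps gram0 y0 algebra_simps)
    then show ?thesis using inv by metis
  qed
  have G22: "gram 2 2 q = l * iy q * iy q" if q: "q \<in> N" for q
  proof -
    have "y q * (y q * gram 2 2 q) = l"
      using cst[OF q fd_mult[OF y fd_mult[OF y fd_gram[of 2 2]]]]
      by (simp add: sum_3 C_simps gram0 y0 algebra_simps)
    then show ?thesis using inv by metis
  qed
  have G12: "gram 1 2 q = 0" if q: "q \<in> N" for q
  proof -
    have "y q * (y q * gram 1 2 q) = 0"
      using cst[OF q fd_mult[OF y fd_mult[OF y fd_gram[of 1 2]]]]
      by (simp add: sum_3 C_simps gram0 y0 algebra_simps)
    then show ?thesis using yiy(2)[of q] by simp
  qed
  have G21: "gram 2 1 q = 0" if q: "q \<in> N" for q using G12[OF q] gram_sym[OF q] by metis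
  \<comment> \<open>The derivative along \<open>\<xi> 1\<close> brings in \<open>gram 1 1\<close>,
    which the term \<open>l * v\<close> absorbs.\<close>
  have G13: "gram 1 3 q = l * v q * iy q" if q: "q \<in> N" for q
  proof -
    have "y q * gram 1 3 q + - (l * v q) = 0"
      using cst[OF q fd_add[OF fd_mult[OF y fd_gram[of 1 3]] fd_minus[OF fd_mult[OF fd_const[of l]
          v(1)]]]]
      by (simp add: sum_3 C_simps gram0 y0 v(2) G11 G21 G12) (metis mult.assoc mult.commute mult_1
          yiy(1))
    then have "y q * gram 1 3 q = l * v q" by simp
    then show ?thesis using inv by metis
  qed
  have G23: "gram 2 3 q = l * w q * iy q" if q: "q \<in> N" for q
  proof -
    have "y q * gram 2 3 q + - (l * w q) = 0"
      using cst[OF q fd_add[OF fd_mult[OF y fd_gram[of 2 3]] fd_minus[OF fd_mult[OF fd_const[of l]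
          w(1)]]]]
      by (simp add: sum_3 C_simps gram0 y0 w(2) G22 G21 G12) (metis mult.assoc mult.commute mult_1
          yiy(1))
    then have "y q * gram 2 3 q = l * w q" by simp
    then show ?thesis using inv by metis
  qed
  have G31: "gram 3 1 q = l * v q * iy q" and G32: "gram 3 2 q = l * w q * iy q" if q: "q \<in> N" for q
    using G13[OF q] G23[OF q] gram_sym[OF q] by metis+
  have G33: "gram 3 3 q = l * (1 + v q * v q + w q * w q)" if q: "q \<in> N" for q
  proof -
    have "gram 3 3 q + - (l * (v q * v q + w q * w q)) = l"
      using cst[OF q fd_add[OF fd_gram[of 3 3] fd_minus[OF fd_mult[OF fd_const[of l] fd_add[OF
          fd_mult[OF v(1) v(1)] fd_mult[OF w(1) w(1)]]]]]]
      by (simp add: sum_3 C_simps gram0 v(2) w(2) G13 G31 G23 G32 algebra_simps)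
    then show ?thesis by (simp add: algebra_simps)
  qed
  \<comment> \<open>\<open>S\<close> equals V^2 + W^2 + y^2, the squared Euclidean distance from the
    origin of the boundary plane.\<close>
  define V W S where "V q = y q * v q" and "W q = y q * w q" and "S q = y q * y q * (1 + v q * v q +
      w q * w q)" for q
  have V: "fd V (tri (?k 1) (?k 0) V)"
  proof (rule fd_cong[OF fd_mult[OF y v(1), folded V_def]])
    show "tri (?k 0) (?k 0) y a q * v q + y q * tri iy (?k 0) (?k 0) a q = tri (?k 1) (?k 0) V a q"
        for a q
      using exhaust_3[of a] yiy(1)[of q] by (auto simp: V_def)
  qed
  have W: "fd W (tri (?k 0) (?k 1) W)"
  proof (rule fd_cong[OF fd_mult[OF y w(1), folded W_def]])
    show "tri (?k 0) (?k 0) y a q * w q + y q * tri (?k 0) iy (?k 0) a q = tri (?k 0) (?k 1) W a q"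
        for a q
      using exhaust_3[of a] yiy(1)[of q] by (auto simp: W_def)
  qed
  have S_eq: "S = (\<lambda>q. V q * V q + W q * W q + y q * y q)" by (simp add: fun_eq_iff S_def V_def
      W_def algebra_simps)
  have S: "fd S (tri (\<lambda>q. 2 * V q) (\<lambda>q. 2 * W q) (\<lambda>q. 2 * S q))"
    unfolding S_eq
  proof (rule fd_cong[OF fd_add[OF fd_add[OF fd_mult[OF V V] fd_mult[OF W W]] fd_mult[OF y y]]])
    show "tri (?k 1) (?k 0) V a q * V q + V q * tri (?k 1) (?k 0) V a q + (tri (?k 0) (?k 1) W a q *
        W q + W q * tri (?k 0) (?k 1) W a q)
      + (tri (?k 0) (?k 0) y a q * y q + y q * tri (?k 0) (?k 0) y a q)
      = tri (\<lambda>q. 2 * V q) (\<lambda>q. 2 * W q) (\<lambda>q. 2 * (V q * V q + W q * W q + y q * y q)) a q" for a q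
      using exhaust_3[of a] by auto
  qed
  let ?dV = "tri (?k 1) (?k 0) V" and ?dW = "tri (?k 0) (?k 1) W" and ?dS = "tri (\<lambda>q. 2 * V q) (\<lambda>q.
      2 * W q) (\<lambda>q. 2 * S q)"
  \<comment> \<open>The last two are 2 V \<xi> 3 - S \<xi> 1 and 2 W \<xi> 3 - S \<xi> 2, the
    special conformal fields written in the frame.\<close>
  define \<phi> where "\<phi> = hexa (tri (?k 1) (?k 0) (?k 0)) (tri (?k 0) (?k 1) (?k 0)) (tri (?k 0) (?k 0)
      (?k 1))
    (tri (\<lambda>q. - W q) V (?k 0)) (tri (\<lambda>q. - S q) (?k 0) (\<lambda>q. V q + V q)) (tri (?k 0) (\<lambda>q. - S q) (\<lambda>q.
        W q + W q))"
  define d\<phi> where "d\<phi> = hexa (tri ?z ?z ?z) (tri ?z ?z ?z) (tri ?z ?z ?z)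
    (tri (\<lambda>a q. - ?dW a q) ?dV ?z) (tri (\<lambda>a q. - ?dS a q) ?z (\<lambda>a q. ?dV a q + ?dV a q))
    (tri ?z (\<lambda>a q. - ?dS a q) (\<lambda>a q. ?dW a q + ?dW a q))"
  have "fd (\<lambda>q. 2 * V q) (\<lambda>a q. 2 * ?dV a q)" "fd (\<lambda>q. 2 * W q) (\<lambda>a q. 2 * ?dW a q)"
    using fd_add[OF V V] fd_add[OF W W] by simp_all
  then have fd\<phi>: "fd (\<phi> k i) (d\<phi> k i)" for k i
    using exhaust_6[of k] exhaust_3[of i]
    by (elim disjE) (simp_all add: \<phi>_def d\<phi>_def fd_const fd_minus V W S)
  have basis: "killing_algebra_basis A g N (\<lambda>k. field_of (\<phi> k))"
  proof (rule killing_algebra_of_functions[OF fd\<phi>])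
    fix k q a b assume q: "q \<in> N"
    \<comment> \<open>The conformal factor l / y^2; the Gram matrix is \<open>P\<close> times a
      matrix in \<open>V\<close>, \<open>W\<close> and \<open>S\<close>.\<close>
    define P where "P = l * iy q * iy q"
    have G: "gram 1 1 q = P" "gram 2 2 q = P" "gram 1 3 q = V q * P" "gram 3 1 q = V q * P" "gram 2
        3 q = W q * P" "gram 3 2 q = W q * P"
      "gram 3 3 q = S q * P"
      unfolding P_def V_def W_def S_def G11[OF q] G22[OF q] G13[OF q] G31[OF q] G23[OF q] G32[OF q]
          G33[OF q]
      by (rule refl | use yiy(1)[of q] in algebra)+
    show "(\<Sum>i\<in>UNIV. d\<phi> k i a q * gram i b q + d\<phi> k i b q * gram i a q) = 0"
      using exhaust_6[of k] exhaust_3[of a] exhaust_3[of b]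
      by (elim disjE) (simp_all add: d\<phi>_def sum_3 G G12[OF q] G21[OF q] algebra_simps)
  next
    fix k l
    have "(\<Sum>a\<in>UNIV. \<phi> k a q * d\<phi> l m a q - \<phi> l a q * d\<phi> k m a q)
     + (\<Sum>i\<in>UNIV. \<Sum>j\<in>UNIV. \<phi> k i q * \<phi> l j q * C i j m) = (\<Sum>n\<in>UNIV. table_V k l n * \<phi> n m q)" for q m
      using exhaust_6[of k] exhaust_6[of l] exhaust_3[of m]
      by (elim disjE) (simp_all add: \<phi>_def d\<phi>_def sum_3 sum_6 C_simps table_V_def
          structure_table_def algebra_simps)
    then show "\<exists>\<alpha>. \<forall>q\<in>N. \<forall>m. (\<Sum>a\<in>UNIV. \<phi> k a q * d\<phi> l m a q - \<phi> l a q * d\<phi> k m a q)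
     + (\<Sum>i\<in>UNIV. \<Sum>j\<in>UNIV. \<phi> k i q * \<phi> l j q * C i j m) = (\<Sum>n\<in>UNIV. \<alpha> n * \<phi> n m q)"
      by blast
  next
    fix \<alpha> :: "6 \<Rightarrow> real" assume "\<And>q m. q \<in> N \<Longrightarrow> (\<Sum>n\<in>UNIV. \<alpha> n * \<phi> n m q) = 0"
    then have eq: "(\<Sum>n\<in>UNIV. \<alpha> n * \<phi> n m q) = 0" if "q \<in> N" for q m using that by blast
    have V0: "V (chart_inv c z) = 0" "W (chart_inv c z) = 0" "S (chart_inv c z) = 1"
      by (simp_all add: V_def W_def S_def v(2) w(2) y0)
    \<comment> \<open>As \<open>S\<close> is 1 at the centre, the special conformal fields do not
      vanish there, and the equations only tie coefficients 1 and 2 to 5 and 6; the derivatives of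
      the third component decide them.\<close>
    have 0: "\<alpha> 1 = \<alpha> 5" "\<alpha> 2 = \<alpha> 6" "\<alpha> 3 = 0"
      using eq[OF center_N, of 1] eq[OF center_N, of 2] eq[OF center_N, of 3]
      by (simp_all add: \<phi>_def sum_6 V0)
    have "fd (\<lambda>q. \<alpha> 5 * (V q + V q) + \<alpha> 6 * (W q + W q)) (\<lambda>a q. (0 * (V q + V q) + \<alpha> 5 * (?dV a q +
        ?dV a q)) + (0 * (W q + W q) + \<alpha> 6 * (?dW a q + ?dW a q)))"
      by (intro fd_add fd_mult fd_const V W)
    from fd_zero[OF this _ center_N, of 1] fd_zero[OF this _ center_N, of 2]
    have 1: "\<alpha> 5 = 0" "\<alpha> 6 = 0"
      using eq[of _ 3] by (simp_all add: \<phi>_def sum_6 0)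
    have "fd (\<lambda>q. \<alpha> 4 * V q) (\<lambda>a q. 0 * V q + \<alpha> 4 * ?dV a q)"
      by (intro fd_mult fd_const V)
    from fd_zero[OF this _ center_N, of 1]
    have "\<alpha> 4 = 0" using eq[of _ 2] by (simp add: \<phi>_def sum_6 0 1)
    with 0 1 show "\<forall>n. \<alpha> n = 0" by (simp add: forall_6)
  qed
  have "tri (field_of (\<phi> 1)) (field_of (\<phi> 2)) (field_of (\<phi> 3)) i d y = \<xi> i d y" for i d y
    using exhaust_3[of i] by (auto simp: field_of_def \<phi>_def sum_3)
  then have "tri (field_of (\<phi> 1)) (field_of (\<phi> 2)) (field_of (\<phi> 3)) = \<xi>" by blast
  with basis show ?thesis using that by blast
qed

section \<open>From transitive algebras of types I and V to the group and the sign of the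
  curvature\<close>

context riemannian_3manifold
begin

text \<open>Near each point \<open>frame\<close> extends a frame with constants \<open>C\<close>,
  possibly a normalisation of the given one, to six fields; the hypothesis \<open>K\<close> then
  reads off the sign condition from three pairs with these brackets.\<close>

lemma G3_curvature:
  assumes G3: "admits_transitive_G3 A g T"
    and frame: "\<And>W \<xi> p. p \<in> W \<Longrightarrow> killing_algebra_basis A g W \<xi> \<Longrightarrow> transitive_on A W \<xi> \<Longrightarrow> T A W \<xi> \<Longrightarrow>
      \<exists>N \<eta> c z r (B :: 6 \<Rightarrow> ('m, 3) vfield). killing_frame A g N \<eta> C c z r \<and> p \<in> N \<and>
          killing_algebra_basis A g N B \<and> tri (B 1) (B 2) (B 3) = \<eta>"
    and K: "\<And>K p. det (\<chi> i j. fst (p j) $ i) \<noteq> 0 \<Longrightarrow>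
      \<forall>i j. space_form_bracket K (p i) (p j) = (\<Sum>k\<in>UNIV. C i j k *\<^sub>R p k) \<Longrightarrow> R (6 * K)"
  shows "admits_G6 A g" "\<forall>c\<in>A. \<forall>x\<in>coords c UNIV. R (scalar_curvature (g c) x)"
proof -
  have ex: "\<exists>N \<eta> c z r (B :: 6 \<Rightarrow> ('m, 3) vfield). killing_frame A g N \<eta> C c z r \<and> p \<in> N \<and>
      killing_algebra_basis A g N B \<and> tri (B 1) (B 2) (B 3) = \<eta>" for p
    using G3 frame unfolding admits_transitive_G3_def by meson
  show "admits_G6 A g"
    unfolding admits_G6_def using ex by meson
  show "\<forall>c\<in>A. \<forall>x\<in>coords c UNIV. R (scalar_curvature (g c) x)"
  proof (intro ballI)
    fix d x assume d: "d \<in> A" "x \<in> coords d UNIV"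
    obtain p where p: "p \<in> fst d" "x = snd d p" using d(2) by (auto simp: coords_def)
    obtain N \<eta> c z r and B :: "6 \<Rightarrow> ('m, 3) vfield"
      where N: "killing_frame A g N \<eta> C c z r" "p \<in> N" "killing_algebra_basis A g N B" "tri (B 1) (B
          2) (B 3) = \<eta>"
      using ex by meson
    interpret f: killing_frame A g N \<eta> C c z r by (rule N(1))
    have x: "x \<in> coords d N" using p N(2) by (auto intro: coordsI)
    show "R (scalar_curvature (g d) x)"
    proof (rule G6_containing_frame[OF N(3) d(1) x, unfolded N(4), OF f.trans f.br])
      fix K q assume "scalar_curvature (g d) x = 6 * K" "det (\<chi> i j. fst (q j) $ i) \<noteq> 0"
        "\<And>i j. space_form_bracket K (q i) (q j) = (\<Sum>k\<in>UNIV. C i j k *\<^sub>R q k)"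
      then show ?thesis using K[of q K] by simp
    qed
  qed
qed

text \<open>Every linear change of frame keeps an algebra abelian, so the Gram matrix at
  \<open>p\<close> can be made the identity.\<close>

lemma type_I_frame:
  assumes "p \<in> W" "killing_algebra_basis A g W \<xi>" "transitive_on A W \<xi>" "bianchi_I A W \<xi>"
  shows "\<exists>N \<eta> c z r (B :: 6 \<Rightarrow> ('m, 3) vfield). killing_frame A g N \<eta> (\<lambda>_ _ _. 0) c z r \<and> p \<in> N \<and>
      killing_algebra_basis A g N B \<and> tri (B 1) (B 2) (B 3) = \<eta>"
proof -
  have W: "open W" "\<And>i. killing_field_on A g W (\<xi> i)" using assms(2) by (auto simp:
      killing_algebra_basis_def)
  have br: "vf_eq_on A W (lie_bracket (\<xi> i) (\<xi> j)) (vf_comb (\<lambda>_. 0) \<xi>)" for i j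
    using assms(4) by (simp add: bianchi_I_def vf_comb_def)
  obtain N c z r where N: "killing_frame A g N \<xi> (\<lambda>_ _ _. 0) c z r" "p \<in> N" "chart_inv c z = p"
    using killing_frame_near[OF W assms(3,1) br] by blast
  interpret f: killing_frame A g N \<xi> "\<lambda>_ _ _. 0" c z r by (rule N(1))
  obtain E :: "real^3^3" where E: "transpose E ** (\<chi> i j. f.gram i j p) ** E = mat 1"
    using gram_schmidt3[OF f.gram_center[OF N(2)]] by blast
  have "det E \<noteq> 0"
    using arg_cong[OF E, of det] by (auto simp: det_mul)
  let ?\<eta> = "\<lambda>j. vf_comb (\<lambda>i. E $ i $ j) \<xi>"
  have kf: "killing_frame A g N ?\<eta> (\<lambda>_ _ _. 0) c z r"
    by (rule f.frame_change(1)[OF \<open>det E \<noteq> 0\<close>]) simp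
  have gram: "killing_frame.gram g ?\<eta> c a b (chart_inv c z) = (if a = b then 1 else 0)" for a b
    using f.frame_change(2)[OF \<open>det E \<noteq> 0\<close>, of "\<lambda>_ _ _. 0"] by (simp add: E N(3) mat_def)
  interpret k: killing_frame A g N ?\<eta> "\<lambda>_ _ _. 0" c z r by (rule kf)
  obtain B :: "6 \<Rightarrow> ('m, 3) vfield" where "killing_algebra_basis A g N B" "tri (B 1) (B 2) (B 3) = ?\<eta>"
    using k.type_I_algebra6[OF refl gram] by blast
  with kf N(2) show ?thesis by blast
qed

text \<open>An upper triangular change of frame keeps the ideal spanned by the first two fields, on
  which the third acts as a scalar; the brackets survive once the last diagonal entry is 1.\<close>

lemma type_V_frame:
  assumes "p \<in> W" "killing_algebra_basis A g W \<xi>" "transitive_on A W \<xi>" "bianchi_V A W \<xi>"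
  shows "\<exists>N \<eta> c z r (B :: 6 \<Rightarrow> ('m, 3) vfield). killing_frame A g N \<eta> bianchi_V_constants c z r \<and> p \<in>
      N \<and> killing_algebra_basis A g N B \<and> tri (B 1) (B 2) (B 3) = \<eta>"
proof -
  have W: "open W" "\<And>i. killing_field_on A g W (\<xi> i)" using assms(2) by (auto simp:
      killing_algebra_basis_def)
  have br: "vf_eq_on A W (lie_bracket (\<xi> i) (\<xi> j)) (vf_comb (bianchi_V_constants i j) \<xi>)" for i j
    unfolding vf_eq_on_def
  proof (intro ballI)
    fix c x assume c: "c \<in> A" "x \<in> coords c W"
    then have "lie_bracket (\<xi> 1) (\<xi> 2) c x = 0" "lie_bracket (\<xi> 2) (\<xi> 3) c x = \<xi> 2 c x" "lie_bracket
        (\<xi> 3) (\<xi> 1) c x = - \<xi> 1 c x"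
      using assms(4) by (simp_all add: bianchi_V_def vf_eq_on_def)
    then show "lie_bracket (\<xi> i) (\<xi> j) c x = vf_comb (bianchi_V_constants i j) \<xi> c x"
      using exhaust_3[of i] exhaust_3[of j] lie_bracket_swap[of "\<xi> 2" "\<xi> 1" c x] lie_bracket_swap[of
          "\<xi> 3" "\<xi> 2" c x]
        lie_bracket_swap[of "\<xi> 1" "\<xi> 3" c x]
      by (elim disjE) (simp_all add: bianchi_V_constants_def vf_comb_tri lie_bracket_self)
  qed
  obtain N c z r where N: "killing_frame A g N \<xi> bianchi_V_constants c z r" "p \<in> N" "chart_inv c z = p"
    using killing_frame_near[OF W assms(3,1) br] by blast
  interpret f: killing_frame A g N \<xi> bianchi_V_constants c z r by (rule N(1))
  obtain E0 :: "real^3^3" where E0: "transpose E0 ** (\<chi> i j. f.gram i j p) ** E0 = mat 1" "E0 $ 2 $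
      1 = 0" "E0 $ 3 $ 1 = 0" "E0 $ 3 $ 2 = 0"
    "E0 $ 1 $ 1 > 0" "E0 $ 2 $ 2 > 0" "E0 $ 3 $ 3 > 0"
    by (rule gram_schmidt3[OF f.gram_center[OF N(2)]])
  \<comment> \<open>Normalises the last diagonal entry at the price of a Gram matrix
    \<open>s * s\<close> times the identity, the constant \<open>l\<close> of
    \<open>type_V_algebra6\<close>.\<close>
  define s where "s = 1 / E0 $ 3 $ 3"
  define E where "E = s *\<^sub>R E0"
  have s: "s \<noteq> 0" "s * E0 $ 3 $ 3 = 1" using E0(7) by (simp_all add: s_def)
  have tri: "E $ 2 $ 1 = 0" "E $ 3 $ 1 = 0" "E $ 3 $ 2 = 0" "E $ 3 $ 3 = 1" using E0 s by (simp_all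
      add: E_def)
  have "det E0 \<noteq> 0" using arg_cong[OF E0(1), of det] by (auto simp: det_mul)
  then have E: "det E \<noteq> 0" using s(1) by (simp add: E_def det_3 algebra_simps) algebra
  have C: "(\<Sum>i\<in>UNIV. \<Sum>j\<in>UNIV. E $ i $ a * E $ j $ b * bianchi_V_constants i j k) = (\<Sum>m\<in>UNIV.
      bianchi_V_constants a b m * E $ k $ m)" for a b k
    using exhaust_3[of a] exhaust_3[of b] exhaust_3[of k]
    by (elim disjE) (simp_all add: bianchi_V_constants_def sum_3 tri)
  let ?\<eta> = "\<lambda>j. vf_comb (\<lambda>i. E $ i $ j) \<xi>"
  have kf: "killing_frame A g N ?\<eta> bianchi_V_constants c z r"
    by (rule f.frame_change(1)[OF E C])
  have "transpose E ** (\<chi> i j. f.gram i j p) ** E = (s * s) *\<^sub>R (transpose E0 ** (\<chi> i j. f.gram i j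
      p) ** E0)"
    by (simp add: E_def matrix_matrix_mult_def transpose_def vec_eq_iff sum_distrib_left
        sum_distrib_right mult_ac)
  then have gram: "killing_frame.gram g ?\<eta> c a b (chart_inv c z) = (if a = b then s * s else 0)" for a b
    unfolding f.frame_change(2)[OF E C] N(3) by (simp add: E0(1) mat_def)
  interpret k: killing_frame A g N ?\<eta> bianchi_V_constants c z r by (rule kf)
  obtain B :: "6 \<Rightarrow> ('m, 3) vfield" where "killing_algebra_basis A g N B" "tri (B 1) (B 2) (B 3) = ?\<eta>"
    using k.type_V_algebra6[OF refl gram] by blast
  with kf N(2) show ?thesis by blast
qed

lemma type_I_flat:
  assumes "admits_transitive_G3 A g bianchi_I"
  shows "admits_G6 A g" "\<forall>c\<in>A. \<forall>x\<in>coords c UNIV. scalar_curvature (g c) x = 0"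
proof -
  have K: "6 * K = 0" if "det (\<chi> i j. fst (p j) $ i) \<noteq> 0"
    "\<forall>i j. space_form_bracket K (p i) (p j) = (\<Sum>k\<in>UNIV. 0 *\<^sub>R p k)" for K :: real and p :: "3 \<Rightarrow>
        (real^3) \<times> (real^3)"
    using space_form_type_I[OF that(1), of K] that(2) by simp
  show "admits_G6 A g"
    by (rule G3_curvature(1)[where R = "\<lambda>r. r = 0", OF assms type_I_frame K])
  show "\<forall>c\<in>A. \<forall>x\<in>coords c UNIV. scalar_curvature (g c) x = 0"
    by (rule G3_curvature(2)[where R = "\<lambda>r. r = 0", OF assms type_I_frame K])
qed

lemma type_V_negative:
  assumes "admits_transitive_G3 A g bianchi_V"
  shows "admits_G6 A g" "\<forall>c\<in>A. \<forall>x\<in>coords c UNIV. scalar_curvature (g c) x < 0"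
proof -
  have K: "6 * K < 0" if det: "det (\<chi> i j. fst (p j) $ i) \<noteq> 0"
    and br: "\<forall>i j. space_form_bracket K (p i) (p j) = (\<Sum>k\<in>UNIV. bianchi_V_constants i j k *\<^sub>R p k)"
  for K :: real and p :: "3 \<Rightarrow> (real^3) \<times> (real^3)"
  proof -
    have "space_form_bracket K (p 3) (p 1) = - p 1" using br[rule_format, of 3 1] by (simp add:
        bianchi_V_constants_def sum_3)
    moreover have "fst (p 1) \<noteq> 0" using det by (auto simp: det_3)
    ultimately show ?thesis using space_form_type_V by fastforce
  qed
  show "admits_G6 A g"
    by (rule G3_curvature(1)[where R = "\<lambda>r. r < 0", OF assms type_V_frame K])
  show "\<forall>c\<in>A. \<forall>x\<in>coords c UNIV. scalar_curvature (g c) x < 0"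
    by (rule G3_curvature(2)[where R = "\<lambda>r. r < 0", OF assms type_V_frame K])
qed

end

theorem theorem4:
  fixes A :: "('m::{t2_space, second_countable_topology}, 3) chart set"
    and g :: "('m, 3) metric"
  assumes "connected (UNIV :: 'm set)"
    and "smooth_atlas A"
    and "riemannian_metric A g"
  shows
    "((admits_G6 A g \<and> (\<forall>c\<in>A. \<forall>x\<in>coords c UNIV. scalar_curvature (g c) x = 0)
         \<longleftrightarrow> admits_transitive_G3 A g bianchi_I) \<and>
      (admits_G6 A g \<and> (\<forall>c\<in>A. \<forall>x\<in>coords c UNIV. scalar_curvature (g c) x = 0)
         \<longrightarrow> G6_locally_isomorphic A g e_3 \<and> admits_transitive_G3 A g bianchi_VII0))
     \<and>
     ((admits_G6 A g \<and> (\<forall>c\<in>A. \<forall>x\<in>coords c UNIV. scalar_curvature (g c) x < 0)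
         \<longleftrightarrow> admits_transitive_G3 A g bianchi_V) \<and>
      (admits_G6 A g \<and> (\<forall>c\<in>A. \<forall>x\<in>coords c UNIV. scalar_curvature (g c) x < 0)
         \<longrightarrow> G6_locally_isomorphic A g so_31 \<and>
             (\<forall>h>0. admits_transitive_G3 A g (bianchi_VIIh h))))
     \<and>
     (admits_G6 A g \<and> (\<forall>c\<in>A. \<forall>x\<in>coords c UNIV. scalar_curvature (g c) x > 0)
         \<longrightarrow> G6_locally_isomorphic A g so_4 \<and> admits_transitive_G3 A g bianchi_IX)"
proof -
  interpret riemannian_3manifold A g by unfold_locales (use assms in auto)
  have I: "admits_G6 A g \<and> (\<forall>c\<in>A. \<forall>x\<in>coords c UNIV. scalar_curvature (g c) x = 0) \<longleftrightarrow>
      admits_transitive_G3 A g bianchi_I"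
    using G6_flat_imp_I type_I_flat by blast
  have V: "admits_G6 A g \<and> (\<forall>c\<in>A. \<forall>x\<in>coords c UNIV. scalar_curvature (g c) x < 0) \<longleftrightarrow>
      admits_transitive_G3 A g bianchi_V"
    using G6_negative_imp_V type_V_negative by blast
  show ?thesis
    using I V G6_flat_e_3 G6_flat_imp_VII0 G6_negative_so_31 G6_negative_imp_VIIh G6_positive_so_4
        G6_positive_imp_IX
    by blast
qed

end
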